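(* Let $\mathcal{E}$ be a biordered set with underlying set $E$, and let $e\in E$ be such that $D_e=J_e$ in $\mathsf{IG}(\mathcal{E})$ and the principal factor $\overline{D}_e$ is completely $0$-simple. Then the mappings $\pi$ and $\rho$ (defined in the context) induce mutually inverse isomorphisms between the principal factor $\overline{D}_e$ and the Rees matrix semigroup $\mathcal{M}^0[H;I,J;P]$. Moreover, when $\mathcal{E}$ is finite, both of these mappings are effectively computable.
   Context: Biordered sets and $\mathsf{IG}(\mathcal{E})$. For a semigroup $S$ with set of idempotents $E$, $(e,f)\in E\times E$ is a basic pair if $\{e,f\}\cap\{ef,fe\}\neq\varnothing$; then $ef\in E$. The biordered set $\mathcal{E}$ is $E$ with the partial multiplication $e*f=ef$ on basic pairs; a biordered set is a partial algebra so arising. $\mathsf{IG}(\mathcal{E})$ is the semigroup with presentation $\langle E\mid ef=e*f\ ((e,f)\text{ a basic pair})\rangle$. Its idempotents are exactly the elements represented by letters of $E$, distinct letters represent distinct elements, and its biordered set is $\mathcal{E}$. Notation. Let $D=D_e$ be the $\mathscr{D}$-class of $e$ in $\mathsf{IG}(\mathcal{E})$ and $J_e$ its $\mathscr{J}$-class. Let $R_i$ $(i\in I)$, $L_j$ $(j\in J)$ be the $\mathscr{R}$- and $\mathscr{L}$-classes in $D$, $H_{i,j}=R_i\cap L_j$, $K=\{(i,j):H_{i,j}\text{ is a group}\}$, and for $(i,j)\in K$ let $e_{ij}$ be the idempotent in $H_{i,j}$. Assume $1\in I\cap J$ and $e=e_{11}$; put $H=H_{1,1}$. The free monoid $E^*$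 acts on $J\cup\{0\}$ (fixing $0$): for $g\in E$, $j\cdot g=l$ if $H_{1,j}g=H_{1,l}$, and $j\cdot g=0$ if there is no such $l$. Fix a Schreier system: words $r_j\in(E\cap D)^*$ $(j\in J)$ with $1\cdot r_j=j$, every prefix of every $r_j$ being some $r_l$; and words $r'_j\in(E\cap D)^*$ with $j\cdot r'_j=1$, $xr_jr'_j=x$ for $x\in H_{1,1}$, $xr'_jr_j=x$ for $x\in H_{1,j}$. (For finite $\mathcal{E}$ such words are computed algorithmically from $\mathcal{E}$.) For each $i\in I$ fix $j(i)\in J$ with $(i,j(i))\in K$. Let $F=\{f_{ij}:(i,j)\in K\}$ be a set of formal symbols, where $f_{ij}$ represents the element $e\,r_{j(i)}e_{ij}r'_j$ of $H$; these elements generate $H$, and the inverse of this element is $e\,r_je_{i,j(i)}r'_{j(i)}$. Words over $F\cup F^{-1}$ thus represent elements of $H$. Let $P=(p_{ji})_{j\in J,i\in I}$, $p_{ji}=f_{ij}^{-1}$ if $(i,j)\in K$ and $p_{ji}=0$ otherwise. The mapping $\pi$: for a word $w\equiv e_{i_1j_1}e_{i_2j_2}\cdots e_{i_mj_m}$ over $E\cap D$ which represents an element of $D$, $$\pi(w)=(i_1,\ f_{i_1j_1}f_{i_2j_1}^{-1}f_{i_2j_2}f_{i_3j_2}^{-1}\cdots f_{i_{m-1}j_{m-1}}f_{i_mj_{m-1}}^{-1}f_{i_mj_m},\ j_m)\in I\times(F\cup F^{-1})^*\times J.$$ The mapping $\rho:I\times(F\cup F^{-1})^*\times J\to(E\cap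 D)^*$ is $\rho(i,w,j)=e_{i,j(i)}\,r'_{j(i)}\,\widetilde\rho(w)\,e_{11}\,r_j$, where $\widetilde\rho:(F\cup F^{-1})^*\to(E\cap D)^*$ is the monoid homomorphism with $f_{ij}\mapsto e\,r_{j(i)}e_{ij}r'_j$ and $f_{ij}^{-1}\mapsto e\,r_je_{i,j(i)}r'_{j(i)}$. "Induce" means: on the elements represented by the words involved, together with $0\mapsto 0$. Principal factor: $\overline{D}_e=D\cup\{0\}$ with $x\cdot y=xy$ if $x,y,xy\in D$ and $0$ otherwise. $\mathcal{M}^0[H;I,J;P]$ is $(I\times H\times J)\cup\{0\}$ with $(i,g,j)(k,h,l)=(i,gp_{jk}h,l)$ if $p_{jk}\neq0$, and all other products $0$. *)

theory Defs
  imports "HOL-Algebra.Group" "HOL-Library.Sublist" "HOL-Library.Nat_Bijection"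
begin

section \<open>Semigroups and Green's relations\<close>

record 'a sgrp = "'a partial_object" +
  sprod :: "'a \<Rightarrow> 'a \<Rightarrow> 'a"

definition is_semigroup :: "'a sgrp \<Rightarrow> bool" where
  "is_semigroup S \<longleftrightarrow>
     (\<forall>x\<in>carrier S. \<forall>y\<in>carrier S. sprod S x y \<in> carrier S) \<and>
     (\<forall>x\<in>carrier S. \<forall>y\<in>carrier S. \<forall>z\<in>carrier S.
        sprod S (sprod S x y) z = sprod S x (sprod S y z))"

definition idempotents :: "'a sgrp \<Rightarrow> 'a set" where
  "idempotents S = {x \<in> carrier S. sprod S x x = x}"

text \<open>The principal one-sided and two-sided ideals \<open>x S\<^sup>1\<close>, \<open>S\<^sup>1 x\<close>, \<open>S\<^sup>1 x S\<^sup>1\<close>.\<close>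

definition right_ideal_of :: "'a sgrp \<Rightarrow> 'a \<Rightarrow> 'a set" where
  "right_ideal_of S x = insert x {sprod S x s |s. s \<in> carrier S}"

definition left_ideal_of :: "'a sgrp \<Rightarrow> 'a \<Rightarrow> 'a set" where
  "left_ideal_of S x = insert x {sprod S s x |s. s \<in> carrier S}"

definition ideal_of :: "'a sgrp \<Rightarrow> 'a \<Rightarrow> 'a set" where
  "ideal_of S x = (\<Union>y \<in> left_ideal_of S x. right_ideal_of S y)"

definition green_R :: "'a sgrp \<Rightarrow> ('a \<times> 'a) set" where
  "green_R S = {(x, y). x \<in> carrier S \<and> y \<in> carrier S \<and> right_ideal_of S x = right_ideal_of S y}"

definition green_L :: "'a sgrp \<Rightarrow> ('a \<times> 'a) set" where
  "green_L S = {(x, y). x \<in> carrier S \<and> y \<in> carrier S \<and> left_ideal_of S x = left_ideal_of S y}"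

definition green_D :: "'a sgrp \<Rightarrow> ('a \<times> 'a) set" where
  "green_D S = green_R S O green_L S"

definition green_J :: "'a sgrp \<Rightarrow> ('a \<times> 'a) set" where
  "green_J S = {(x, y). x \<in> carrier S \<and> y \<in> carrier S \<and> ideal_of S x = ideal_of S y}"

definition sub_monoid :: "'a sgrp \<Rightarrow> 'a set \<Rightarrow> 'a \<Rightarrow> 'a monoid" where
  "sub_monoid S H u = \<lparr>carrier = H, mult = sprod S, one = u\<rparr>"

definition is_subgroup_of :: "'a sgrp \<Rightarrow> 'a set \<Rightarrow> bool" where
  "is_subgroup_of S H \<longleftrightarrow> H \<subseteq> carrier S \<and> (\<exists>u. group (sub_monoid S H u))"

definition sgrp_iso :: "'a sgrp \<Rightarrow> 'b sgrp \<Rightarrow> ('a \<Rightarrow> 'b) \<Rightarrow> bool" where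
  "sgrp_iso S T h \<longleftrightarrow> bij_betw h (carrier S) (carrier T) \<and>
     (\<forall>x\<in>carrier S. \<forall>y\<in>carrier S. h (sprod S x y) = sprod T (h x) (h y))"


section \<open>Completely 0-simple semigroups, principal factors, Rees matrix semigroups\<close>

definition is_ideal :: "'a sgrp \<Rightarrow> 'a set \<Rightarrow> bool" where
  "is_ideal S A \<longleftrightarrow> A \<noteq> {} \<and> A \<subseteq> carrier S \<and>
     (\<forall>a\<in>A. \<forall>s\<in>carrier S. sprod S a s \<in> A \<and> sprod S s a \<in> A)"

definition is_zero :: "'a sgrp \<Rightarrow> 'a \<Rightarrow> bool" where
  "is_zero S z \<longleftrightarrow> z \<in> carrier S \<and> (\<forall>s\<in>carrier S. sprod S z s = z \<and> sprod S s z = z)"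

definition primitive_idempotent :: "'a sgrp \<Rightarrow> 'a \<Rightarrow> 'a \<Rightarrow> bool" where
  "primitive_idempotent S z e \<longleftrightarrow> e \<in> idempotents S \<and> e \<noteq> z \<and>
     (\<forall>f\<in>idempotents S. f \<noteq> z \<longrightarrow> sprod S e f = f \<longrightarrow> sprod S f e = f \<longrightarrow> f = e)"

definition completely_0_simple :: "'a sgrp \<Rightarrow> 'a \<Rightarrow> bool" where
  "completely_0_simple S z \<longleftrightarrow> is_semigroup S \<and> is_zero S z \<and>
     {sprod S x y |x y. x \<in> carrier S \<and> y \<in> carrier S} \<noteq> {z} \<and>
     (\<forall>A. is_ideal S A \<longrightarrow> A = {z} \<or> A = carrier S) \<and>
     (\<exists>e. primitive_idempotent S z e)"

text \<open>In both constructions below \<open>None\<close> is the adjoined zero.\<close>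

definition principal_factor :: "'a sgrp \<Rightarrow> 'a set \<Rightarrow> 'a option sgrp" where
  "principal_factor S D = \<lparr>carrier = insert None (Some ` D),
     sprod = (\<lambda>x y. case (x, y) of
        (Some a, Some b) \<Rightarrow>
          if a \<in> D \<and> b \<in> D \<and> sprod S a b \<in> D then Some (sprod S a b) else None
      | _ \<Rightarrow> None)\<rparr>"

definition rees_matrix ::
    "'h monoid \<Rightarrow> 'i set \<Rightarrow> 'j set \<Rightarrow> ('j \<Rightarrow> 'i \<Rightarrow> 'h option) \<Rightarrow> ('i \<times> 'h \<times> 'j) option sgrp" where
  "rees_matrix G I J P = \<lparr>carrier = insert None (Some ` (I \<times> carrier G \<times> J)),
     sprod = (\<lambda>x y. case (x, y) of
        (Some (i, g, j), Some (k, h, l)) \<Rightarrow>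
          (case P j k of Some p \<Rightarrow> Some (i, g \<otimes>\<^bsub>G\<^esub> p \<otimes>\<^bsub>G\<^esub> h, l) | None \<Rightarrow> None)
      | _ \<Rightarrow> None)\<rparr>"


section \<open>Biordered sets and free idempotent generated semigroups\<close>

record 'a partial_algebra = "'a partial_object" +
  star :: "'a \<Rightarrow> 'a \<Rightarrow> 'a option"

definition basic_pair :: "'a sgrp \<Rightarrow> 'a \<Rightarrow> 'a \<Rightarrow> bool" where
  "basic_pair S e f \<longleftrightarrow> e \<in> idempotents S \<and> f \<in> idempotents S \<and>
     {e, f} \<inter> {sprod S e f, sprod S f e} \<noteq> {}"

definition biordered_set_of :: "'a sgrp \<Rightarrow> 'a partial_algebra" where
  "biordered_set_of S = \<lparr>carrier = idempotents S,
     star = (\<lambda>e f. if basic_pair S e f then Some (sprod S e f) else None)\<rparr>"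

text \<open>
  The underlying set of the biordered set of \<open>S\<close> is a subset of \<open>S\<close>, so \<open>S\<close> ranges over the
  semigroups whose carrier is a subset of the same type.  For \<^typ>\<open>nat\<close> this still yields every
  finite biordered set up to isomorphism: a semigroup may be replaced by the subsemigroup
  generated by its idempotents, which is countable if these are finite in number.
\<close>

definition biordered_set :: "'a partial_algebra \<Rightarrow> bool" where
  "biordered_set B \<longleftrightarrow> (\<exists>S. is_semigroup S \<and> B = biordered_set_of S)"

inductive ig_eq :: "'a partial_algebra \<Rightarrow> 'a list \<Rightarrow> 'a list \<Rightarrow> bool" for B where
  refl: "u \<noteq> [] \<Longrightarrow> u \<in> lists (carrier B) \<Longrightarrow> ig_eq B u u"
| sym: "ig_eq B u v \<Longrightarrow> ig_eq B v u"
| trans: "ig_eq B u v \<Longrightarrow> ig_eq B v w \<Longrightarrow> ig_eq B u w"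
| rel: "e \<in> carrier B \<Longrightarrow> f \<in> carrier B \<Longrightarrow> star B e f = Some g \<Longrightarrow> g \<in> carrier B \<Longrightarrow>
        u \<in> lists (carrier B) \<Longrightarrow> v \<in> lists (carrier B) \<Longrightarrow>
        ig_eq B (u @ [e, f] @ v) (u @ [g] @ v)"

definition cls :: "'a partial_algebra \<Rightarrow> 'a list \<Rightarrow> 'a list set" where
  "cls B w = {v. ig_eq B w v}"

definition IG :: "'a partial_algebra \<Rightarrow> 'a list set sgrp" where
  "IG B = \<lparr>carrier = {cls B w |w. w \<noteq> [] \<and> w \<in> lists (carrier B)},
     sprod = (\<lambda>X Y. \<Union>u\<in>X. \<Union>v\<in>Y. cls B (u @ v))\<rparr>"

definition Dcl :: "'a partial_algebra \<Rightarrow> 'a \<Rightarrow> 'a list set set" where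
  "Dcl B e = green_D (IG B) `` {cls B [e]}"

definition Jcl :: "'a partial_algebra \<Rightarrow> 'a \<Rightarrow> 'a list set set" where
  "Jcl B e = green_J (IG B) `` {cls B [e]}"

definition ED :: "'a partial_algebra \<Rightarrow> 'a \<Rightarrow> 'a set" where
  "ED B e = {a \<in> carrier B. cls B [a] \<in> Dcl B e}"

text \<open>The element \<open>x w\<close> for an element \<open>x\<close> and a possibly empty word \<open>w\<close>.\<close>

definition word_act :: "'a partial_algebra \<Rightarrow> 'a list set \<Rightarrow> 'a list \<Rightarrow> 'a list set" where
  "word_act B x w = (if w = [] then x else sprod (IG B) x (cls B w))"


section \<open>Coordinates and Schreier systems\<close>

text \<open>
  All choices made when coordinatizing \<open>D\<close>: the index sets \<open>I\<close> and \<open>J\<close> with common element \<open>1\<close>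
  (\<open>base\<close>), the families \<open>R\<^sub>i\<close> and \<open>L\<^sub>j\<close>, the words \<open>r\<^sub>j\<close> (\<open>rw\<close>) and \<open>r'\<^sub>j\<close> (\<open>rw'\<close>), and the
  function \<open>i \<mapsto> j(i)\<close> (\<open>jsel\<close>).
\<close>

record ('a, 'i) coord =
  idxI :: "'i set"
  idxJ :: "'i set"
  base :: 'i
  Rcl :: "'i \<Rightarrow> 'a list set set"
  Lcl :: "'i \<Rightarrow> 'a list set set"
  rw :: "'i \<Rightarrow> 'a list"
  rw' :: "'i \<Rightarrow> 'a list"
  jsel :: "'i \<Rightarrow> 'i"

definition Hcl :: "('a, 'i) coord \<Rightarrow> 'i \<Rightarrow> 'i \<Rightarrow> 'a list set set" where
  "Hcl X i j = Rcl X i \<inter> Lcl X j"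

definition KK :: "'a partial_algebra \<Rightarrow> ('a, 'i) coord \<Rightarrow> ('i \<times> 'i) set" where
  "KK B X = {(i, j). i \<in> idxI X \<and> j \<in> idxJ X \<and> is_subgroup_of (IG B) (Hcl X i j)}"

text \<open>
  \<open>e\<^sub>i\<^sub>j\<close> as a letter of \<open>E\<close>: the idempotents of \<open>IG(E)\<close> are exactly the elements represented by
  letters, and distinct letters represent distinct elements.
\<close>

definition eij :: "'a partial_algebra \<Rightarrow> ('a, 'i) coord \<Rightarrow> 'i \<Rightarrow> 'i \<Rightarrow> 'a" where
  "eij B X i j = (THE a. a \<in> carrier B \<and> cls B [a] \<in> Hcl X i j)"

text \<open>The action on \<open>J \<union> {0}\<close>, with \<open>None\<close> for \<open>0\<close>.\<close>

definition act1 :: "'a partial_algebra \<Rightarrow> ('a, 'i) coord \<Rightarrow> 'i \<Rightarrow> 'a \<Rightarrow> 'i option" where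
  "act1 B X j g =
     (let Q = (\<lambda>l. l \<in> idxJ X \<and>
                   (\<lambda>x. sprod (IG B) x (cls B [g])) ` Hcl X (base X) j = Hcl X (base X) l)
      in if Ex Q then Some (The Q) else None)"

primrec act :: "'a partial_algebra \<Rightarrow> ('a, 'i) coord \<Rightarrow> 'i option \<Rightarrow> 'a list \<Rightarrow> 'i option" where
  "act B X s [] = s"
| "act B X s (g # w) = act B X (Option.bind s (\<lambda>j. act1 B X j g)) w"

definition indexes_classes :: "'a partial_algebra \<Rightarrow> 'a \<Rightarrow> ('a, 'i) coord \<Rightarrow> bool" where
  "indexes_classes B e X \<longleftrightarrow>
     bij_betw (Rcl X) (idxI X) {green_R (IG B) `` {x} |x. x \<in> Dcl B e} \<and>
     bij_betw (Lcl X) (idxJ X) {green_L (IG B) `` {x} |x. x \<in> Dcl B e} \<and>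
     base X \<in> idxI X \<inter> idxJ X \<and>
     cls B [e] \<in> Hcl X (base X) (base X)"

definition schreier_system :: "'a partial_algebra \<Rightarrow> 'a \<Rightarrow> ('a, 'i) coord \<Rightarrow> bool" where
  "schreier_system B e X \<longleftrightarrow>
     (\<forall>j\<in>idxJ X.
        rw X j \<in> lists (ED B e) \<and>
        act B X (Some (base X)) (rw X j) = Some j \<and>
        (\<forall>p. prefix p (rw X j) \<longrightarrow> (\<exists>l\<in>idxJ X. p = rw X l)) \<and>
        rw' X j \<in> lists (ED B e) \<and>
        act B X (Some j) (rw' X j) = Some (base X) \<and>
        (\<forall>x \<in> Hcl X (base X) (base X). word_act B x (rw X j @ rw' X j) = x) \<and>
        (\<forall>x \<in> Hcl X (base X) j. word_act B x (rw' X j @ rw X j) = x))"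

definition coordinatization :: "'a partial_algebra \<Rightarrow> 'a \<Rightarrow> ('a, 'i) coord \<Rightarrow> bool" where
  "coordinatization B e X \<longleftrightarrow> indexes_classes B e X \<and> schreier_system B e X \<and>
     (\<forall>i\<in>idxI X. (i, jsel X i) \<in> KK B X)"


section \<open>The group \<open>H\<close>, its generators and the sandwich matrix\<close>

datatype 'i gen = Gen 'i 'i | GenInv 'i 'i

definition gens :: "'a partial_algebra \<Rightarrow> ('a, 'i) coord \<Rightarrow> 'i gen set" where
  "gens B X = (\<Union>(i, j) \<in> KK B X. {Gen i j, GenInv i j})"

definition HG :: "'a partial_algebra \<Rightarrow> 'a \<Rightarrow> ('a, 'i) coord \<Rightarrow> 'a list set monoid" where
  "HG B e X = sub_monoid (IG B) (Hcl X (base X) (base X)) (cls B [e])"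

fun rho_letter :: "'a partial_algebra \<Rightarrow> 'a \<Rightarrow> ('a, 'i) coord \<Rightarrow> 'i gen \<Rightarrow> 'a list" where
  "rho_letter B e X (Gen i j) = [e] @ rw X (jsel X i) @ [eij B X i j] @ rw' X j"
| "rho_letter B e X (GenInv i j) = [e] @ rw X j @ [eij B X i (jsel X i)] @ rw' X (jsel X i)"

definition fval :: "'a partial_algebra \<Rightarrow> 'a \<Rightarrow> ('a, 'i) coord \<Rightarrow> 'i \<Rightarrow> 'i \<Rightarrow> 'a list set" where
  "fval B e X i j = cls B ([e] @ rw X (jsel X i) @ [eij B X i j] @ rw' X j)"

fun gen_val :: "'a partial_algebra \<Rightarrow> 'a \<Rightarrow> ('a, 'i) coord \<Rightarrow> 'i gen \<Rightarrow> 'a list set" where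
  "gen_val B e X (Gen i j) = fval B e X i j"
| "gen_val B e X (GenInv i j) = inv\<^bsub>HG B e X\<^esub> (fval B e X i j)"

definition word_val :: "'a partial_algebra \<Rightarrow> 'a \<Rightarrow> ('a, 'i) coord \<Rightarrow> 'i gen list \<Rightarrow> 'a list set" where
  "word_val B e X u = foldr (\<lambda>g x. gen_val B e X g \<otimes>\<^bsub>HG B e X\<^esub> x) u \<one>\<^bsub>HG B e X\<^esub>"

definition sandwich ::
    "'a partial_algebra \<Rightarrow> 'a \<Rightarrow> ('a, 'i) coord \<Rightarrow> 'i \<Rightarrow> 'i \<Rightarrow> 'a list set option" where
  "sandwich B e X j i =
     (if (i, j) \<in> KK B X then Some (inv\<^bsub>HG B e X\<^esub> (fval B e X i j)) else None)"


section \<open>The mappings \<open>\<pi>\<close> and \<open>\<rho>\<close>\<close>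

definition idx :: "'a partial_algebra \<Rightarrow> ('a, 'i) coord \<Rightarrow> 'a \<Rightarrow> 'i \<times> 'i" where
  "idx B X a = (THE (i, j). (i, j) \<in> KK B X \<and> eij B X i j = a)"

fun pi_mid :: "('i \<times> 'i) list \<Rightarrow> 'i gen list" where
  "pi_mid [] = []"
| "pi_mid [(i, j)] = [Gen i j]"
| "pi_mid ((i, j) # (k, l) # ks) = [Gen i j, GenInv k j] @ pi_mid ((k, l) # ks)"

definition pi_dom :: "'a partial_algebra \<Rightarrow> 'a \<Rightarrow> 'a list set" where
  "pi_dom B e = {w \<in> lists (ED B e). w \<noteq> [] \<and> cls B w \<in> Dcl B e}"

definition pi_map ::
    "'a partial_algebra \<Rightarrow> ('a, 'i) coord \<Rightarrow> 'a list \<Rightarrow> 'i \<times> 'i gen list \<times> 'i" where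
  "pi_map B X w =
     (let ks = map (idx B X) w in (fst (hd ks), pi_mid ks, snd (last ks)))"

definition rho_dom :: "'a partial_algebra \<Rightarrow> ('a, 'i) coord \<Rightarrow> ('i \<times> 'i gen list \<times> 'i) set" where
  "rho_dom B X = idxI X \<times> lists (gens B X) \<times> idxJ X"

fun rho_map ::
    "'a partial_algebra \<Rightarrow> 'a \<Rightarrow> ('a, 'i) coord \<Rightarrow> 'i \<times> 'i gen list \<times> 'i \<Rightarrow> 'a list" where
  "rho_map B e X (i, u, j) =
     [eij B X i (jsel X i)] @ rw' X (jsel X i) @ concat (map (rho_letter B e X) u) @
     [eij B X (base X) (base X)] @ rw X j"

text \<open>The triple in \<open>I \<times> H \<times> J\<close> represented by a triple in \<open>I \<times> (F \<union> F\<^sup>-\<^sup>1)\<^sup>* \<times> J\<close>.\<close>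

fun triple_val ::
    "'a partial_algebra \<Rightarrow> 'a \<Rightarrow> ('a, 'i) coord \<Rightarrow> 'i \<times> 'i gen list \<times> 'i \<Rightarrow> 'i \<times> 'a list set \<times> 'i" where
  "triple_val B e X (i, u, j) = (i, word_val B e X u, j)"

text \<open>
  A mapping \<open>m\<close> from names in \<open>V\<close> to names in \<open>W\<close> induces \<open>h\<close> if \<open>h\<close> fixes zero and sends the
  element named by \<open>v\<close> to the element named by \<open>m v\<close>.  As \<open>V\<close> is required to name all of the
  nonzero elements of \<open>S\<close>, at most one \<open>h\<close> on the carrier of \<open>S\<close> is induced by \<open>m\<close>.
\<close>

definition induces ::
    "'v set \<Rightarrow> 'w set \<Rightarrow> ('v \<Rightarrow> 'w) \<Rightarrow> ('v \<Rightarrow> 'x) \<Rightarrow> ('w \<Rightarrow> 'y) \<Rightarrow> 'x option sgrp \<Rightarrow>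
     ('x option \<Rightarrow> 'y option) \<Rightarrow> bool" where
  "induces V W m val_V val_W S h \<longleftrightarrow>
     m \<in> V \<rightarrow> W \<and> carrier S = insert None (Some ` val_V ` V) \<and>
     h None = None \<and> (\<forall>v\<in>V. h (Some (val_V v)) = Some (val_W (m v)))"


section \<open>Effective computability\<close>

text \<open>Partial recursive functions on natural numbers, with their evaluation relation.\<close>

datatype recf = Zero | Succ | Proj nat | Comp recf "recf list" | PrimRec recf recf | Mu recf

inductive rec_eval :: "recf \<Rightarrow> nat list \<Rightarrow> nat \<Rightarrow> bool" where
  "rec_eval Zero xs 0"
| "rec_eval Succ [x] (Suc x)"
| "i < length xs \<Longrightarrow> rec_eval (Proj i) xs (xs ! i)"
| "list_all2 (\<lambda>g y. rec_eval g xs y) gs ys \<Longrightarrow> rec_eval f ys z \<Longrightarrow> rec_eval (Comp f gs) xs z"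
| "rec_eval f xs y \<Longrightarrow> rec_eval (PrimRec f g) (0 # xs) y"
| "rec_eval (PrimRec f g) (n # xs) y \<Longrightarrow> rec_eval g (n # y # xs) z \<Longrightarrow>
     rec_eval (PrimRec f g) (Suc n # xs) z"
| "rec_eval f (n # xs) 0 \<Longrightarrow> (\<forall>m<n. \<exists>y. rec_eval f (m # xs) (Suc y)) \<Longrightarrow> rec_eval (Mu f) xs n"

text \<open>
  Finite input data are presented by lists (in any order) of the entries of the relevant tables.
\<close>

type_synonym algebra_table = "nat list \<times> (nat \<times> nat \<times> nat) list"

fun presents :: "algebra_table \<Rightarrow> nat partial_algebra \<Rightarrow> bool" where
  "presents (es, ts) B \<longleftrightarrow> set es = carrier B \<and>
     set ts = {(a, b, c). a \<in> carrier B \<and> b \<in> carrier B \<and> star B a b = Some c}"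

text \<open>
  \<open>R\<^sub>i\<close> and \<open>L\<^sub>j\<close> are in general infinite sets of classes of words; they are given by the table of
  the idempotents \<open>e\<^sub>i\<^sub>j\<close>, which determines them because every \<open>R\<^sub>i\<close> and every \<open>L\<^sub>j\<close> contains one.
\<close>

type_synonym coord_table =
  "nat list \<times> nat list \<times> nat \<times> (nat \<times> nat \<times> nat) list \<times>
   (nat \<times> nat list) list \<times> (nat \<times> nat list) list \<times> (nat \<times> nat) list"

fun presents_coord :: "coord_table \<Rightarrow> nat partial_algebra \<Rightarrow> (nat, nat) coord \<Rightarrow> bool" where
  "presents_coord (is, js, b, ks, rs, rs', ss) B X \<longleftrightarrow>
     set is = idxI X \<and> set js = idxJ X \<and> b = base X \<and>
     set ks = {(i, j, eij B X i j) |i j. (i, j) \<in> KK B X} \<and>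
     set rs = {(j, rw X j) |j. j \<in> idxJ X} \<and>
     set rs' = {(j, rw' X j) |j. j \<in> idxJ X} \<and>
     set ss = {(i, jsel X i) |i. i \<in> idxI X}"

definition enc_pair :: "('a \<Rightarrow> nat) \<Rightarrow> ('b \<Rightarrow> nat) \<Rightarrow> 'a \<times> 'b \<Rightarrow> nat" where
  "enc_pair f g = (\<lambda>(x, y). prod_encode (f x, g y))"

definition enc_list :: "('a \<Rightarrow> nat) \<Rightarrow> 'a list \<Rightarrow> nat" where
  "enc_list f xs = list_encode (map f xs)"

fun enc_gen :: "nat gen \<Rightarrow> nat" where
  "enc_gen (Gen i j) = prod_encode (0, prod_encode (i, j))"
| "enc_gen (GenInv i j) = prod_encode (1, prod_encode (i, j))"

definition enc_word :: "nat list \<Rightarrow> nat" where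
  "enc_word = enc_list id"

definition enc_triple :: "nat \<times> nat gen list \<times> nat \<Rightarrow> nat" where
  "enc_triple = enc_pair id (enc_pair (enc_list enc_gen) id)"

definition enc_algebra :: "algebra_table \<Rightarrow> nat" where
  "enc_algebra =
     enc_pair enc_word (enc_list (enc_pair id (enc_pair id id)))"

definition enc_coord :: "coord_table \<Rightarrow> nat" where
  "enc_coord =
     enc_pair enc_word (enc_pair enc_word (enc_pair id
       (enc_pair (enc_list (enc_pair id (enc_pair id id)))
         (enc_pair (enc_list (enc_pair id enc_word))
           (enc_pair (enc_list (enc_pair id enc_word))
             (enc_list (enc_pair id id)))))))"

text \<open>
  \<open>F\<close>, run with additional inputs \<open>ps\<close>, computes the partial function given by \<open>m\<close> on the
  domain \<open>V\<close>: it halts on the code of \<open>v\<close> precisely for \<open>v \<in> V\<close>, with the code of \<open>m v\<close> as output.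
\<close>

definition computes_on ::
    "recf \<Rightarrow> nat list \<Rightarrow> ('v \<Rightarrow> nat) \<Rightarrow> ('w \<Rightarrow> nat) \<Rightarrow> 'v set \<Rightarrow> ('v \<Rightarrow> 'w) \<Rightarrow> bool" where
  "computes_on F ps enc_v enc_w V m \<longleftrightarrow>
     (\<forall>v y. rec_eval F (ps @ [enc_v v]) y \<longleftrightarrow> v \<in> V \<and> y = enc_w (m v))"

end

theory Submission
  imports Defs
begin

text \<open>
  Write \<open>S\<close> for a semigroup whose biordered set is \<open>\<E>\<close>.  Evaluating words in \<open>S\<close> is a homomorphism
  from \<open>IG(\<E>)\<close> that is injective on letters, and the relations \<open>\<R>\<close> and \<open>\<L>\<close> between letters
  are the same in both semigroups.  If \<open>f w t = f\<close> in \<open>S\<close> for a letter \<open>f\<close> and a word \<open>w\<close>, then the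
  letters of \<open>w\<close> can be replaced one at a time by letters connected to \<open>f\<close> through \<open>\<R>\<close> and
  \<open>\<L>\<close>, without changing the element \<open>f w\<close> of \<open>IG(\<E>)\<close>.  Hence every idempotent of \<open>D\<close> is a letter,
  \<open>D\<close> is generated by its letters, and these are connected by chains of \<open>\<R>\<close>- and
  \<open>\<L>\<close>-related letters.

  The isomorphism sends \<open>x \<in> R\<^sub>i \<inter> L\<^sub>j\<close> to \<open>(i, h(x), j)\<close> with \<open>h(x) = e r\<^sub>j\<^sub>(\<^sub>i\<^sub>) x r'\<^sub>j\<close>.  It is
  multiplicative because \<open>f\<^sub>k\<^sub>j\<^sup>-\<^sup>1 = e r\<^sub>j e\<^sub>k\<^sub>,\<^sub>j\<^sub>(\<^sub>k\<^sub>) r'\<^sub>j\<^sub>(\<^sub>k\<^sub>)\<close>, so that all the words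
  \<open>r\<close> and \<open>r'\<close> cancel from \<open>h(x) f\<^sub>k\<^sub>j\<^sup>-\<^sup>1 h(y)\<close>.

  A coordinatization is computed by unbounded search for a table that passes a primitive recursive
  test.  The test stays inside the multiplication table of \<open>\<E>\<close>, and so avoids the word problem of
  \<open>H\<close>, because it only admits words \<open>r'\<^sub>j\<close> that undo the letters of \<open>r\<^sub>j\<close> one by one:
  if \<open>y \<in> L\<^sub>j\<close> and \<open>g\<close> are \<open>\<R>\<close>-related letters, then \<open>x g y = x\<close> for all \<open>x \<in> L\<^sub>j\<close>.
\<close>

section \<open>Recursive functions\<close>

text \<open>Evaluation in S does not decide equality of words. It serves only to transport equations
  f w t = f and the relations R and L between letters, the places where S and IG(E) agree. Complete
  0-simplicity enters through stability: x y in D forces x R x y and y L x y. Hence x y lies in D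
  exactly when the H-class in the row of y and the column of x contains a letter. This one criterion
  gives the zeros of P and also decides the domain of \<pi>, by looking at adjacent letters; D = J
  is needed there, to know that suffixes of a word with value in D have values in D. The domain must
  be decided exactly, because \<open>computes_on\<close> demands divergence outside it; each machine
  is therefore a total function guarded by a search that may run forever. The machines for \<pi> and
  \<rho> must accept the table of any coordinatization, whereas the search has to produce only one.
  The test of the search may thus be stricter than the definition of a coordinatization, as long as
  it is sound and some table passes it.\<close>

inductive_cases rec_eval_ZeroE: "rec_eval Zero xs y"
inductive_cases rec_eval_SuccE: "rec_eval Succ xs y"
inductive_cases rec_eval_ProjE: "rec_eval (Proj i) xs y"
inductive_cases rec_eval_CompE: "rec_eval (Comp f gs) xs y"
inductive_cases rec_eval_PrimRec_0E: "rec_eval (PrimRec f g) (0 # xs) y"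
inductive_cases rec_eval_PrimRec_SucE: "rec_eval (PrimRec f g) (Suc n # xs) y"
inductive_cases rec_eval_MuE: "rec_eval (Mu f) xs y"

lemma list_all2_unique:
  assumes "list_all2 (\<lambda>g y. \<forall>z. P g z \<longrightarrow> z = y) gs ys" and "list_all2 P gs zs"
  shows "zs = ys"
  using assms by (auto simp: list_all2_conv_all_nth intro!: nth_equalityI)

text \<open>\<open>computes_on\<close> and the output clause for the coordinatization are
  equivalences, so a derivation of the right value must also exclude all other values.\<close>

lemma rec_eval_unique: "rec_eval F xs y \<Longrightarrow> rec_eval F xs z \<Longrightarrow> z = y"
proof (induction arbitrary: z rule: rec_eval.induct)
  case (1 xs)
  then show ?case by (auto elim: rec_eval_ZeroE)
next
  case (2 x)
  then show ?case by (auto elim: rec_eval_SuccE)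
next
  case (3 i xs)
  then show ?case by (auto elim: rec_eval_ProjE)
next
  case (4 xs gs ys f y)
  from 4(4) obtain zs where zs: "list_all2 (\<lambda>g. rec_eval g xs) gs zs" "rec_eval f zs z"
    by (rule rec_eval_CompE)
  have "list_all2 (\<lambda>g y. \<forall>z. rec_eval g xs z \<longrightarrow> z = y) gs ys"
    using 4(1) by (rule list_all2_mono) blast
  then have "zs = ys" using zs(1) by (rule list_all2_unique)
  then show ?case using 4(2) zs(2) by blast
next
  case (5 f xs y g)
  then show ?case using rec_eval_PrimRec_0E by blast
next
  case (6 f g n xs y w)
  from 6(5) obtain v where "rec_eval (PrimRec f g) (n # xs) v" "rec_eval g (n # v # xs) z"
    by (rule rec_eval_PrimRec_SucE)
  then show ?case using 6(3,4) by blast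
next
  case (7 f n xs)
  from 7(4) have z: "rec_eval f (z # xs) 0" "\<forall>m<z. \<exists>y. rec_eval f (m # xs) (Suc y)"
    by (blast elim: rec_eval_MuE)+
  show ?case
  proof (rule linorder_cases[of z n])
    assume "z < n"
    then obtain y where "\<forall>v. rec_eval f (z # xs) v \<longrightarrow> v = Suc y" using 7(3) by blast
    with z(1) show ?thesis by blast
  next
    assume "n < z"
    then obtain y where "rec_eval f (n # xs) (Suc y)" using z(2) by blast
    then show ?thesis using 7(2) by blast
  qed
qed

lemma rec_eval_iff: "rec_eval F xs v \<Longrightarrow> rec_eval F xs y \<longleftrightarrow> y = v"
  using rec_eval_unique by blast

text \<open>Argument tuples are lists, as in \<open>rec_eval\<close>. Values of \<open>f\<close> on
  lists of other lengths are ignored, so \<open>f\<close> may use \<open>xs ! i\<close> and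
  \<open>tl\<close> freely.\<close>

definition total_rec :: "nat \<Rightarrow> (nat list \<Rightarrow> nat) \<Rightarrow> bool" where
  "total_rec n f \<longleftrightarrow> (\<exists>F. \<forall>xs. length xs = n \<longrightarrow> rec_eval F xs (f xs))"

lemma total_recE:
  assumes "total_rec n f"
  obtains F where "\<And>xs y. length xs = n \<Longrightarrow> rec_eval F xs y \<longleftrightarrow> y = f xs"
  using assms rec_eval_iff unfolding total_rec_def by metis

lemma total_rec_cong:
  "total_rec n f \<Longrightarrow> (\<And>xs. length xs = n \<Longrightarrow> f xs = g xs) \<Longrightarrow> total_rec n g"
  by (fastforce simp: total_rec_def)

lemma total_rec_proj: "i < n \<Longrightarrow> total_rec n (\<lambda>xs. xs ! i)"
  unfolding total_rec_def by (rule exI[of _ "Proj i"]) (auto intro: rec_eval.intros)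

lemma total_rec_comp:
  assumes "total_rec (length gs) f" "\<And>g. g \<in> set gs \<Longrightarrow> total_rec n g"
  shows "total_rec n (\<lambda>xs. f (map (\<lambda>g. g xs) gs))"
proof -
  from assms(1) obtain F where F: "\<And>xs. length xs = length gs \<Longrightarrow> rec_eval F xs (f xs)"
    unfolding total_rec_def by blast
  from assms(2) obtain G where G: "\<And>g xs. g \<in> set gs \<Longrightarrow> length xs = n \<Longrightarrow> rec_eval (G g) xs (g xs)"
    unfolding total_rec_def by metis
  have "rec_eval (Comp F (map G gs)) xs (f (map (\<lambda>g. g xs) gs))" if "length xs = n" for xs
    by (rule rec_eval.intros(4)[where ys = "map (\<lambda>g. g xs) gs"])
      (auto simp: list_all2_conv_all_nth F G that)
  then show ?thesis unfolding total_rec_def by blast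
qed

abbreviation total_rec1 :: "(nat \<Rightarrow> nat) \<Rightarrow> bool" where
  "total_rec1 f \<equiv> total_rec (Suc 0) (\<lambda>xs. f (xs ! 0))"

abbreviation total_rec2 :: "(nat \<Rightarrow> nat \<Rightarrow> nat) \<Rightarrow> bool" where
  "total_rec2 f \<equiv> total_rec (Suc (Suc 0)) (\<lambda>xs. f (xs ! 0) (xs ! 1))"

lemma total_rec_comp1:
  "total_rec1 f \<Longrightarrow> total_rec n g \<Longrightarrow> total_rec n (\<lambda>xs. f (g xs))"
  using total_rec_comp[of "[g]" "\<lambda>xs. f (xs ! 0)" n] by simp

lemma total_rec_comp2:
  "total_rec2 f \<Longrightarrow> total_rec n g \<Longrightarrow> total_rec n h \<Longrightarrow> total_rec n (\<lambda>xs. f (g xs) (h xs))"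
  using total_rec_comp[of "[g, h]" "\<lambda>xs. f (xs ! 0) (xs ! 1)" n] by auto

lemma total_rec_Suc:
  assumes "total_rec n f"
  shows "total_rec n (\<lambda>xs. Suc (f xs))"
proof -
  have "total_rec1 Suc"
    unfolding total_rec_def
    by (rule exI[of _ Succ]) (auto simp: length_Suc_conv intro: rec_eval.intros(2))
  then show ?thesis using assms by (rule total_rec_comp1)
qed

lemma total_rec_const: "total_rec n (\<lambda>xs. c)"
proof (induction c)
  case 0
  show ?case unfolding total_rec_def by (rule exI[of _ Zero]) (auto intro: rec_eval.intros)
next
  case (Suc c)
  then show ?case by (rule total_rec_Suc)
qed

lemma total_rec_primrec:
  assumes "total_rec n f" "total_rec (Suc (Suc n)) g"
  shows "total_rec (Suc n) (\<lambda>xs. rec_nat (f (tl xs)) (\<lambda>k r. g (k # r # tl xs)) (hd xs))"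
proof -
  from assms obtain F G where F: "\<And>xs. length xs = n \<Longrightarrow> rec_eval F xs (f xs)"
    and G: "\<And>xs. length xs = Suc (Suc n) \<Longrightarrow> rec_eval G xs (g xs)"
    unfolding total_rec_def by blast
  have "rec_eval (PrimRec F G) (k # xs) (rec_nat (f xs) (\<lambda>k r. g (k # r # xs)) k)"
    if "length xs = n" for k xs
    using that by (induction k) (auto intro!: rec_eval.intros(5) rec_eval.intros(6) F G)
  then have "\<forall>xs. length xs = Suc n \<longrightarrow>
      rec_eval (PrimRec F G) xs (rec_nat (f (tl xs)) (\<lambda>k r. g (k # r # tl xs)) (hd xs))"
    by (auto simp: length_Suc_conv)
  then show ?thesis unfolding total_rec_def by blast
qed

text \<open>With \<open>F\<close> total at these parameters, a rejected candidate yields a positive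
  value instead of divergence, so minimisation reaches the first zero.\<close>

lemma rec_eval_Mu_iff:
  assumes "\<And>n. rec_eval F (n # xs) (f n)"
  shows "rec_eval (Mu F) xs n \<longleftrightarrow> f n = 0 \<and> (\<forall>m<n. f m \<noteq> 0)"
proof -
  have eq: "rec_eval F (m # xs) y \<longleftrightarrow> y = f m" for m y
    by (rule rec_eval_iff) (rule assms)
  show ?thesis
  proof
    assume "rec_eval (Mu F) xs n"
    then show "f n = 0 \<and> (\<forall>m<n. f m \<noteq> 0)"
      by (rule rec_eval_MuE) (use eq in \<open>metis nat.distinct(1)\<close>)
  next
    assume "f n = 0 \<and> (\<forall>m<n. f m \<noteq> 0)"
    then show "rec_eval (Mu F) xs n"
      by (intro rec_eval.intros(7)) (use eq in \<open>metis not0_implies_Suc\<close>)+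
  qed
qed

lemma total_rec_Least:
  assumes "total_rec (Suc n) f" and ex: "\<And>xs. length xs = n \<Longrightarrow> \<exists>k. f (k # xs) = 0"
  shows "total_rec n (\<lambda>xs. LEAST k. f (k # xs) = 0)"
proof -
  from assms(1) obtain F where F: "\<And>xs. length xs = Suc n \<Longrightarrow> rec_eval F xs (f xs)"
    unfolding total_rec_def by blast
  have "rec_eval (Mu F) xs (LEAST k. f (k # xs) = 0)" if "length xs = n" for xs
    using rec_eval_Mu_iff[of F xs "\<lambda>k. f (k # xs)"] F that LeastI_ex[OF ex[OF that]]
    by (auto dest: not_less_Least)
  then show ?thesis unfolding total_rec_def by blast
qed

lemma total_rec2_primrec:
  assumes "total_rec1 a" "total_rec (Suc (Suc (Suc 0))) (\<lambda>xs. s (xs ! 0) (xs ! 1) (xs ! 2))"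
  shows "total_rec2 (\<lambda>k x. rec_nat (a x) (\<lambda>k r. s k r x) k)"
  by (rule total_rec_cong[OF total_rec_primrec[OF assms]]) (auto simp: length_Suc_conv)

lemma total_rec_add: "total_rec2 (+)"
proof -
  have "rec_nat b (\<lambda>k. Suc) a = a + b" for a b :: nat by (induction a) auto
  then show ?thesis
    using total_rec2_primrec[of "\<lambda>x. x" "\<lambda>k r x. Suc r"]
    by (simp add: total_rec_proj total_rec_Suc)
qed


lemma total_rec_diff: "total_rec2 (-)"
proof -
  have pred: "total_rec1 (\<lambda>n. n - 1)"
  proof (rule total_rec_cong)
    show "total_rec (Suc 0) (\<lambda>xs. rec_nat 0 (\<lambda>k r. (k # r # tl xs) ! 0) (hd xs))"
      by (intro total_rec_primrec total_rec_const total_rec_proj) simp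
  next
    fix xs :: "nat list" assume "length xs = Suc 0"
    then show "rec_nat 0 (\<lambda>k r. (k # r # tl xs) ! 0) (hd xs) = xs ! 0 - 1"
      by (cases "xs ! 0") (auto simp: length_Suc_conv)
  qed
  have "rec_nat b (\<lambda>k r. r - 1) a = b - a" for a b :: nat by (induction a) auto
  \<comment> \<open>\<open>total_rec2_primrec\<close> recurses on the first argument, so iterating
    the predecessor gives subtraction with the arguments swapped.\<close>
  then have "total_rec2 (\<lambda>a b. b - a)"
    using total_rec2_primrec[of "\<lambda>x. x" "\<lambda>k r x. r - 1"] total_rec_comp1[OF pred]
    by (simp add: total_rec_proj)
  from total_rec_comp2[OF this total_rec_proj[of 1 "Suc (Suc 0)"] total_rec_proj[of 0 "Suc (Suc 0)"]]
  show ?thesis by simp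
qed

lemma total_rec_triangle: "total_rec1 triangle"
proof (rule total_rec_cong)
  show "total_rec (Suc 0) (\<lambda>xs. rec_nat 0
      (\<lambda>k r. (\<lambda>zs. zs ! 1 + Suc (zs ! 0)) (k # r # tl xs)) (hd xs))"
    by (intro total_rec_primrec total_rec_const total_rec_comp2[OF total_rec_add] total_rec_Suc
        total_rec_proj) simp_all
next
  fix xs :: "nat list" assume "length xs = Suc 0"
  then obtain n where [simp]: "xs = [n]" by (auto simp: length_Suc_conv)
  have "rec_nat 0 (\<lambda>k r. r + Suc k) n = triangle n" by (induction n) auto
  then show "rec_nat 0 (\<lambda>k r. (\<lambda>zs. zs ! 1 + Suc (zs ! 0)) (k # r # tl xs)) (hd xs) = triangle (xs ! 0)"
    by simp
qed

lemma total_rec_prod_encode: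
  assumes "total_rec n f" "total_rec n g"
  shows "total_rec n (\<lambda>xs. prod_encode (f xs, g xs))"
  unfolding prod_encode_def prod.case
  by (intro total_rec_comp2[OF total_rec_add] total_rec_comp1[OF total_rec_triangle] assms)

text \<open>Cantor pairing is \<open>triangle (a + b) + a\<close> with \<open>a\<close> at most
  \<open>a + b\<close>, so \<open>a + b\<close> is the least \<open>s\<close> whose next triangle
  number exceeds the code. Truncated subtraction turns this strict inequality into an equation with
  0.\<close>

lemma Least_triangle: "(LEAST s. Suc (prod_encode (a, b)) - triangle (Suc s) = 0) = a + b"
proof (rule Least_equality)
  show "Suc (prod_encode (a, b)) - triangle (Suc (a + b)) = 0" by (simp add: prod_encode_def)
next
  fix s assume "Suc (prod_encode (a, b)) - triangle (Suc s) = 0"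
  then have *: "triangle (a + b) < triangle (Suc s)" by (simp add: prod_encode_def)
  have "mono triangle" by (simp add: mono_iff_le_Suc)
  then have "triangle (Suc s) \<le> triangle (a + b)" if "Suc s \<le> a + b" using that by (rule monoD)
  with * show "a + b \<le> s" using not_less_eq_eq leD by blast
qed

lemma total_rec_prod_decode:
  shows "total_rec1 (\<lambda>p. fst (prod_decode p))" and "total_rec1 (\<lambda>p. snd (prod_decode p))"
proof -
  let ?s = "\<lambda>p. LEAST s. Suc p - triangle (Suc s) = 0"
  have s: "?s p = fst (prod_decode p) + snd (prod_decode p)" for p
    using Least_triangle[of "fst (prod_decode p)" "snd (prod_decode p)"] by simp
  have p: "p = triangle (fst (prod_decode p) + snd (prod_decode p)) + fst (prod_decode p)" for p
  proof -
    have "p = prod_encode (prod_decode p)" by simp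
    also have "\<dots> = triangle (fst (prod_decode p) + snd (prod_decode p)) + fst (prod_decode p)"
      by (simp only: prod_encode_def split_beta)
    finally show ?thesis .
  qed
  \<comment> \<open>The search is bounded by \<open>p\<close> itself, since
    \<open>triangle (Suc p)\<close> is at least \<open>Suc p\<close>.\<close>
  have ex: "\<exists>s. Suc p - triangle (Suc s) = 0" for p
    by (rule exI[of _ p]) (induction p, auto)
  have "total_rec (Suc (Suc 0)) (\<lambda>zs. Suc (zs ! 1) - triangle (Suc (zs ! 0)))"
    by (intro total_rec_comp2[OF total_rec_diff] total_rec_Suc
        total_rec_comp1[OF total_rec_triangle] total_rec_proj) simp_all
  from total_rec_Least[OF this] ex have "total_rec (Suc 0) (\<lambda>xs. ?s (xs ! 0))" by simp
  then have sum: "total_rec1 (\<lambda>p. fst (prod_decode p) + snd (prod_decode p))" by (simp only: s)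
  have "total_rec1 (\<lambda>p. p - triangle (fst (prod_decode p) + snd (prod_decode p)))"
    by (intro total_rec_comp2[OF total_rec_diff] total_rec_comp1[OF total_rec_triangle] sum
        total_rec_proj) simp_all
  moreover have "p - triangle (fst (prod_decode p) + snd (prod_decode p)) = fst (prod_decode p)" for p
    using p[of p] by linarith
  ultimately show fst: "total_rec1 (\<lambda>p. fst (prod_decode p))" by simp
  from total_rec_comp2[OF total_rec_diff sum fst]
  show "total_rec1 (\<lambda>p. snd (prod_decode p))" by simp
qed

section \<open>Computable functions on coded types\<close>

text \<open>A type class makes computability compositional: it follows the syntax of a term through
  \<open>computable_intros\<close>. Codes need not exhaust the naturals; \<open>bool\<close> and
  \<open>gen\<close> leave gaps.\<close>

class coded =
  fixes code :: "'a \<Rightarrow> nat"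
  assumes inj_code: "inj code"

lemma code_eq_iff [simp]: "code x = code y \<longleftrightarrow> x = y"
  using inj_code by (auto dest: injD)

instantiation nat :: coded begin
definition code_nat :: "nat \<Rightarrow> nat" where [simp]: "code_nat = id"
instance by standard (simp add: inj_on_def)
end

instantiation bool :: coded begin
definition code_bool :: "bool \<Rightarrow> nat" where [simp]: "code_bool b = of_bool b"
instance by standard (auto simp: inj_on_def)
end

instantiation prod :: (coded, coded) coded begin
definition code_prod :: "'a \<times> 'b \<Rightarrow> nat" where "code_prod p = prod_encode (code (fst p), code (snd p))"
instance by standard (auto intro!: injI simp: code_prod_def prod_eq_iff)
end

instantiation list :: (coded) coded begin
definition code_list :: "'a list \<Rightarrow> nat" where "code_list xs = list_encode (map code xs)"
instance by standard (auto intro!: injI simp: code_list_def list_encode_eq dest: map_injective[OF _ inj_code])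
end

instantiation gen :: (coded) coded begin
primrec code_gen :: "'a gen \<Rightarrow> nat" where
  "code_gen (Gen i j) = code (0 :: nat, i, j)"
| "code_gen (GenInv i j) = code (1 :: nat, i, j)"
instance
proof (standard, rule injI)
  fix x y :: "'a gen" assume "code x = code y"
  then show "x = y" by (cases x; cases y) (auto simp del: code_nat_def)
qed
end

lemma code_Pair: "code (a, b) = prod_encode (code a, code b)"
  by (simp add: code_prod_def)

lemma code_Nil [simp]: "code [] = 0" and code_Cons: "code (x # xs) = Suc (prod_encode (code x, code xs))"
  by (simp_all add: code_list_def)

text \<open>\<open>g\<close> is constrained on codes only, so nothing has to recognise which numbers
  are codes.\<close>

definition computable :: "('a :: coded \<Rightarrow> 'b :: coded) \<Rightarrow> bool" where
  "computable f \<longleftrightarrow> (\<exists>g. total_rec1 g \<and> (\<forall>x. g (code x) = code (f x)))"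

named_theorems computable_intros

lemma computableI: "total_rec1 g \<Longrightarrow> (\<And>x. g (code x) = code (f x)) \<Longrightarrow> computable f"
  unfolding computable_def by blast

lemma computable_comp:
  assumes "computable f" "computable g"
  shows "computable (\<lambda>x. f (g x))"
proof -
  from assms obtain f' g' where f: "total_rec1 f'" "\<And>x. f' (code x) = code (f x)"
    and g: "total_rec1 g'" "\<And>x. g' (code x) = code (g x)" unfolding computable_def by metis
  show ?thesis by (rule computableI[OF total_rec_comp1[OF f(1) g(1)]]) (simp add: f g)
qed

lemma computable_id [computable_intros]: "computable (\<lambda>x. x)"
  by (rule computableI[of "\<lambda>x. x"]) (auto intro: total_rec_proj)

lemma computable_const [computable_intros]: "computable (\<lambda>x. c)"
  by (rule computableI[of "\<lambda>x. code c"]) (auto intro: total_rec_const)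

lemma computable_Pair [computable_intros]:
  assumes "computable f" "computable g"
  shows "computable (\<lambda>x. (f x, g x))"
proof -
  from assms obtain f' g' where "total_rec1 f'" "\<And>x. f' (code x) = code (f x)"
    "total_rec1 g'" "\<And>x. g' (code x) = code (g x)" unfolding computable_def by metis
  then show ?thesis
    by (intro computableI[of "\<lambda>x. prod_encode (f' x, g' x)"] total_rec_prod_encode)
      (simp_all add: code_Pair)
qed

lemma computable_fst [computable_intros]: "computable f \<Longrightarrow> computable (\<lambda>x. fst (f x))"
  by (rule computable_comp[OF computableI[of "\<lambda>p. fst (prod_decode p)"]])
    (auto simp: code_prod_def total_rec_prod_decode)

lemma computable_snd [computable_intros]: "computable f \<Longrightarrow> computable (\<lambda>x. snd (f x))"
  by (rule computable_comp[OF computableI[of "\<lambda>p. snd (prod_decode p)"]])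
    (auto simp: code_prod_def total_rec_prod_decode)

lemma computable_comp2:
  assumes "computable (\<lambda>p. h (fst p) (snd p))" "computable f" "computable g"
  shows "computable (\<lambda>x. h (f x) (g x))"
  using computable_comp[OF assms(1) computable_Pair[OF assms(2,3)]] by simp

lemma computable_recode:
  assumes "computable f" "\<And>x. code (g x) = code (f x)"
  shows "computable g"
  using assms unfolding computable_def by simp

text \<open>Two-argument arithmetic is lifted by unpairing, which lets the composition rule for one
  argument do the rest.\<close>

lemma computable_nat2:
  assumes "total_rec2 h" "computable f" "computable g"
  shows "computable (\<lambda>x. h (f x) (g x))"
proof -
  let ?h = "\<lambda>p. h (fst (prod_decode p)) (snd (prod_decode p))"
  have "total_rec1 ?h" by (rule total_rec_comp2[OF assms(1) total_rec_prod_decode])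
  then have "computable (\<lambda>p. h (fst p) (snd p))"
    by (rule computableI[of ?h]) (simp add: code_prod_def)
  from computable_comp2[OF this assms(2,3)] show ?thesis .
qed

lemmas computable_diff = computable_nat2[OF total_rec_diff]
lemmas computable_add = computable_nat2[OF total_rec_add]

lemma computable_code: "computable f \<Longrightarrow> computable (\<lambda>x. code (f x))"
  unfolding computable_def by simp

text \<open>The step may depend on the input \<open>x\<close>, whose code is carried through the
  primitive recursion as a parameter. Branching and all list recursions below reduce to this
  iteration.\<close>

lemma computable_iterate:
  fixes n :: "'a :: coded \<Rightarrow> nat" and s :: "'a \<Rightarrow> 's :: coded \<Rightarrow> 's"
  assumes n: "computable n" and a: "computable a" and s: "computable (\<lambda>p. s (fst p) (snd p))"
  shows "computable (\<lambda>x. (s x ^^ n x) (a x))"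
proof -
  from s obtain s' where s': "total_rec1 s'" "\<And>x. s' (code x) = code (s (fst x) (snd x))"
    unfolding computable_def by blast
  \<comment> \<open>The arguments are the step count, the code of the parameter and the code of the
    start value.\<close>
  define it where "it xs = rec_nat (xs ! 2) (\<lambda>k r. s' (prod_encode (xs ! 1, r))) (xs ! 0)" for xs
  have it: "total_rec (Suc (Suc (Suc 0))) it"
  proof (rule total_rec_cong)
    show "total_rec (Suc (Suc (Suc 0))) (\<lambda>xs. rec_nat (tl xs ! 1)
        (\<lambda>k r. (\<lambda>zs. s' (prod_encode (zs ! 2, zs ! 1))) (k # r # tl xs)) (hd xs))"
      by (intro total_rec_primrec[where n = "Suc (Suc 0)"] total_rec_comp1[OF s'(1)]
          total_rec_prod_encode total_rec_proj) simp_all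
  qed (auto simp: it_def length_Suc_conv)
  have "rec_nat (code y) (\<lambda>k r. s' (prod_encode (code x, r))) m = code ((s x ^^ m) y)" for x y m
    using s'(2)[of "(x, _)"] by (induction m) (auto simp: code_Pair)
  then have it_code: "it [m, code x, code y] = code ((s x ^^ m) y)" for m x y by (simp add: it_def)
  from n a obtain n' a' where n': "total_rec1 n'" "\<And>x. n' (code x) = code (n x)"
    and a': "total_rec1 a'" "\<And>x. a' (code x) = code (a x)" unfolding computable_def by metis
  have "total_rec (Suc 0) (\<lambda>xs. it (map (\<lambda>g. g xs) [\<lambda>xs. n' (xs ! 0), \<lambda>xs. xs ! 0, \<lambda>xs. a' (xs ! 0)]))"
    by (rule total_rec_comp) (auto simp: it n' a' total_rec_proj)
  then have "total_rec1 (\<lambda>p. it [n' p, p, a' p])" by simp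
  then show ?thesis by (rule computableI) (simp add: n' a' it_code)
qed

lemma computable_via_code:
  assumes "computable (g :: nat \<Rightarrow> nat)" "\<And>x. code (f x) = g (code x)"
  shows "computable f"
  using assms by (auto simp: computable_def)

lemma computable_eq [computable_intros]:
  assumes "computable f" "computable g"
  shows "computable (\<lambda>x. f x = g x)"
proof (rule computable_recode)
  \<comment> \<open>With truncated subtraction the two differences add up to the distance of the
    codes, and 1 minus this distance is the code of the truth value.\<close>
  show "computable (\<lambda>x. 1 - ((code (f x) - code (g x)) + (code (g x) - code (f x))))"
    by (intro computable_diff computable_add computable_code computable_const assms)
  fix x show "code (f x = g x) = code (1 - ((code (f x) - code (g x)) + (code (g x) - code (f x))))"
    using code_eq_iff[of "f x" "g x"] by (auto simp del: code_eq_iff)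
qed

lemma computable_not [computable_intros]: "computable P \<Longrightarrow> computable (\<lambda>x. \<not> P x)"
  using computable_eq[OF _ computable_const[of False]] by simp

lemma computable_if [computable_intros]:
  assumes "computable P" "computable f" "computable g"
  shows "computable (\<lambda>x. if P x then f x else g x)"
proof -
  \<comment> \<open>Branching as iteration: the constant function with value \<open>f x\<close> is
    applied to \<open>g x\<close> once if \<open>P x\<close> holds and not at all otherwise.\<close>
  have "computable (\<lambda>x. ((\<lambda>_. f x) ^^ code (P x)) (g x))"
    by (rule computable_iterate[OF computable_code])
      (intro assms computable_comp[OF assms(2)] computable_fst computable_id)+
  then show ?thesis by (rule computable_recode) simp
qed

lemma computable_conj [computable_intros]:
  "computable P \<Longrightarrow> computable Q \<Longrightarrow> computable (\<lambda>x. P x \<and> Q x)"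
  using computable_if[OF _ _ computable_const[of False], of P Q]
  by (rule computable_recode) auto

lemma computable_disj [computable_intros]:
  "computable P \<Longrightarrow> computable Q \<Longrightarrow> computable (\<lambda>x. P x \<or> Q x)"
  using computable_if[OF _ computable_const[of True], of P Q]
  by (rule computable_recode) auto

lemma computable_imp [computable_intros]:
  "computable P \<Longrightarrow> computable Q \<Longrightarrow> computable (\<lambda>x. P x \<longrightarrow> Q x)"
  using computable_if[OF _ _ computable_const[of True], of P Q]
  by (rule computable_recode) auto

lemma computable_Suc: "computable f \<Longrightarrow> computable (\<lambda>x. Suc (f x))"
  using computable_add[OF computable_const[of 1]] by simp

lemma computable_prod_encode:
  "computable f \<Longrightarrow> computable g \<Longrightarrow> computable (\<lambda>x. prod_encode (f x, g x))"
  using computable_code[OF computable_Pair, of f g] by (simp add: code_Pair)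

lemma computable_prod_decode:
  "computable (\<lambda>n. fst (prod_decode n))" "computable (\<lambda>n. snd (prod_decode n))"
  by (rule computableI[OF total_rec_prod_decode(1)], simp)
    (rule computableI[OF total_rec_prod_decode(2)], simp)

lemma computable_Cons [computable_intros]:
  assumes "computable f" "computable g"
  shows "computable (\<lambda>x. f x # g x)"
proof (rule computable_recode)
  show "computable (\<lambda>x. Suc (prod_encode (code (f x), code (g x))))"
    by (intro computable_Suc computable_prod_encode computable_code assms)
qed (simp add: code_Cons)

lemma computable_tl [computable_intros]:
  assumes "computable f" shows "computable (\<lambda>x. tl (f x))"
proof (rule computable_comp[OF _ assms], rule computable_via_code)
  \<comment> \<open>The code 0 of \<open>[]\<close> is sent to the second component of the pair
    coded by 0, which is 0 again; so \<open>tl [] = []\<close> needs no case distinction.\<close>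
  show "computable (\<lambda>n :: nat. snd (prod_decode (n - 1)))"
    by (rule computable_comp[OF computable_prod_decode(2)])
      (intro computable_diff computable_const computable_id)
  have "snd (prod_decode 0) = 0" by (simp add: prod_decode_def prod_decode_aux.simps)
  then show "code (tl xs) = snd (prod_decode (code xs - 1))" for xs :: "'b list"
    by (cases xs) (simp_all add: code_Cons)
qed

lemma computable_hd [computable_intros]:
  assumes "computable f" shows "computable (\<lambda>x. hd (f x :: 'b :: coded list))"
proof (rule computable_comp[OF _ assms], rule computable_via_code)
  \<comment> \<open>\<open>hd []\<close> is an unspecified but fixed element, so its code can be
    returned as a constant.\<close>
  show "computable (\<lambda>n. if n = 0 then code (hd [] :: 'b) else fst (prod_decode (n - 1)))"
    by (rule computable_if computable_comp[OF computable_prod_decode(1)] computable_eq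
        computable_diff computable_const computable_id)+
  show "code (hd xs) = (if code xs = 0 then code (hd [] :: 'b) else fst (prod_decode (code xs - 1)))"
    for xs :: "'b list" by (cases xs) (simp_all add: code_Cons)
qed

text \<open>Lets the code of a list serve as the number of iterations in
  \<open>computable_foldl\<close>, whose step idles once the list is used up.\<close>

lemma length_le_code: "length xs \<le> code xs"
proof (induction xs)
  case (Cons x xs)
  then show ?case using le_prod_encode_2[of "code xs" "code x"] by (simp add: code_Cons)
qed simp

lemma computable_foldl:
  fixes s :: "'a :: coded \<Rightarrow> 'r :: coded \<Rightarrow> 'b :: coded \<Rightarrow> 'r"
  assumes s: "computable (\<lambda>p. s (fst p) (fst (snd p)) (snd (snd p)))"
    and a: "computable a" and l: "computable l"
  shows "computable (\<lambda>x. foldl (s x) (a x) (l x))"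
proof -
  define st where "st x p = (if snd p = [] then p else (s x (fst p) (hd (snd p)), tl (snd p)))" for x p
  have st_n: "(st x ^^ n) (b, xs) = (foldl (s x) b (take n xs), drop n xs)" for x n b xs
  proof (induction n arbitrary: b xs)
    case (Suc n)
    then show ?case
      by (cases xs) (simp_all only: funpow_Suc_right comp_def, simp_all add: st_def Suc)
  qed simp
  have "computable (\<lambda>x. (st x ^^ code (l x)) (a x, l x))"
    unfolding st_def
    by (rule computable_iterate)
      (intro computable_intros a l computable_code computable_comp[OF s, of "\<lambda>p. (_ p, _ p, _ p)", simplified])+
  then have "computable (\<lambda>x. fst ((st x ^^ code (l x)) (a x, l x)))" by (rule computable_fst)
  then show ?thesis by (simp add: st_n length_le_code)
qed

lemma computable_rev:
  assumes "computable l" shows "computable (\<lambda>x. rev (l x))"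
proof -
  have "foldl (\<lambda>acc y. y # acc) acc xs = rev xs @ acc" for acc xs :: "'b list"
    by (induction xs arbitrary: acc) simp_all
  moreover have "computable (\<lambda>x. foldl (\<lambda>acc y. y # acc) [] (l x))"
    by (rule computable_foldl) (intro computable_intros assms)+
  ultimately show ?thesis by simp
qed

text \<open>The step of \<open>rec_list\<close> sees the remaining tail. A fold over the reversed
  list rebuilds that tail in its first component, next to the recursive value.\<close>

lemma computable_rec_list:
  fixes s :: "'a :: coded \<Rightarrow> 'b :: coded \<Rightarrow> 'b list \<Rightarrow> 'r :: coded \<Rightarrow> 'r"
  assumes s: "computable (\<lambda>p. s (fst p) (fst (snd p)) (fst (snd (snd p))) (snd (snd (snd p))))"
    and a: "computable a" and l: "computable l"
  shows "computable (\<lambda>x. rec_list (a x) (s x) (l x))"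
proof -
  have *: "foldl (\<lambda>p y. (y # fst p, s x y (fst p) (snd p))) ([], b) (rev xs) = (xs, rec_list b (s x) xs)"
    for x b xs by (induction xs) simp_all
  have "computable (\<lambda>x. foldl (\<lambda>p y. (y # fst p, s x y (fst p) (snd p))) ([], a x) (rev (l x)))"
  proof (rule computable_foldl[OF computable_Pair])
    have "computable (\<lambda>p :: 'a \<times> ('b list \<times> 'r) \<times> 'b. (fst p, snd (snd p), fst (snd p)))"
      by (intro computable_intros)
    from computable_comp[OF s this]
    show "computable (\<lambda>p :: 'a \<times> ('b list \<times> 'r) \<times> 'b. s (fst p) (snd (snd p)) (fst (fst (snd p))) (snd (fst (snd p))))"
      by simp
  qed (intro computable_intros computable_rev a l)+
  from computable_snd[OF this] show ?thesis by (simp add: *)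
qed

lemma computable_append [computable_intros]:
  assumes "computable f" "computable g" shows "computable (\<lambda>x. f x @ g x)"
proof -
  have "xs @ ys = rec_list ys (\<lambda>y _ r. y # r) xs" for xs ys :: "'b list" by (induction xs) simp_all
  then show ?thesis by (simp only:) (rule computable_rec_list; intro computable_intros assms)
qed

lemma computable_map [computable_intros]:
  assumes "computable (\<lambda>p. f (fst p) (snd p))" "computable l"
  shows "computable (\<lambda>x. map (\<lambda>y. f x y) (l x))"
proof -
  have *: "map (f x) xs = rec_list [] (\<lambda>y _ r. f x y # r) xs" for x xs by (induction xs) simp_all
  show ?thesis unfolding *
    by (rule computable_rec_list; intro computable_intros assms(2) computable_comp2[OF assms(1)])
qed

lemma computable_filter [computable_intros]:
  assumes "computable (\<lambda>p. P (fst p) (snd p))" "computable l"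
  shows "computable (\<lambda>x. filter (\<lambda>y. P x y) (l x))"
proof -
  have *: "filter (P x) xs = rec_list [] (\<lambda>y _ r. if P x y then y # r else r) xs" for x xs
    by (induction xs) simp_all
  show ?thesis unfolding *
    by (rule computable_rec_list; intro computable_intros assms(2) computable_comp2[OF assms(1)])
qed

lemma computable_Ball [computable_intros]:
  assumes "computable (\<lambda>p. P (fst p) (snd p))" "computable l"
  shows "computable (\<lambda>x. \<forall>y\<in>set (l x). P x y)"
  using computable_eq[OF computable_filter[OF assms] assms(2)] by (simp add: filter_id_conv)

lemma computable_Bex [computable_intros]:
  assumes "computable (\<lambda>p. P (fst p) (snd p))" "computable l"
  shows "computable (\<lambda>x. \<exists>y\<in>set (l x). P x y)"
  using computable_not[OF computable_eq[OF computable_filter[OF assms] computable_const[of "[]"]]]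
  by (simp add: filter_empty_conv)

lemma computable_mem [computable_intros]:
  assumes "computable f" "computable l"
  shows "computable (\<lambda>x. f x \<in> set (l x))"
proof -
  have "computable (\<lambda>x. \<exists>y\<in>set (l x). y = f x)"
    by (intro computable_Bex computable_eq computable_comp[OF assms(1)] computable_intros assms)
  then show ?thesis by (rule computable_recode) auto
qed

lemma computable_concat [computable_intros]:
  assumes "computable l" shows "computable (\<lambda>x. concat (l x))"
proof -
  have "concat xs = rec_list [] (\<lambda>y _ r. y @ r) xs" for xs :: "'b list list" by (induction xs) simp_all
  then show ?thesis by (simp only:) (rule computable_rec_list; intro computable_intros assms)
qed

lemma computable_last [computable_intros]:
  assumes "computable l" shows "computable (\<lambda>x. last (l x))"
proof -
  \<comment> \<open>Both are the same unspecified value, so \<open>last\<close> is \<open>hd\<close>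
    of the reversed list for the empty list too.\<close>
  have "last [] = hd ([] :: 'b list)" by (simp add: last_def hd_def)
  then have "last xs = hd (rev xs)" for xs :: "'b list" by (cases "xs = []") (simp_all add: hd_rev)
  then show ?thesis by (simp only:) (intro computable_intros computable_rev assms)
qed

text \<open>\<open>M\<close> ignores its search variable and returns the code of the negation of
  \<open>P x\<close>, so \<open>Mu M\<close> stops at once if \<open>P x\<close> holds and never
  otherwise. Composition with \<open>Proj 0\<close> keeps the value of \<open>G\<close> and inherits
  the divergence of \<open>Mu M\<close>.\<close>

lemma rec_eval_guarded:
  assumes "computable P" "computable f"
  shows "\<exists>F. \<forall>x y. rec_eval F [code x] y \<longleftrightarrow> P x \<and> y = code (f x)"
proof -
  from assms obtain p g where p: "total_rec1 p" "\<And>x. p (code x) = code (\<not> P x)"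
    and g: "total_rec1 g" "\<And>x. g (code x) = code (f x)"
    using computable_not[OF assms(1)] unfolding computable_def by metis
  have "total_rec 2 (\<lambda>xs. p (xs ! 1))" by (rule total_rec_comp1[OF p(1) total_rec_proj]) simp
  then obtain M where "\<And>xs. length xs = 2 \<Longrightarrow> rec_eval M xs (p (xs ! 1))"
    unfolding total_rec_def by blast
  from this[of "[_, _]"] have M: "rec_eval M [n, m] (p m)" for n m by simp
  from g(1) obtain G where "\<And>xs. length xs = Suc 0 \<Longrightarrow> rec_eval G xs (g (xs ! 0))"
    unfolding total_rec_def by blast
  from this[of "[_]"] have G: "rec_eval G [m] (g m)" for m by simp
  have mu: "rec_eval (Mu M) [code x] n \<longleftrightarrow> P x \<and> n = 0" for x n
    using rec_eval_Mu_iff[of M "[code x]" "\<lambda>_. p (code x)", OF M] p(2)[of x] by auto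
  have "rec_eval (Comp (Proj 0) [G, Mu M]) [code x] y \<longleftrightarrow> P x \<and> y = code (f x)" for x y
  proof
    assume "rec_eval (Comp (Proj 0) [G, Mu M]) [code x] y"
    then obtain ys where "list_all2 (\<lambda>F. rec_eval F [code x]) [G, Mu M] ys" and y: "rec_eval (Proj 0) ys y"
      by (rule rec_eval_CompE)
    then obtain u v where uv: "ys = [u, v]" "rec_eval G [code x] u" "rec_eval (Mu M) [code x] v"
      by (metis list_all2_Cons1 list_all2_Nil)
    have "u = g (code x)" using uv(2) G rec_eval_unique by blast
    moreover have "y = u" using y unfolding uv(1) by (rule rec_eval_ProjE) simp
    ultimately show "P x \<and> y = code (f x)" using uv(3) mu g(2) by simp
  next
    assume "P x \<and> y = code (f x)"
    then have "rec_eval G [code x] y" "rec_eval (Mu M) [code x] 0" using G[of "code x"] mu by (auto simp: g)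
    then show "rec_eval (Comp (Proj 0) [G, Mu M]) [code x] y"
      using rec_eval.intros(3)[of 0 "[y, 0]"] by (intro rec_eval.intros(4)[where ys = "[y, 0]"]) auto
  qed
  then show ?thesis by blast
qed

text \<open>The search runs through all naturals, while the test is specified on codes only;
  surjectivity of \<open>code\<close> makes every candidate a code. The witness found is the one of
  least code.\<close>

lemma rec_eval_search:
  fixes P :: "'a :: coded \<Rightarrow> 'b :: coded \<Rightarrow> bool"
  assumes "computable (\<lambda>p. P (fst p) (snd p))" and surj: "surj (code :: 'b \<Rightarrow> nat)"
  shows "\<exists>F. \<forall>x. (\<exists>z. P x z) \<longrightarrow> (\<exists>z. P x z \<and> (\<forall>y. rec_eval F [code x] y \<longleftrightarrow> y = code z))"
proof -
  from computable_not[OF assms(1)] obtain p where p: "total_rec1 p"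
    "\<And>x z. p (prod_encode (code x, code z)) = code (\<not> P x z)"
    unfolding computable_def by (fastforce simp: code_prod_def)
  have "total_rec 2 (\<lambda>xs. p (prod_encode (xs ! 1, xs ! 0)))"
    by (intro total_rec_comp1[OF p(1)] total_rec_prod_encode total_rec_proj) simp_all
  then obtain M where "\<And>xs. length xs = 2 \<Longrightarrow> rec_eval M xs (p (prod_encode (xs ! 1, xs ! 0)))"
    unfolding total_rec_def by blast
  from this[of "[_, _]"] have M: "rec_eval M [n, m] (p (prod_encode (m, n)))" for n m by simp
  have "\<exists>z. P x z \<and> (\<forall>y. rec_eval (Mu M) [code x] y \<longleftrightarrow> y = code z)" if P: "P x z0" for x z0
  proof -
    obtain z where z: "P x z" and least: "\<And>z'. P x z' \<Longrightarrow> code z \<le> code z'"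
      using ex_has_least_nat[of "P x" z0 code, OF P] by blast
    have min: "p (prod_encode (code x, code z')) \<noteq> 0" if "code z' < code z" for z' :: 'b
      using p(2)[of x z'] least[of z'] that by auto
    have "p (prod_encode (code x, m)) \<noteq> 0" if "m < code z" for m
      using min surjD[OF surj, of m] that by metis
    with z have "rec_eval (Mu M) [code x] (code z)"
      using rec_eval_Mu_iff[of M "[code x]" "\<lambda>n. p (prod_encode (code x, n))", OF M] p(2)[of x z] by simp
    then show ?thesis using z rec_eval_iff by blast
  qed
  then show ?thesis by blast
qed

lemma rec_eval_precomp:
  assumes "total_rec n f"
  shows "\<exists>G. \<forall>xs y. length xs = n \<longrightarrow> (rec_eval G xs y \<longleftrightarrow> rec_eval F [f xs] y)"
proof -
  from assms obtain H where H: "\<And>xs y. length xs = n \<Longrightarrow> rec_eval H xs y \<longleftrightarrow> y = f xs"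
    using total_recE by blast
  have "rec_eval (Comp F [H]) xs y \<longleftrightarrow> rec_eval F [f xs] y" if "length xs = n" for xs y
  proof
    assume "rec_eval (Comp F [H]) xs y"
    then obtain ys where "list_all2 (\<lambda>F. rec_eval F xs) [H] ys" and y: "rec_eval F ys y"
      by (rule rec_eval_CompE)
    then have "ys = [f xs]" using H[OF that] by (metis list_all2_Cons1 list_all2_Nil)
    with y show "rec_eval F [f xs] y" by simp
  next
    assume "rec_eval F [f xs] y"
    then show "rec_eval (Comp F [H]) xs y"
      by (intro rec_eval.intros(4)[where ys = "[f xs]"]) (simp_all add: H that)
  qed
  then show ?thesis by blast
qed

section \<open>Green's relations\<close>

text \<open>Reversing the product exchanges R and L, so one-sided facts are proved once and their
  mirror images are read off in \<open>opp S\<close>.\<close>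

definition opp :: "'a sgrp \<Rightarrow> 'a sgrp" where
  "opp S = \<lparr>carrier = carrier S, sprod = (\<lambda>x y. sprod S y x)\<rparr>"

lemma opp_simps [simp]: "carrier (opp S) = carrier S" "sprod (opp S) x y = sprod S y x"
  "idempotents (opp S) = idempotents S" "green_R (opp S) = green_L S" "green_L (opp S) = green_R S"
  by (simp_all add: opp_def idempotents_def green_R_def green_L_def right_ideal_of_def left_ideal_of_def)

locale semigroup_on =
  fixes S :: "'a sgrp"
  assumes is_semigroup: "is_semigroup S"
begin

abbreviation mul (infixl "\<cdot>" 70) where "x \<cdot> y \<equiv> sprod S x y"
abbreviation "C \<equiv> carrier S"
abbreviation "E \<equiv> idempotents S"
abbreviation "R \<equiv> green_R S"
abbreviation "L \<equiv> green_L S"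

lemma closed [simp, intro]: "x \<in> C \<Longrightarrow> y \<in> C \<Longrightarrow> x \<cdot> y \<in> C"
  using is_semigroup by (simp add: is_semigroup_def)

lemma assoc: "x \<in> C \<Longrightarrow> y \<in> C \<Longrightarrow> z \<in> C \<Longrightarrow> x \<cdot> y \<cdot> z = x \<cdot> (y \<cdot> z)"
  using is_semigroup by (simp add: is_semigroup_def)

lemma opp: "semigroup_on (opp S)"
  using is_semigroup by unfold_locales (simp add: is_semigroup_def)

lemma idemD [dest]: "f \<in> E \<Longrightarrow> f \<in> C" "f \<in> E \<Longrightarrow> f \<cdot> f = f"
  by (simp_all add: idempotents_def)

lemma idem_assoc: "f \<in> E \<Longrightarrow> x \<in> C \<Longrightarrow> f \<cdot> (f \<cdot> x) = f \<cdot> x"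
  by (simp add: idempotents_def flip: assoc)

lemma R_iff: "(x, y) \<in> R \<longleftrightarrow> x \<in> C \<and> y \<in> C \<and>
    (x = y \<or> (\<exists>s\<in>C. x \<cdot> s = y) \<and> (\<exists>t\<in>C. y \<cdot> t = x))"
proof
  assume "(x, y) \<in> R"
  then have C: "x \<in> C" "y \<in> C" and eq: "right_ideal_of S x = right_ideal_of S y"
    by (auto simp: green_R_def)
  from eq have "x \<in> right_ideal_of S y" "y \<in> right_ideal_of S x"
    unfolding right_ideal_of_def by blast+
  then show "x \<in> C \<and> y \<in> C \<and> (x = y \<or> (\<exists>s\<in>C. x \<cdot> s = y) \<and> (\<exists>t\<in>C. y \<cdot> t = x))"
    using C unfolding right_ideal_of_def insert_iff mem_Collect_eq by metis
next
  assume *: "x \<in> C \<and> y \<in> C \<and> (x = y \<or> (\<exists>s\<in>C. x \<cdot> s = y) \<and> (\<exists>t\<in>C. y \<cdot> t = x))"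
  have "right_ideal_of S (x \<cdot> s) \<subseteq> right_ideal_of S x" if "x \<in> C" "s \<in> C" for x s
    using that by (auto simp: right_ideal_of_def assoc)
  with * have "right_ideal_of S x = right_ideal_of S y" by (metis subset_antisym)
  with * show "(x, y) \<in> R" by (simp add: green_R_def)
qed

lemma R_C: "(x, y) \<in> R \<Longrightarrow> x \<in> C" "(x, y) \<in> R \<Longrightarrow> y \<in> C"
  by (auto simp: R_iff)

lemma R_refl: "x \<in> C \<Longrightarrow> (x, x) \<in> R"
  by (simp add: R_iff)

lemma R_sym: "(x, y) \<in> R \<Longrightarrow> (y, x) \<in> R"
  by (auto simp: green_R_def)

lemma R_trans: "(x, y) \<in> R \<Longrightarrow> (y, z) \<in> R \<Longrightarrow> (x, z) \<in> R"
  by (auto simp: green_R_def)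

lemma R_class_eq: "(x, y) \<in> R \<Longrightarrow> R `` {x} = R `` {y}"
  using R_sym R_trans by blast

lemma R_cong:
  assumes "(x, y) \<in> R" "z \<in> C" shows "(z \<cdot> x, z \<cdot> y) \<in> R"
proof (cases "x = y")
  case True
  then show ?thesis using assms R_refl R_C by auto
next
  case False
  then obtain s t where "s \<in> C" "x \<cdot> s = y" "t \<in> C" "y \<cdot> t = x" using assms(1) by (auto simp: R_iff)
  with assms R_C[OF assms(1)] have "z \<cdot> x \<cdot> s = z \<cdot> y" "z \<cdot> y \<cdot> t = z \<cdot> x" by (simp_all add: assoc)
  with \<open>s \<in> C\<close> \<open>t \<in> C\<close> assms R_C[OF assms(1)] show ?thesis by (auto simp: R_iff)
qed

lemma R_idem:
  assumes "f \<in> E" "(f, x) \<in> R"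
  shows "f \<cdot> x = x" and "\<exists>s\<in>C. x \<cdot> s = f"
  using assms by (auto simp: R_iff idem_assoc)

lemma R_idemI: "f \<in> E \<Longrightarrow> x \<in> C \<Longrightarrow> f \<cdot> x = x \<Longrightarrow> s \<in> C \<Longrightarrow> x \<cdot> s = f \<Longrightarrow> (f, x) \<in> R"
  by (auto simp: R_iff)

lemmas L_iff = semigroup_on.R_iff[OF opp, simplified]
lemmas L_C = semigroup_on.R_C[OF opp, simplified]
lemmas L_refl = semigroup_on.R_refl[OF opp, simplified]
lemmas L_sym = semigroup_on.R_sym[OF opp, simplified]
lemmas L_trans = semigroup_on.R_trans[OF opp, simplified]
lemmas L_class_eq = semigroup_on.R_class_eq[OF opp, simplified]
lemmas L_cong = semigroup_on.R_cong[OF opp, simplified]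
lemmas L_idem = semigroup_on.R_idem[OF opp, simplified]
lemmas L_idemI = semigroup_on.R_idemI[OF opp, simplified]

text \<open>The witness is \<open>p \<cdot> x = z \<cdot> t\<close>: the left multiplier from
  \<open>y\<close> to \<open>z\<close> applied to \<open>x\<close>, which is also the right
  multiplier from \<open>y\<close> to \<open>x\<close> applied to \<open>z\<close>.\<close>

lemma R_L_commute:
  assumes "(x, y) \<in> R" "(y, z) \<in> L" shows "\<exists>w. (x, w) \<in> L \<and> (w, z) \<in> R"
proof (cases "x = y \<or> y = z")
  case True
  then show ?thesis using assms R_refl L_refl R_C L_C by metis
next
  case False
  note C = R_C[OF assms(1)] L_C[OF assms(2)]
  from False assms obtain s t p q where st: "s \<in> C" "x \<cdot> s = y" "t \<in> C" "y \<cdot> t = x"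
    and pq: "p \<in> C" "p \<cdot> y = z" "q \<in> C" "q \<cdot> z = y" by (auto simp: R_iff L_iff)
  have px: "p \<cdot> x = z \<cdot> t" using st pq C by (metis assoc)
  have "q \<cdot> (p \<cdot> x) = x" unfolding px using st pq C by (metis assoc)
  then have "(x, p \<cdot> x) \<in> L" using C pq by (auto simp: L_iff)
  moreover have "p \<cdot> x \<cdot> s = z" using st pq C by (metis assoc)
  then have "(p \<cdot> x, z) \<in> R" using px C st pq by (auto simp: R_iff)
  ultimately show ?thesis by blast
qed

lemmas L_R_commute = semigroup_on.R_L_commute[OF opp, simplified]

text \<open>An element L-related to an idempotent is regular: \<open>p \<cdot> v = e\<close> and
  \<open>v \<cdot> e = v\<close> give \<open>v \<cdot> p \<cdot> v = v\<close>, and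
  \<open>v \<cdot> p\<close> is the idempotent sought.\<close>

lemma L_class_idem:
  assumes "e \<in> E" "(e, v) \<in> L" shows "\<exists>f\<in>E. (f, v) \<in> R"
proof -
  from L_idem[OF assms] obtain p where p: "p \<in> C" "p \<cdot> v = e" and ve: "v \<cdot> e = v" by auto
  note C = L_C[OF assms(2)]
  have "v \<cdot> p \<cdot> v = v" using p ve C by (simp add: assoc)
  then have "v \<cdot> p \<in> E" "(v \<cdot> p, v) \<in> R"
    using p C by (auto simp: idempotents_def R_iff assoc) (metis assoc closed)+
  then show ?thesis by blast
qed

text \<open>One half of the Miller-Clifford theorem: \<open>x \<cdot> f = x\<close> and
  \<open>f \<cdot> y = y\<close>, so multiplying \<open>f R y\<close> by \<open>x\<close> and
  \<open>x L f\<close> by \<open>y\<close> gives both claims.\<close>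

lemma mult_through_idem:
  assumes "f \<in> E" "(x, f) \<in> L" "(f, y) \<in> R" shows "(x, x \<cdot> y) \<in> R" "(y, x \<cdot> y) \<in> L"
  using R_cong[OF assms(3), of x] L_cong[OF assms(2), of y] L_idem[OF assms(1) L_sym[OF assms(2)]]
    R_idem[OF assms(1,3)] L_C[OF assms(2)] R_C[OF assms(3)] L_sym by auto

text \<open>The converse half: multipliers with \<open>x \<cdot> y \<cdot> t = x\<close> and
  \<open>s \<cdot> (x \<cdot> y) = y\<close> give \<open>y \<cdot> t = s \<cdot> x\<close>, and this
  element is the idempotent.\<close>

lemma idem_from_mult:
  assumes "(x, x \<cdot> y) \<in> R" "(y, x \<cdot> y) \<in> L" "x \<in> C" "y \<in> C"
  shows "\<exists>f\<in>E. (x, f) \<in> L \<and> (f, y) \<in> R"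
proof -
  from assms(1) obtain t where t: "t \<in> C" "x \<cdot> y \<cdot> t = x"
    by (cases "x = x \<cdot> y") (use assms(4) in \<open>auto simp: R_iff\<close>)
  from assms(2) obtain s where s: "s \<in> C" "s \<cdot> (x \<cdot> y) = y"
    by (cases "y = x \<cdot> y") (use assms(3) in \<open>auto simp: L_iff\<close>)
  have yty: "y \<cdot> t \<cdot> y = y" using s t assms(3,4) by (metis assoc closed)
  then have f: "y \<cdot> t \<in> E" using t assms(4) by (simp add: idempotents_def) (metis assoc closed)
  have "(y \<cdot> t, y) \<in> R" using yty t assms(4) by (auto simp: R_iff)
  moreover have "s \<cdot> x = y \<cdot> t" using s t assms(3,4) by (metis assoc closed)
  then have "(x, y \<cdot> t) \<in> L" using s t assms(3,4) by (auto simp: L_iff assoc)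
  ultimately show ?thesis using f by blast
qed

abbreviation "Hclass x \<equiv> R `` {x} \<inter> L `` {x}"

lemma H_idem_unique:
  assumes "f \<in> E" "g \<in> E" "(f, g) \<in> R" "(f, g) \<in> L" shows "f = g"
  using R_idem(1)[OF assms(1,3)] L_idem(1)[OF assms(2) L_sym[OF assms(4)]] by simp

lemma H_group:
  assumes "f \<in> E" shows "group (sub_monoid S (Hclass f) f)"
proof (rule groupI; simp add: sub_monoid_def)
  show "(f, f) \<in> R \<and> (f, f) \<in> L" using assms R_refl L_refl by blast
next
  fix x y assume x: "(f, x) \<in> R \<and> (f, x) \<in> L" and y: "(f, y) \<in> R \<and> (f, y) \<in> L"
  then have "(x, x \<cdot> y) \<in> R" "(y, x \<cdot> y) \<in> L"
    using mult_through_idem[OF assms, of x y] L_sym by auto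
  then show "(f, x \<cdot> y) \<in> R \<and> (f, x \<cdot> y) \<in> L" using x y R_trans L_trans by blast
next
  fix x assume "(f, x) \<in> R \<and> (f, x) \<in> L"
  then show "f \<cdot> x = x" using R_idem assms by blast
next
  fix x assume x: "(f, x) \<in> R \<and> (f, x) \<in> L"
  then obtain s t where s: "s \<in> C" "x \<cdot> s = f" and t: "t \<in> C" "t \<cdot> x = f"
    using R_idem(2)[OF assms] L_idem(2)[OF assms] by meson
  have C: "x \<in> C" "f \<in> C" using x R_C by auto
  have fx: "f \<cdot> x = x" "x \<cdot> f = x" using x R_idem(1) L_idem(1) assms by auto
  \<comment> \<open>The left multiplier \<open>t\<close> cut down to the H-class of
    \<open>f\<close>; after that it is a right inverse as well.\<close>
  define s' where "s' = f \<cdot> t \<cdot> f"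
  have s'C: "s' \<in> C" using C t by (simp add: s'_def)
  have s'x: "s' \<cdot> x = f" using C t fx assms by (simp add: s'_def assoc idempotents_def)
  have fs': "f \<cdot> s' = s'" "s' \<cdot> f = s'" using C t assms by (simp_all add: s'_def assoc idem_assoc idempotents_def)
  have "s' = s' \<cdot> (x \<cdot> s)" using fs' s by simp
  also have "\<dots> = s' \<cdot> x \<cdot> s" using C s(1) s'C by (simp add: assoc)
  also have "\<dots> = f \<cdot> s" by (simp add: s'x)
  finally have "x \<cdot> s' = f" using C s fx by (metis assoc)
  then have "(f, s') \<in> R" "(f, s') \<in> L" using assms fs' s'x s'C C R_idemI L_idemI by auto
  with s'x show "\<exists>y\<in>Hclass f. y \<cdot> x = f" by blast
qed (use R_C(2) in \<open>blast intro: assoc\<close>)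

text \<open>Left multiplications commute with the right action of \<open>w\<close>, so a
  \<open>w\<close> that fixes one element of an L-class fixes all of them.\<close>

lemma idem_absorb:
  assumes "f \<in> E" "(f, x) \<in> L" "x \<cdot> w = x" "w \<in> C" shows "f \<cdot> w = f"
proof -
  from L_idem(2)[OF assms(1,2)] obtain t where t: "t \<in> C" "t \<cdot> x = f" by blast
  then show ?thesis using assms(3,4) L_C[OF assms(2)] by (metis assoc)
qed

lemmas opp_idem_absorb = semigroup_on.idem_absorb[OF opp, simplified]

end

section \<open>Stability of completely 0-simple semigroups\<close>

lemma completely_0_simple_opp:
  assumes "completely_0_simple T z" shows "completely_0_simple (opp T) z"
proof -
  have "is_semigroup (opp T)" using assms by (simp add: completely_0_simple_def is_semigroup_def)
  moreover have "is_zero (opp T) z" using assms by (auto simp: completely_0_simple_def is_zero_def)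
  moreover have "{sprod T y x |x y. x \<in> carrier T \<and> y \<in> carrier T} =
      {sprod T x y |x y. x \<in> carrier T \<and> y \<in> carrier T}" by auto
  moreover have "is_ideal (opp T) = is_ideal T" by (auto simp: is_ideal_def fun_eq_iff)
  moreover have "primitive_idempotent (opp T) = primitive_idempotent T"
    by (auto simp: primitive_idempotent_def fun_eq_iff)
  ultimately show ?thesis using assms by (simp add: completely_0_simple_def)
qed

context semigroup_on begin

text \<open>The multipliers lie in \<open>C\<close>, without adjoining an identity. The elements all
  of whose two-sided multiples vanish form an ideal \<open>N\<close>; as every element is a product,
  \<open>N = C\<close> would make all products vanish.\<close>

lemma zero_simple_generated:
  assumes "completely_0_simple S z" "a \<in> C" "a \<noteq> z" "b \<in> C"
  shows "\<exists>x\<in>C. \<exists>y\<in>C. b = x \<cdot> a \<cdot> y"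
proof -
  have z: "z \<in> C" "\<And>s. s \<in> C \<Longrightarrow> z \<cdot> s = z \<and> s \<cdot> z = z"
    using assms(1) by (auto simp: completely_0_simple_def is_zero_def)
  have ideal: "is_ideal S A \<Longrightarrow> A = {z} \<or> A = C" for A
    using assms(1) by (auto simp: completely_0_simple_def)
  define T2 where "T2 = {x \<cdot> y |x y. x \<in> C \<and> y \<in> C}"
  have T2: "T2 \<noteq> {z}" using assms(1) by (simp add: completely_0_simple_def T2_def)
  have "is_ideal S T2" using z(1) by (auto simp: is_ideal_def T2_def; metis assoc closed)
  with T2 have T2C: "T2 = C" using ideal by blast
  define N where "N = {a \<in> C. \<forall>x\<in>C. \<forall>y\<in>C. x \<cdot> a \<cdot> y = z}"
  have "is_ideal S N" unfolding is_ideal_def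
  proof (intro conjI ballI)
    show "N \<noteq> {}" using z by (auto simp: N_def)
    fix a s assume "a \<in> N" "s \<in> C"
    then show "a \<cdot> s \<in> N" "s \<cdot> a \<in> N" by (simp_all add: N_def) (metis assoc closed)+
  qed (auto simp: N_def)
  moreover have "N \<noteq> C"
  proof
    assume N: "N = C"
    have "u \<cdot> v = z" if "u \<in> C" "v \<in> C" for u v
    proof -
      from that(1) T2C obtain x y where "x \<in> C" "y \<in> C" "u = x \<cdot> y" unfolding T2_def by blast
      with N that(2) show ?thesis unfolding N_def by blast
    qed
    then have "T2 \<subseteq> {z}" unfolding T2_def by auto
    then have "T2 = {z}" using z(1) T2C by blast
    with T2 show False by simp
  qed
  ultimately have "a \<notin> N" using ideal assms(3) by blast
  define A where "A = {x \<cdot> a \<cdot> y |x y. x \<in> C \<and> y \<in> C}"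
  have "is_ideal S A" unfolding is_ideal_def
  proof (intro conjI ballI)
    show "A \<noteq> {}" using z by (auto simp: A_def)
    fix b s assume "b \<in> A" "s \<in> C"
    then obtain x y where xy: "b = x \<cdot> a \<cdot> y" "x \<in> C" "y \<in> C" by (auto simp: A_def)
    have "b \<cdot> s = x \<cdot> a \<cdot> (y \<cdot> s)" "s \<cdot> b = (s \<cdot> x) \<cdot> a \<cdot> y"
      using xy \<open>s \<in> C\<close> assms(2) by (simp_all add: assoc)
    then show "b \<cdot> s \<in> A" "s \<cdot> b \<in> A" unfolding A_def using xy \<open>s \<in> C\<close> closed by blast+
  qed (use assms(2) in \<open>auto simp: A_def\<close>)
  moreover have "A \<noteq> {z}" using \<open>a \<notin> N\<close> assms(2) by (auto simp: A_def N_def)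
  ultimately have "A = C" using ideal by blast
  then have "b \<in> A" using assms(4) by simp
  then show ?thesis unfolding A_def by blast
qed

text \<open>Every element factors through the primitive idempotent \<open>p\<close>, which reduces
  the claim to \<open>reach\<close>: \<open>p\<close> generates a minimal nonzero right
  ideal.\<close>

lemma completely_0_simple_stable:
  assumes c0s: "completely_0_simple S z" and x: "x \<in> C" and y: "y \<in> C"
    and nz: "x \<cdot> y \<noteq> z"
  shows "\<exists>w\<in>C. x \<cdot> y \<cdot> w = x"
proof -
  have z: "z \<in> C" "\<And>s. s \<in> C \<Longrightarrow> z \<cdot> s = z \<and> s \<cdot> z = z"
    using c0s by (auto simp: completely_0_simple_def is_zero_def)
  from c0s obtain p where "primitive_idempotent S z p" unfolding completely_0_simple_def by blast
  then have p: "p \<in> E" "p \<noteq> z"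
    and prim: "\<And>f. f \<in> E \<Longrightarrow> f \<noteq> z \<Longrightarrow> p \<cdot> f = f \<Longrightarrow> f \<cdot> p = f \<Longrightarrow> f = p"
    by (simp_all add: primitive_idempotent_def)
  have pC: "p \<in> C" "p \<cdot> p = p" using idemD[OF p(1)] by simp_all
  have pp: "p \<cdot> (p \<cdot> u) = p \<cdot> u" if "u \<in> C" for u using idem_assoc[OF p(1) that] .
  have reach: "\<exists>w\<in>C. a \<cdot> w = p" if a: "a \<in> C" "a \<noteq> z" "p \<cdot> a = a" for a
  proof -
    from zero_simple_generated[OF c0s a(1,2) pC(1)]
    obtain u v where uv: "u \<in> C" "v \<in> C" "p = u \<cdot> a \<cdot> v" by blast
    define u' v' where "u' = p \<cdot> u \<cdot> p" and "v' = v \<cdot> p"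
    have C': "u' \<in> C" "v' \<in> C" using uv pC by (auto simp: u'_def v'_def)
    have pa: "p \<cdot> (a \<cdot> w) = a \<cdot> w" if "w \<in> C" for w using that a pC by (metis assoc)
    have "u' \<cdot> a \<cdot> v' = p \<cdot> (u \<cdot> a \<cdot> v) \<cdot> p"
      using uv(1,2) a pC by (simp add: u'_def v'_def assoc pa)
    then have uav: "u' \<cdot> a \<cdot> v' = p" using uv(3) pC by simp
    have pu: "u' \<cdot> p = u'" using uv(1) pC by (simp add: u'_def assoc)
    have pu': "p \<cdot> u' = u'" using uv(1) pC by (simp add: u'_def assoc pp)
    \<comment> \<open>An idempotent below \<open>p\<close>, built from
      \<open>p = u' \<cdot> a \<cdot> v'\<close>. Primitivity forces \<open>f = p\<close>, which
      makes \<open>v' \<cdot> u'\<close> the right multiplier from \<open>a\<close> to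
      \<open>p\<close>.\<close>
    define f where "f = a \<cdot> v' \<cdot> u'"
    have fC: "f \<in> C" using a C' by (simp add: f_def)
    have "f \<cdot> f = a \<cdot> v' \<cdot> (u' \<cdot> a \<cdot> v') \<cdot> u'" using a C' by (simp add: f_def assoc)
    also have "\<dots> = f" using a C' pC pu' by (simp add: uav f_def assoc)
    finally have fE: "f \<in> E" using fC by (simp add: idempotents_def)
    have pf: "p \<cdot> f = f" "f \<cdot> p = f" using a C' pC pu pa by (simp_all add: f_def assoc)
    have "u' \<cdot> f \<cdot> (a \<cdot> v') = (u' \<cdot> a \<cdot> v') \<cdot> (u' \<cdot> a \<cdot> v')" using a C' by (simp add: f_def assoc)
    then have "u' \<cdot> f \<cdot> (a \<cdot> v') = p" using uav pC by simp
    then have "f \<noteq> z" using p(2) z a(1) C' by auto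
    from prim[OF fE this pf] have "a \<cdot> (v' \<cdot> u') = p" using a C' by (simp add: f_def assoc)
    then show ?thesis using C' by blast
  qed
  from zero_simple_generated[OF c0s pC(1) p(2) x]
  obtain s t where st: "s \<in> C" "t \<in> C" "x = s \<cdot> p \<cdot> t" by blast
  define b where "b = p \<cdot> t"
  have b: "b \<in> C" "p \<cdot> b = b" "x = s \<cdot> b" using st pC pp by (auto simp: b_def assoc)
  have xy: "x \<cdot> y = s \<cdot> (b \<cdot> y)" using b st y by (simp add: assoc)
  have "b \<cdot> y \<noteq> z" using nz xy z st by auto
  moreover have "p \<cdot> (b \<cdot> y) = b \<cdot> y" using b y pC by (simp flip: assoc)
  ultimately obtain w where w: "w \<in> C" "b \<cdot> y \<cdot> w = p" using reach[of "b \<cdot> y"] b y by blast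
  have "x \<cdot> y \<cdot> (w \<cdot> b) = s \<cdot> (b \<cdot> y \<cdot> w) \<cdot> b" using xy b st y w(1) by (simp add: assoc)
  also have "\<dots> = x" using w b st pC by (simp add: assoc)
  finally show ?thesis using w b by blast
qed

end

text \<open>The multiplier found in the principal factor cannot be its zero, because the product is
  \<open>Some x\<close>; so it comes from D and also works in \<open>S\<close>.\<close>

lemma principal_factor_stable_R:
  assumes "is_semigroup S" "D \<subseteq> carrier S" "completely_0_simple (principal_factor S D) None"
    "x \<in> D" "y \<in> D" "sprod S x y \<in> D"
  shows "(x, sprod S x y) \<in> green_R S"
proof -
  interpret semigroup_on S using assms(1) by unfold_locales
  interpret T: semigroup_on "principal_factor S D"
    using assms(3) by unfold_locales (simp add: completely_0_simple_def)
  have "\<exists>w\<in>carrier (principal_factor S D).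
      sprod (principal_factor S D) (sprod (principal_factor S D) (Some x) (Some y)) w = Some x"
    using assms(4-6) by (intro T.completely_0_simple_stable[OF assms(3)]) (auto simp: principal_factor_def)
  then obtain w where "w \<in> D" "sprod S (sprod S x y) w = x"
    using assms(4-6) by (auto simp: principal_factor_def split: if_splits)
  then show ?thesis using assms(2,4-6) by (auto simp: R_iff)
qed

lemma principal_factor_opp: "principal_factor (opp S) D = opp (principal_factor S D)"
  by (auto simp: principal_factor_def opp_def fun_eq_iff split: option.split)

lemma principal_factor_stable_L:
  assumes "is_semigroup S" "D \<subseteq> carrier S" "completely_0_simple (principal_factor S D) None"
    "x \<in> D" "y \<in> D" "sprod S x y \<in> D"
  shows "(y, sprod S x y) \<in> green_L S"
proof -
  have "is_semigroup (opp S)" using assms(1) by (simp add: is_semigroup_def)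
  moreover have "completely_0_simple (principal_factor (opp S) D) None"
    using completely_0_simple_opp[OF assms(3)] by (simp add: principal_factor_opp)
  ultimately show ?thesis using principal_factor_stable_R[of "opp S" D y x] assms by simp
qed

section \<open>The free idempotent generated semigroup\<close>

lemma ig_eq_words:
  "ig_eq B u v \<Longrightarrow> u \<noteq> [] \<and> u \<in> lists (carrier B) \<and> v \<noteq> [] \<and> v \<in> lists (carrier B)"
  by (induction rule: ig_eq.induct) auto

lemma ig_eq_context:
  assumes "ig_eq B u v" "x \<in> lists (carrier B)" "y \<in> lists (carrier B)"
  shows "ig_eq B (x @ u @ y) (x @ v @ y)"
  using assms
proof (induction rule: ig_eq.induct)
  case (rel e f g u v)
  from rel(1-4) ig_eq.rel[of e B f g "x @ u" "v @ y"] rel(5-8) show ?case by simp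
next
  case (refl u)
  then show ?case by (intro ig_eq.refl) auto
qed (blast intro: ig_eq.sym ig_eq.trans)+

text \<open>A biordered set comes without a semigroup; one semigroup realising it is fixed here, as
  the place where words are evaluated.\<close>

locale biordered = S: semigroup_on S for S :: "'a sgrp" +
  fixes B :: "'a partial_algebra"
  assumes B: "B = biordered_set_of S"
begin

abbreviation "I \<equiv> IG B"
abbreviation gmul (infixl "\<bullet>" 70) where "X \<bullet> Y \<equiv> sprod I X Y"
abbreviation "c \<equiv> cls B"

definition word :: "'a list \<Rightarrow> bool" where "word w \<longleftrightarrow> w \<noteq> [] \<and> w \<in> lists S.E"

lemma carrier_B [simp]: "carrier B = S.E"
  by (simp add: B biordered_set_of_def)

lemma word_simps [simp]: "word [a] \<longleftrightarrow> a \<in> S.E" "word (a # u) \<longleftrightarrow> a \<in> S.E \<and> u \<in> lists S.E"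
  "\<not> word []"
  by (auto simp: word_def)

lemma word_append: "word u \<Longrightarrow> word v \<Longrightarrow> word (u @ v)"
  by (auto simp: word_def)

lemma word_lists: "word u \<Longrightarrow> u \<in> lists S.E"
  by (auto simp: word_def)

lemma ig_eq_word: "ig_eq B u v \<Longrightarrow> word u \<and> word v"
  using ig_eq_words[of B u v] by (auto simp: word_def)

lemma cls_eq_iff:
  assumes "word u" shows "c u = c v \<longleftrightarrow> ig_eq B u v"
proof
  assume "c u = c v"
  moreover have "u \<in> c u" using assms ig_eq.refl[of u B] by (simp add: cls_def word_def)
  ultimately show "ig_eq B u v" by (auto simp: cls_def intro: ig_eq.sym)
next
  assume "ig_eq B u v"
  then show "c u = c v" unfolding cls_def using ig_eq.sym ig_eq.trans by blast
qed

lemma cls_eqI: "ig_eq B u v \<Longrightarrow> c u = c v"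
  using ig_eq_word cls_eq_iff by blast

lemma cls_context:
  assumes "c u = c v" "word u" "x \<in> lists S.E" "y \<in> lists S.E"
  shows "c (x @ u @ y) = c (x @ v @ y)"
  using assms ig_eq_context[of B u v x y] by (simp add: cls_eq_iff cls_eqI)

lemma in_cls: "v \<in> c u \<Longrightarrow> word v \<and> c v = c u"
  using ig_eq_word cls_eqI unfolding cls_def by blast

text \<open>The product in \<open>IG\<close> is a union over representatives. By congruence all its
  members coincide, so the union is a single class.\<close>

lemma IG_mult:
  assumes "word u" "word v" shows "c u \<bullet> c v = c (u @ v)"
proof -
  have "c (u' @ v') = c (u @ v)" if "u' \<in> c u" "v' \<in> c v" for u' v'
  proof -
    have *: "word u'" "c u' = c u" "word v'" "c v' = c v" using that in_cls by auto
    have "c (u' @ v') = c (u @ v')"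
      using cls_context[of u' u "[]" v'] * by (simp add: word_lists)
    also have "\<dots> = c (u @ v)"
      using cls_context[of v' v u "[]"] * assms by (simp add: word_lists)
    finally show ?thesis .
  qed
  moreover have "u \<in> c u" "v \<in> c v"
    using assms by (auto simp: cls_def word_def intro: ig_eq.refl)
  ultimately have "(\<Union>u'\<in>c u. \<Union>v'\<in>c v. c (u' @ v')) = c (u @ v)" by blast
  then show ?thesis by (simp add: IG_def)
qed

lemma carrier_IG: "carrier I = {c w |w. word w}"
  by (auto simp: IG_def word_def)

lemma IG_cases: "X \<in> carrier I \<Longrightarrow> (\<And>w. word w \<Longrightarrow> X = c w \<Longrightarrow> thesis) \<Longrightarrow> thesis"
  by (auto simp: carrier_IG)

lemma cls_in_IG: "word w \<Longrightarrow> c w \<in> carrier I"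
  by (auto simp: carrier_IG)

lemma semigroup_IG: "semigroup_on I"
proof
  show "is_semigroup I" unfolding is_semigroup_def
  proof (intro conjI ballI)
    fix X Y assume "X \<in> carrier I" "Y \<in> carrier I"
    then show "X \<bullet> Y \<in> carrier I"
      by (elim IG_cases) (simp add: IG_mult word_append cls_in_IG)
  next
    fix X Y Z assume "X \<in> carrier I" "Y \<in> carrier I" "Z \<in> carrier I"
    then show "X \<bullet> Y \<bullet> Z = X \<bullet> (Y \<bullet> Z)"
      by (elim IG_cases) (simp add: IG_mult word_append)
  qed
qed

sublocale G: semigroup_on I
  by (rule semigroup_IG)

section \<open>Evaluation of words in the realising semigroup\<close>

fun ev :: "'a list \<Rightarrow> 'a" where
  "ev [a] = a"
| "ev (a # u) = a \<cdot> ev u"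

lemma ev_Cons: "u \<noteq> [] \<Longrightarrow> ev (a # u) = a \<cdot> ev u"
  by (cases u) simp_all

lemma ev_C: "word w \<Longrightarrow> ev w \<in> S.C"
proof (induction w)
  case (Cons a w)
  then show ?case by (cases "w = []") (auto simp: ev_Cons word_def)
qed simp

lemma ev_append: "word u \<Longrightarrow> word v \<Longrightarrow> ev (u @ v) = ev u \<cdot> ev v"
proof (induction u)
  case (Cons a u)
  then show ?case
    using ev_C[of u] ev_C[of v] S.idemD(1)[of a]
    by (cases "u = []") (auto simp: ev_Cons word_def S.assoc)
qed simp

lemma star_B: "star B a b = (if basic_pair S a b then Some (a \<cdot> b) else None)"
  by (simp add: B biordered_set_of_def)

lemma ev_ig_eq: "ig_eq B u v \<Longrightarrow> ev u = ev v"
proof (induction rule: ig_eq.induct)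
  case (rel e f g u v)
  then have g: "g = e \<cdot> f" by (auto simp: star_B split: if_splits)
  have *: "word [e, f]" "word [g]" "ev [e, f] = ev [g]" using rel g by auto
  have "ev (x @ v) = ev (y @ v)" if "word x" "word y" "ev x = ev y" for x y
    using that rel by (cases "v = []") (auto simp: ev_append word_def)
  from this[OF *] have "ev ([e, f] @ v) = ev ([g] @ v)" .
  then show ?case
    using rel * by (cases "u = []") (simp_all add: ev_append word_def)
qed simp_all

lemma ev_cls: "c u = c v \<Longrightarrow> word u \<Longrightarrow> ev u = ev v"
  using cls_eq_iff ev_ig_eq by blast

lemma cls_letter_eq_iff: "a \<in> S.E \<Longrightarrow> b \<in> S.E \<Longrightarrow> c [a] = c [b] \<longleftrightarrow> a = b"
  using ev_cls[of "[a]" "[b]"] by auto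

lemma ev_mult: "c (u @ v) = c w \<Longrightarrow> word u \<Longrightarrow> word v \<Longrightarrow> ev u \<cdot> ev v = ev w"
  using ev_cls[of "u @ v" w] by (simp add: ev_append word_append)

lemma hom_R:
  assumes "(c u, c v) \<in> G.R" "word u" "word v" shows "(ev u, ev v) \<in> S.R"
proof (cases "c u = c v")
  case True
  then show ?thesis using ev_cls[OF True assms(2)] S.R_refl[OF ev_C[OF assms(3)]] by simp
next
  case False
  then obtain X Y where XY: "X \<in> G.C" "c u \<bullet> X = c v" "Y \<in> G.C" "c v \<bullet> Y = c u"
    using assms(1) unfolding G.R_iff by blast
  from XY(1,3) obtain x y where xy: "word x" "X = c x" "word y" "Y = c y" by (auto elim!: IG_cases)
  with XY assms have "c (u @ x) = c v" "c (v @ y) = c u" by (simp_all add: IG_mult)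
  then have "ev u \<cdot> ev x = ev v" "ev v \<cdot> ev y = ev u"
    using assms xy by (simp_all add: ev_mult)
  then show ?thesis using xy assms by (auto simp: S.R_iff ev_C)
qed

lemma hom_L:
  assumes "(c u, c v) \<in> G.L" "word u" "word v" shows "(ev u, ev v) \<in> S.L"
proof (cases "c u = c v")
  case True
  then show ?thesis using ev_cls[OF True assms(2)] S.L_refl[OF ev_C[OF assms(3)]] by simp
next
  case False
  then obtain X Y where XY: "X \<in> G.C" "X \<bullet> c u = c v" "Y \<in> G.C" "Y \<bullet> c v = c u"
    using assms(1) unfolding G.L_iff by blast
  from XY(1,3) obtain x y where xy: "word x" "X = c x" "word y" "Y = c y" by (auto elim!: IG_cases)
  with XY assms have "c (x @ u) = c v" "c (y @ v) = c u" by (simp_all add: IG_mult)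
  then have "ev x \<cdot> ev u = ev v" "ev y \<cdot> ev v = ev u"
    using assms xy by (simp_all add: ev_mult)
  then show ?thesis using xy assms by (auto simp: S.L_iff ev_C)
qed

text \<open>The hypothesis spells out that \<open>(a, b)\<close> is a basic pair. Even when only
  \<open>b \<cdot> a\<close> is known to be one of the two letters, \<open>a \<cdot> b\<close> is
  idempotent.\<close>

lemma cls_basic:
  assumes "a \<in> S.E" "b \<in> S.E" "a \<cdot> b = a \<or> a \<cdot> b = b \<or> b \<cdot> a = a \<or> b \<cdot> a = b"
  shows "a \<cdot> b \<in> S.E" "c [a, b] = c [a \<cdot> b]"
proof -
  have C: "a \<in> S.C" "b \<in> S.C" "a \<cdot> a = a" "b \<cdot> b = b" using assms by auto
  show ab: "a \<cdot> b \<in> S.E"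
    using assms(3) C by (auto simp: idempotents_def) (metis S.assoc S.closed)+
  have "star B a b = Some (a \<cdot> b)"
    using assms by (auto simp: star_B basic_pair_def)
  then have "ig_eq B [a, b] [a \<cdot> b]"
    using ig_eq.rel[of a B b "a \<cdot> b" "[]" "[]"] ab assms by simp
  then show "c [a, b] = c [a \<cdot> b]" by (rule cls_eqI)
qed

lemma cls_letter_idem: "a \<in> S.E \<Longrightarrow> c [a] \<in> G.E"
  using cls_basic[of a a] by (auto simp: idempotents_def IG_mult cls_in_IG)

text \<open>Makes R between letters readable from the table of \<open>B\<close>; the test for
  coordinatizations rests on this.\<close>

lemma letter_R_iff:
  assumes "a \<in> S.E" "b \<in> S.E"
  shows "(c [a], c [b]) \<in> G.R \<longleftrightarrow> a \<cdot> b = b \<and> b \<cdot> a = a"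
proof
  assume "(c [a], c [b]) \<in> G.R"
  from hom_R[OF this] assms have "(a, b) \<in> S.R" by simp
  then show "a \<cdot> b = b \<and> b \<cdot> a = a" using assms S.R_idem(1) S.R_sym by blast
next
  assume "a \<cdot> b = b \<and> b \<cdot> a = a"
  with assms have "c [a] \<bullet> c [b] = c [b]" "c [b] \<bullet> c [a] = c [a]"
    using cls_basic[of a b] cls_basic[of b a] by (auto simp: IG_mult)
  then show "(c [a], c [b]) \<in> G.R" using assms by (auto simp: G.R_iff cls_in_IG)
qed

lemma letter_L_iff:
  assumes "a \<in> S.E" "b \<in> S.E"
  shows "(c [a], c [b]) \<in> G.L \<longleftrightarrow> a \<cdot> b = a \<and> b \<cdot> a = b"
proof
  assume "(c [a], c [b]) \<in> G.L"
  from hom_L[OF this] assms have "(a, b) \<in> S.L" by simp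
  then show "a \<cdot> b = a \<and> b \<cdot> a = b" using assms S.L_idem(1) S.L_sym by blast
next
  assume "a \<cdot> b = a \<and> b \<cdot> a = b"
  with assms have "c [a] \<bullet> c [b] = c [a]" "c [b] \<bullet> c [a] = c [b]"
    using cls_basic[of a b] cls_basic[of b a] by (auto simp: IG_mult)
  then show "(c [a], c [b]) \<in> G.L" using assms by (auto simp: G.L_iff cls_in_IG)
qed

lemma letter_R_S: "a \<in> S.E \<Longrightarrow> b \<in> S.E \<Longrightarrow> (a, b) \<in> S.R \<Longrightarrow> (c [a], c [b]) \<in> G.R"
  using letter_R_iff S.R_idem(1) S.R_sym by blast

lemma letter_L_S: "a \<in> S.E \<Longrightarrow> b \<in> S.E \<Longrightarrow> (a, b) \<in> S.L \<Longrightarrow> (c [a], c [b]) \<in> G.L"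
  using letter_L_iff S.L_idem(1) S.L_sym by blast

section \<open>Replacing letters, and the idempotents of a D-class\<close>

inductive connected_letters :: "'a \<Rightarrow> 'a \<Rightarrow> bool" where
  base: "a \<in> S.E \<Longrightarrow> connected_letters a a"
| R_step: "connected_letters a b \<Longrightarrow> d \<in> S.E \<Longrightarrow> (c [b], c [d]) \<in> G.R \<Longrightarrow> connected_letters a d"
| L_step: "connected_letters a b \<Longrightarrow> d \<in> S.E \<Longrightarrow> (c [b], c [d]) \<in> G.L \<Longrightarrow> connected_letters a d"

lemma connected_letters_trans:
  "connected_letters b d \<Longrightarrow> connected_letters a b \<Longrightarrow> connected_letters a d"
  by (induction rule: connected_letters.induct) (auto intro: connected_letters.intros)

text \<open>\<open>y = g \<cdot> (t \<cdot> f)\<close> satisfies \<open>f \<cdot> y = f\<close> and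
  \<open>g \<cdot> y = y\<close>, so \<open>(f, y)\<close> and \<open>(y, g)\<close> are basic
  pairs: \<open>y\<close> can be inserted after \<open>f\<close> and then merged with
  \<open>g\<close>. The letter \<open>y \<cdot> g\<close> takes the place of
  \<open>g\<close>.\<close>

lemma absorb_letter:
  assumes f: "f \<in> S.E" and g: "g \<in> S.E" and t: "t \<in> S.C" and fgt: "f \<cdot> (g \<cdot> t) = f"
  shows "\<exists>y\<in>S.E. y \<cdot> g \<in> S.E \<and> (c [f], c [y]) \<in> G.L \<and> (c [y], c [y \<cdot> g]) \<in> G.R \<and>
    c [f, g] = c [f, y \<cdot> g] \<and> y \<cdot> f = y"
proof -
  define y where "y = g \<cdot> (t \<cdot> f)"
  have C: "f \<in> S.C" "g \<in> S.C" "f \<cdot> f = f" "g \<cdot> g = g" using f g by auto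
  have yC: "y \<in> S.C" using C t by (simp add: y_def)
  have fy: "f \<cdot> y = f" using fgt C t by (metis S.assoc S.closed y_def)
  have yf: "y \<cdot> f = y" using C t by (simp add: y_def S.assoc)
  have gy: "g \<cdot> y = y" using C t by (simp add: y_def flip: S.assoc)
  have "y \<cdot> y = y" using fy yC C t by (metis S.assoc S.closed y_def)
  then have y: "y \<in> S.E" using yC by (simp add: idempotents_def)
  note yg = cls_basic[OF y g] cls_basic[OF g y] cls_basic[OF f y]
  have ygE: "y \<cdot> g \<in> S.E" using yg gy by simp
  have "(c [f], c [y]) \<in> G.L" using f y fy yf by (simp add: letter_L_iff)
  moreover have "(c [y], c [y \<cdot> g]) \<in> G.R"
    using y ygE gy C yC by (simp add: letter_R_iff S.assoc) (simp add: S.idem_assoc y \<open>y \<cdot> y = y\<close>)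
  moreover have "c [f, g] = c [f, y, g]"
    using cls_context[of "[f, y]" "[f]" "[]" "[g]"] yg(6) fy f y g by simp
  moreover have "c [f, y, g] = c [f, y \<cdot> g]"
    using cls_context[of "[y, g]" "[y \<cdot> g]" "[f]" "[]"] yg(2) gy f y g by simp
  ultimately show ?thesis using y ygE yf by auto
qed

text \<open>FitzGerald's trick: letters of a word whose prefixes do not leave an \<open>\<R>\<close>-class can be
  replaced by idempotents of the same \<open>\<D>\<close>-class.\<close>

lemma absorb_word:
  assumes "word w" "f \<in> S.E" "t \<in> S.C" "f \<cdot> (ev w \<cdot> t) = f"
  shows "\<exists>v. word v \<and> c (f # w) = c (f # v) \<and> (\<forall>a\<in>set v. connected_letters f a) \<and>
    (c [f], c (f # v)) \<in> G.R \<and> (c [last v], c (f # v)) \<in> G.L"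
  using assms
proof (induction w arbitrary: f t)
  case (Cons g w)
  show ?case
  proof (cases "w = []")
    case True
    from absorb_letter[of f g t] Cons True obtain y where y: "y \<in> S.E" "y \<cdot> g \<in> S.E"
      "(c [f], c [y]) \<in> G.L" "(c [y], c [y \<cdot> g]) \<in> G.R" "c [f, g] = c [f, y \<cdot> g]" by auto
    from G.mult_through_idem[OF cls_letter_idem[OF y(1)] y(3,4)] Cons(3) y(2)
    have "(c [f], c [f, y \<cdot> g]) \<in> G.R" "(c [y \<cdot> g], c [f, y \<cdot> g]) \<in> G.L" by (simp_all add: IG_mult)
    moreover have "connected_letters f (y \<cdot> g)"
      using connected_letters.intros y Cons(3) by blast
    ultimately show ?thesis using True y by (intro exI[of _ "[y \<cdot> g]"]) simp
  next
    case False
    then have w: "word w" "g \<in> S.E" using Cons(2) by (auto simp: word_def)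
    have evC: "ev w \<in> S.C" using ev_C[OF w(1)] .
    have C: "f \<in> S.C" "g \<in> S.C" using w Cons(3) by auto
    have fgt: "f \<cdot> (g \<cdot> (ev w \<cdot> t)) = f" using Cons(5) False evC C Cons(4) by (simp add: ev_Cons S.assoc)
    from absorb_letter[OF Cons(3) w(2) _ fgt] evC Cons(4) obtain y where y: "y \<in> S.E" "y \<cdot> g \<in> S.E"
      "(c [f], c [y]) \<in> G.L" "(c [y], c [y \<cdot> g]) \<in> G.R" "c [f, g] = c [f, y \<cdot> g]" "y \<cdot> f = y" by auto
    have yC: "y \<in> S.C" "y \<cdot> y = y" using y by auto
    have gwtC: "g \<cdot> (ev w \<cdot> t) \<in> S.C" using C evC Cons(4) by simp
    \<comment> \<open>The rest of the word is undone behind \<open>y \<cdot> g\<close> up to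
      \<open>y\<close>; one more factor \<open>y \<cdot> g\<close> returns to that letter, so the
      induction hypothesis is used with the multiplier
      \<open>t \<cdot> (y \<cdot> g)\<close>.\<close>
    have "y \<cdot> g \<cdot> (ev w \<cdot> t) = y \<cdot> (g \<cdot> (ev w \<cdot> t))" using yC C evC Cons(4) by (simp add: S.assoc)
    also have "\<dots> = y \<cdot> f \<cdot> (g \<cdot> (ev w \<cdot> t))" by (simp only: y(6))
    also have "\<dots> = y \<cdot> f" using yC(1) C(1) gwtC by (simp only: S.assoc fgt)
    also have "\<dots> = y" by (rule y(6))
    finally have "y \<cdot> g \<cdot> (ev w \<cdot> (t \<cdot> (y \<cdot> g))) = y \<cdot> g"
      using yC C evC Cons(4) by (metis S.assoc S.closed)
    with Cons.IH[OF w(1) y(2), of "t \<cdot> (y \<cdot> g)"] yC C Cons(4) obtain v where v: "word v"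
      "c (y \<cdot> g # w) = c (y \<cdot> g # v)" "\<forall>a\<in>set v. connected_letters (y \<cdot> g) a"
      "(c [y \<cdot> g], c (y \<cdot> g # v)) \<in> G.R" "(c [last v], c (y \<cdot> g # v)) \<in> G.L" by auto
    have "c (f # g # w) = c (f # y \<cdot> g # w)"
      using cls_context[of "[f, g]" "[f, y \<cdot> g]" "[]" w] y Cons(3) w by (simp add: word_lists)
    also have "\<dots> = c (f # y \<cdot> g # v)"
      using cls_context[of "y \<cdot> g # w" "y \<cdot> g # v" "[f]" "[]"] y v Cons(3) w by (simp add: word_lists)
    finally have eq: "c (f # g # w) = c (f # y \<cdot> g # v)" .
    from G.mult_through_idem[OF cls_letter_idem[OF y(1)] y(3) G.R_trans[OF y(4) v(4)]] y Cons(3) v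
    have "(c [f], c (f # y \<cdot> g # v)) \<in> G.R" "(c (y \<cdot> g # v), c (f # y \<cdot> g # v)) \<in> G.L"
      by (simp_all add: IG_mult word_lists)
    moreover have "connected_letters f (y \<cdot> g)"
      using connected_letters.intros y Cons(3) by blast
    ultimately show ?thesis
      using eq v y(2) G.L_trans[OF v(5)] connected_letters_trans
      by (intro exI[of _ "y \<cdot> g # v"]) (auto simp: word_lists word_def)
  qed
qed simp

text \<open>Letters are absorbed from the right end of \<open>w\<close>. With \<open>s\<close> the
  multiplier in front of \<open>g\<close>, the letter \<open>y = f \<cdot> s \<cdot> g\<close> is
  R-related to \<open>f\<close> and satisfies \<open>y \<cdot> g = y\<close>. Hence
  \<open>g f = g y f = z f\<close> in IG, where \<open>z = g \<cdot> y\<close> is a letter R-related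
  to \<open>z f\<close>, and \<open>z\<close> takes the place of \<open>f\<close> for the rest of
  \<open>w\<close>.\<close>

lemma absorb_word_left:
  assumes "word w" "f \<in> S.E" "t \<in> S.C" "t \<cdot> ev w \<cdot> f = f"
  shows "\<exists>z\<in>S.E. (c (w @ [f]), c [z]) \<in> G.R"
  using assms
proof (induction w arbitrary: f t rule: rev_induct)
  case (snoc g w)
  have g: "g \<in> S.E" and w: "w \<noteq> [] \<Longrightarrow> word w" using snoc(2) by (auto simp: word_def)
  define s where "s = (if w = [] then t else t \<cdot> ev w)"
  have sC: "s \<in> S.C" using w ev_C snoc(4) by (simp add: s_def)
  have C: "f \<in> S.C" "g \<in> S.C" "f \<cdot> f = f" "g \<cdot> g = g" using g snoc(3) by auto
  have sgf: "s \<cdot> g \<cdot> f = f"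
  proof (cases "w = []")
    case False
    then have "ev (w @ [g]) = ev w \<cdot> g" using w g by (subst ev_append) simp_all
    then show ?thesis using snoc(4,5) False w ev_C[of w] C by (simp add: s_def S.assoc)
  qed (use snoc(5) s_def in simp)
  define y where "y = f \<cdot> s \<cdot> g"
  have yC: "y \<in> S.C" using C sC by (simp add: y_def)
  have yf: "y \<cdot> f = f" using sgf C sC by (simp add: y_def S.assoc)
  have fy: "f \<cdot> y = y" using C sC by (simp add: y_def flip: S.assoc)
  have yg: "y \<cdot> g = y" using C sC by (simp add: y_def S.assoc)
  have yy: "y \<cdot> y = y" using yf fy yC C by (metis S.assoc)
  then have y: "y \<in> S.E" using yC by (simp add: idempotents_def)
  define z where "z = g \<cdot> y"
  note gy = cls_basic[OF g y, folded z_def]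
  have z: "z \<in> S.E" using gy yg by simp
  have R: "(c [y], c [f]) \<in> G.R" using y snoc(3) yf fy by (simp add: letter_R_iff)
  have "z \<cdot> y = z" "y \<cdot> z = y" using C yC yg yy by (simp_all add: z_def S.assoc) (simp flip: S.assoc add: yg yy)
  then have L: "(c [z], c [y]) \<in> G.L" using y z by (simp add: letter_L_iff)
  from G.mult_through_idem(1)[OF cls_letter_idem[OF y] L R] z snoc(3)
  have zf: "(c [z], c [z, f]) \<in> G.R" by (simp add: IG_mult)
  have "c [g, f] = c [g, y, f]"
    using cls_context[of "[y, f]" "[f]" "[g]" "[]"] cls_basic[OF y snoc(3)] yf y g snoc(3) by simp
  also have "\<dots> = c [z, f]"
    using cls_context[of "[g, y]" "[z]" "[]" "[f]"] gy yg y g snoc(3) by simp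
  finally have gf: "c [g, f] = c [z, f]" .
  show ?case
  proof (cases "w = []")
    case True
    then show ?thesis using gf zf z G.R_sym by auto
  next
    case False
    then have ww: "word w" by (rule w)
    \<comment> \<open>\<open>g \<cdot> f \<cdot> t\<close> is the multiplier that brings
      \<open>ev w \<cdot> z\<close> back to \<open>z\<close>, as the induction hypothesis
      requires.\<close>
    have "g \<cdot> f \<cdot> t \<cdot> ev w \<cdot> z = g \<cdot> (f \<cdot> s \<cdot> g) \<cdot> y"
      using False C snoc(4) yC ev_C[OF ww] by (simp add: s_def z_def S.assoc)
    also have "\<dots> = z" using yy yC C by (simp add: z_def y_def[symmetric] S.assoc)
    finally obtain z' where z': "z' \<in> S.E" "(c (w @ [z]), c [z']) \<in> G.R"
      using snoc.IH[OF ww z, of "g \<cdot> f \<cdot> t"] C snoc(4) by auto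
    have "(c w \<bullet> c [z], c w \<bullet> c [z, f]) \<in> G.R"
      by (rule G.R_cong[OF zf cls_in_IG[OF ww]])
    then have "(c (w @ [z]), c (w @ [z, f])) \<in> G.R"
      using ww z snoc(3) by (simp add: IG_mult)
    from G.R_trans[OF G.R_sym[OF this] z'(2)] have "(c (w @ [z, f]), c [z']) \<in> G.R" .
    moreover have "c (w @ [g, f]) = c (w @ [z, f])"
      using cls_context[of "[g, f]" "[z, f]" w "[]"] gf g snoc(3) ww by (simp add: word_lists)
    ultimately show ?thesis using z'(1) by auto
  qed
qed simp

text \<open>Let \<open>f\<close> be the value of \<open>X\<close> in \<open>S\<close>. Letter
  replacement yields \<open>f X = f\<close> and \<open>X f = f\<close>, and \<open>X f = X\<close>
  remains. For this take \<open>U\<close> with \<open>e L U R X\<close>; then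
  \<open>U = T f U\<close> for some \<open>T\<close>, hence \<open>X = T f X = T f\<close>.\<close>

theorem idem_is_letter:
  assumes X: "X \<in> G.E" and e: "e \<in> S.E" and D: "(c [e], X) \<in> green_D I"
  shows "\<exists>a\<in>S.E. X = c [a]"
proof -
  from X have XC: "X \<in> G.C" "X \<bullet> X = X" by auto
  then obtain w where w: "word w" "X = c w" by (auto elim: IG_cases)
  define f where "f = ev w"
  have "c (w @ w) = c w" using XC w by (simp add: IG_mult)
  then have "f \<cdot> f = f" using w ev_mult[of w w w] by (simp add: f_def)
  then have f: "f \<in> S.E" using ev_C w by (simp add: idempotents_def f_def)
  have fC: "f \<in> S.C" "f \<cdot> (f \<cdot> f) = f" "f \<cdot> f \<cdot> f = f" using f \<open>f \<cdot> f = f\<close> by auto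
  note fI = cls_letter_idem[OF f]
  have fIC: "c [f] \<in> G.C" "c [f] \<bullet> c [f] = c [f]" using fI by auto
  obtain v where v: "word v" "c (f # w) = c (f # v)" "(c [last v], c (f # v)) \<in> G.L"
    using absorb_word[OF w(1) f fC(1)] fC(2) by (auto simp: f_def)
  have lv: "last v \<in> S.E" using v(1) by (auto simp: word_def)
  have evf: "ev (f # v) = f"
    using ev_cls[OF v(2)] w f \<open>f \<cdot> f = f\<close> by (auto simp: ev_Cons word_def f_def[symmetric])
  have "(last v, f) \<in> S.L" using hom_L[OF v(3)] lv f v(1) evf by (simp add: word_lists)
  from letter_L_S[OF lv f this] have "(c [f], c (f # v)) \<in> G.L" using v(3) G.L_sym G.L_trans by blast
  moreover have fX': "c (f # v) = c [f] \<bullet> X" using w f v(2) by (simp add: IG_mult)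
  ultimately have "(c [f], c [f] \<bullet> X) \<in> G.L" by simp
  \<comment> \<open>Right multiplication by \<open>X\<close> fixes \<open>f X\<close>, which is
    L-related to \<open>f\<close>; so it fixes \<open>f\<close> too.\<close>
  from G.idem_absorb[OF fI this _ XC(1)] have fX: "c [f] \<bullet> X = c [f]"
    using XC fIC by (simp add: G.assoc)
  obtain z where z: "z \<in> S.E" "(c (w @ [f]), c [z]) \<in> G.R"
    using absorb_word_left[OF w(1) f fC(1)] fC(3) by (auto simp: f_def)
  have wf: "word (w @ [f])" "ev (w @ [f]) = f"
    using w f ev_append[of w "[f]"] \<open>f \<cdot> f = f\<close> by (simp_all add: word_append f_def[symmetric])
  have "(f, z) \<in> S.R" using hom_R[OF z(2) wf(1)] z(1) wf(2) by simp
  from letter_R_S[OF f z(1) this] z(2) have "(c [f], c (w @ [f])) \<in> G.R" using G.R_sym G.R_trans by blast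
  moreover have "c (w @ [f]) = X \<bullet> c [f]" using w f by (simp add: IG_mult)
  ultimately have "(c [f], X \<bullet> c [f]) \<in> G.R" by simp
  from G.opp_idem_absorb[OF fI this _ XC(1)] have Xf: "X \<bullet> c [f] = c [f]"
    using XC fIC by (simp flip: G.assoc)
  from D obtain U where U: "(c [e], U) \<in> G.L" "(U, X) \<in> G.R"
    using G.R_L_commute unfolding green_D_def by blast
  have UC: "U \<in> G.C" using G.L_C[OF U(1)] by blast
  have XU: "X \<bullet> U = U" using G.R_idem(1)[OF X G.R_sym[OF U(2)]] .
  obtain V where V: "V \<in> G.C" "U \<bullet> V = X" using G.R_idem(2)[OF X G.R_sym[OF U(2)]] by blast
  obtain u where u: "word u" "U = c u" using UC by (auto elim: IG_cases)
  obtain u' where u': "word u'" "V = c u'" using V(1) by (auto elim: IG_cases)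
  have "c (u @ u') = c w" using V(2) u u' w by (simp add: IG_mult)
  then have uu': "ev u \<cdot> ev u' = f" using u u' ev_mult[of u u' w] by (simp add: f_def)
  obtain v' where v': "word v'" "c (f # u) = c (f # v')" "(c [last v'], c (f # v')) \<in> G.L"
    using absorb_word[OF u(1) f ev_C[OF u'(1)]] uu' \<open>f \<cdot> f = f\<close> by auto
  have lv': "last v' \<in> S.E" using v'(1) by (auto simp: word_def)
  have "c (w @ u) = c u" using XU u w by (simp add: IG_mult)
  then have "f \<cdot> ev u = ev u" using u w ev_mult[of w u u] by (simp add: f_def)
  then have "ev (f # v') = ev u"
    using ev_cls[OF v'(2)] u f by (auto simp: ev_Cons word_def)
  then have "(last v', ev u) \<in> S.L" using hom_L[OF v'(3)] lv' f v'(1) by (simp add: word_lists)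
  moreover have "(e, ev u) \<in> S.L" using hom_L[of "[e]" u] U(1) u e by simp
  \<comment> \<open>Both letters are L-related to the value of \<open>U\<close>. Only relations
    between letters lift from \<open>S\<close>, which is why \<open>U\<close> was chosen in the
    L-class of the letter \<open>e\<close>.\<close>
  ultimately have "(last v', e) \<in> S.L" using S.L_sym S.L_trans by blast
  from letter_L_S[OF lv' e this] v'(3) U(1) have "(c (f # v'), U) \<in> G.L"
    using G.L_sym G.L_trans by blast
  moreover have "c (f # v') = c [f] \<bullet> U" using u f v'(2) by (simp add: IG_mult)
  ultimately have "(c [f] \<bullet> U, U) \<in> G.L" by simp
  then have "\<exists>T\<in>G.C. T \<bullet> (c [f] \<bullet> U) = U"
    using fIC UC by (auto simp: G.L_iff) (metis G.assoc)
  then obtain T where T: "T \<in> G.C" "T \<bullet> (c [f] \<bullet> U) = U" by blast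
  have "X = T \<bullet> (c [f] \<bullet> U) \<bullet> V" using T(2) V(2) by simp
  also have "\<dots> = T \<bullet> (c [f] \<bullet> (U \<bullet> V))" using T(1) V(1) UC fIC by (simp add: G.assoc)
  also have "\<dots> = T \<bullet> c [f]" by (simp add: V(2) fX)
  finally have XT: "X = T \<bullet> c [f]" .
  then have "X \<bullet> c [f] = X" using T(1) fIC by (simp add: G.assoc)
  with Xf f show ?thesis by auto
qed

end

section \<open>A completely 0-simple \<open>\<D>\<close>-class\<close>

context semigroup_on begin

lemma right_ideal_mono: "x \<in> C \<Longrightarrow> s \<in> C \<Longrightarrow> right_ideal_of S (x \<cdot> s) \<subseteq> right_ideal_of S x"
  by (auto simp: right_ideal_of_def assoc)

lemma ideal_mono_left:
  assumes "x \<in> C" "s \<in> C" shows "ideal_of S (s \<cdot> x) \<subseteq> ideal_of S x"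
proof -
  have "left_ideal_of S (s \<cdot> x) \<subseteq> left_ideal_of S x"
    using assms by (auto simp: left_ideal_of_def simp flip: assoc)
  then show ?thesis unfolding ideal_of_def by blast
qed

lemma ideal_mono_right:
  assumes "x \<in> C" "s \<in> C" shows "ideal_of S (x \<cdot> s) \<subseteq> ideal_of S x"
proof -
  have "\<exists>z\<in>left_ideal_of S x. right_ideal_of S y \<subseteq> right_ideal_of S z" if y: "y \<in> left_ideal_of S (x \<cdot> s)" for y
  proof (cases "y = x \<cdot> s")
    case True
    then show ?thesis using right_ideal_mono[OF assms] by (auto simp: left_ideal_of_def)
  next
    case False
    then obtain t where t: "t \<in> C" "y = t \<cdot> x \<cdot> s" using y assms by (auto simp: left_ideal_of_def assoc)
    then show ?thesis using right_ideal_mono[of "t \<cdot> x" s] assms by (auto simp: left_ideal_of_def)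
  qed
  then show ?thesis unfolding ideal_of_def by blast
qed

end

locale D_class = biordered S B for S :: "'a sgrp" and B +
  fixes e :: 'a
  assumes e: "e \<in> S.E"
    and c0s: "completely_0_simple (principal_factor (IG B) (Dcl B e)) None"
    and DJ: "Dcl B e = Jcl B e"
begin

abbreviation "D \<equiv> Dcl B e"

lemma D_iff: "X \<in> D \<longleftrightarrow> (\<exists>U. (c [e], U) \<in> G.R \<and> (U, X) \<in> G.L)"
  by (auto simp: Dcl_def green_D_def)

lemma D_C: "X \<in> D \<Longrightarrow> X \<in> G.C"
  using G.L_C by (auto simp: D_iff)

lemma e_D: "c [e] \<in> D"
  using e cls_in_IG[of "[e]"] G.R_refl G.L_refl by (auto simp: D_iff)

lemma D_L: "X \<in> D \<Longrightarrow> (X, Y) \<in> G.L \<Longrightarrow> Y \<in> D"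
  unfolding D_iff using G.L_trans by blast

lemma D_R: "X \<in> D \<Longrightarrow> (X, Y) \<in> G.R \<Longrightarrow> Y \<in> D"
  unfolding D_iff using G.L_R_commute G.R_trans by blast

lemma D_R_L:
  assumes "X \<in> D" "Y \<in> D" shows "\<exists>Z. (X, Z) \<in> G.R \<and> (Z, Y) \<in> G.L"
proof -
  from assms obtain U V where U: "(c [e], U) \<in> G.R" "(U, X) \<in> G.L" and V: "(c [e], V) \<in> G.R" "(V, Y) \<in> G.L"
    unfolding D_iff by blast
  have "(U, V) \<in> G.R" using U(1) V(1) G.R_sym G.R_trans by blast
  with U(2) obtain Z where "(X, Z) \<in> G.R" "(Z, V) \<in> G.L" using G.L_R_commute G.L_sym by blast
  then show ?thesis using V(2) G.L_trans by blast
qed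

abbreviation "F \<equiv> ED B e"

lemma F_iff: "a \<in> F \<longleftrightarrow> a \<in> S.E \<and> c [a] \<in> D"
  by (simp add: ED_def)

lemma F_E: "a \<in> F \<Longrightarrow> a \<in> S.E" and F_D: "a \<in> F \<Longrightarrow> c [a] \<in> D" and e_F: "e \<in> F"
  using e e_D by (simp_all add: F_iff)

lemma F_idem: "a \<in> F \<Longrightarrow> c [a] \<in> G.E"
  using cls_letter_idem F_E by blast

lemma F_lists: "w \<in> lists F \<Longrightarrow> w \<in> lists S.E"
  using F_E by auto

lemma idem_letter:
  assumes "X \<in> D" "X \<in> G.E" shows "\<exists>a\<in>F. X = c [a]"
proof -
  from assms obtain a where "a \<in> S.E" "X = c [a]"
    using idem_is_letter[OF _ e, of X] by (auto simp: Dcl_def)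
  with assms(1) have "a \<in> F" by (simp add: F_iff)
  with \<open>X = c [a]\<close> show ?thesis by blast
qed

lemma D_R_letter:
  assumes "X \<in> D" shows "\<exists>a\<in>F. (c [a], X) \<in> G.R"
proof -
  from assms obtain U where "(c [e], U) \<in> G.L" "(U, X) \<in> G.R"
    unfolding D_iff using G.R_L_commute by blast
  with G.L_class_idem[OF cls_letter_idem[OF e]] obtain f where f: "f \<in> G.E" "(f, X) \<in> G.R"
    using G.R_trans by blast
  then have "f \<in> D" using D_R[OF assms G.R_sym] by blast
  with idem_letter f show ?thesis by blast
qed

lemma D_L_letter:
  assumes "X \<in> D" shows "\<exists>a\<in>F. (c [a], X) \<in> G.L"
proof -
  from assms obtain U where U: "(c [e], U) \<in> G.R" "(U, X) \<in> G.L"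
    unfolding D_iff by blast
  from semigroup_on.L_class_idem[OF G.opp, of "c [e]" U] U(1) cls_letter_idem[OF e]
  obtain f where f: "f \<in> G.E" "(f, X) \<in> G.L"
    using G.L_trans U(2) by auto
  then have "f \<in> D" using D_L[OF assms G.L_sym] by blast
  with idem_letter f show ?thesis by blast
qed

lemma D_stable:
  assumes "X \<in> D" "Y \<in> D" "X \<bullet> Y \<in> D"
  shows "(X, X \<bullet> Y) \<in> G.R" "(Y, X \<bullet> Y) \<in> G.L"
  using principal_factor_stable_R[OF G.is_semigroup _ c0s assms]
    principal_factor_stable_L[OF G.is_semigroup _ c0s assms] D_C by auto

lemma D_mult_letter:
  assumes "X \<in> D" "Y \<in> D" "X \<bullet> Y \<in> D"
  shows "\<exists>a\<in>F. (X, c [a]) \<in> G.L \<and> (c [a], Y) \<in> G.R"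
proof -
  from G.idem_from_mult[OF D_stable[OF assms]] assms D_C
  obtain f where f: "f \<in> G.E" "(X, f) \<in> G.L" "(f, Y) \<in> G.R" by blast
  then have "f \<in> D" using D_L assms(1) by blast
  with idem_letter f show ?thesis by blast
qed

lemma D_mult:
  assumes "X \<in> D" "a \<in> F" "(X, c [a]) \<in> G.L" "(c [a], Y) \<in> G.R" shows "X \<bullet> Y \<in> D"
  using D_R[OF assms(1)] G.mult_through_idem(1)[OF F_idem[OF assms(2)] assms(3,4)] by blast

lemma D_J: "X \<in> D \<longleftrightarrow> X \<in> G.C \<and> ideal_of I X = ideal_of I (c [e])"
  using cls_in_IG[of "[e]"] e unfolding DJ by (auto simp: Jcl_def green_J_def)

text \<open>This is where D = J enters: \<open>Y \<bullet> Z\<close> lies between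
  \<open>X \<bullet> (Y \<bullet> Z)\<close> and \<open>Y\<close> in the order of principal ideals,
  and both ends belong to D.\<close>

lemma D_suffix:
  assumes "X \<in> D" "Y \<in> D" "Z \<in> G.C" "X \<bullet> (Y \<bullet> Z) \<in> D" shows "Y \<bullet> Z \<in> D"
proof -
  have "ideal_of I (X \<bullet> (Y \<bullet> Z)) \<subseteq> ideal_of I (Y \<bullet> Z)"
    using assms D_C by (intro G.ideal_mono_left) auto
  moreover have "ideal_of I (Y \<bullet> Z) \<subseteq> ideal_of I Y"
    using assms D_C by (intro G.ideal_mono_right) auto
  ultimately show ?thesis using assms D_C unfolding D_J by blast
qed

lemma connected_in_F: "connected_letters a b \<Longrightarrow> a \<in> F \<Longrightarrow> b \<in> F"
  by (induction rule: connected_letters.induct) (auto simp: F_iff intro: D_R D_L)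

text \<open>A letter \<open>a\<close> R-related to \<open>X\<close> gives \<open>X = a w\<close> and
  a right multiplier from \<open>X\<close> back to \<open>a\<close>, the situation of
  \<open>absorb_word\<close>.\<close>

lemma D_word:
  assumes "X \<in> D" shows "\<exists>v. v \<noteq> [] \<and> v \<in> lists F \<and> X = c v"
proof -
  from D_R_letter[OF assms] obtain a where a: "a \<in> F" "(c [a], X) \<in> G.R" by blast
  obtain w where w: "word w" "X = c w" using D_C[OF assms] by (auto elim: IG_cases)
  from G.R_idem[OF F_idem[OF a(1)] a(2)] obtain Y where Y: "c [a] \<bullet> X = X" "Y \<in> G.C" "X \<bullet> Y = c [a]" by auto
  obtain y where y: "word y" "Y = c y" using Y(2) by (auto elim: IG_cases)
  have aE: "a \<in> S.E" using a F_E by blast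
  have aX: "c (a # w) = X" using Y(1) w aE by (simp add: IG_mult)
  have "c (w @ y) = c [a]" using Y(3) w y by (simp add: IG_mult)
  then have "ev w \<cdot> ev y = a" using ev_mult[of w y "[a]"] w y by simp
  then have "a \<cdot> (ev w \<cdot> ev y) = a" using S.idemD(2)[OF aE] by simp
  from absorb_word[OF w(1) aE ev_C[OF y(1)] this] obtain v where
    v: "word v" "c (a # w) = c (a # v)" "\<forall>b\<in>set v. connected_letters a b" by blast
  then have "a # v \<in> lists F" using connected_in_F a(1) by auto
  with v aX show ?thesis by blast
qed

text \<open>Apply \<open>absorb_word\<close> to some \<open>U\<close> with \<open>e R U L b\<close>:
  the last new letter is connected to \<open>e\<close> and L-related to \<open>b\<close>.\<close>

lemma F_connected:
  assumes "b \<in> F" shows "connected_letters e b"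
proof -
  from assms obtain U where U: "(c [e], U) \<in> G.R" "(U, c [b]) \<in> G.L" by (auto simp: F_iff D_iff)
  have bE: "b \<in> S.E" using assms F_E by blast
  obtain w where w: "word w" "U = c w" using G.R_C(2)[OF U(1)] by (auto elim: IG_cases)
  from G.R_idem[OF cls_letter_idem[OF e] U(1)] obtain Y where
    Y: "c [e] \<bullet> U = U" "Y \<in> G.C" "U \<bullet> Y = c [e]" by auto
  obtain y where y: "word y" "Y = c y" using Y(2) by (auto elim: IG_cases)
  have eU: "c (e # w) = U" using Y(1) w e by (simp add: IG_mult)
  have "c (w @ y) = c [e]" using Y(3) w y by (simp add: IG_mult)
  then have "ev w \<cdot> ev y = e" using ev_mult[of w y "[e]"] w y by simp
  then have "e \<cdot> (ev w \<cdot> ev y) = e" using S.idemD(2)[OF e] by simp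
  from absorb_word[OF w(1) e ev_C[OF y(1)] this] obtain v where
    v: "word v" "c (e # w) = c (e # v)" "\<forall>b\<in>set v. connected_letters e b"
      "(c [last v], c (e # v)) \<in> G.L" by blast
  then have "connected_letters e (last v)" by (auto simp: word_def)
  moreover have "(c [last v], c [b]) \<in> G.L" using v(2,4) eU U(2) G.L_trans by auto
  ultimately show ?thesis using bE connected_letters.L_step by blast
qed

lemma word_act_simps [simp]: "word_act B X [] = X"
  by (simp add: word_act_def)

lemma word_act_C: "X \<in> G.C \<Longrightarrow> w \<in> lists S.E \<Longrightarrow> word_act B X w \<in> G.C"
  by (auto simp: word_act_def word_def intro!: G.closed cls_in_IG)

lemma word_act_append:
  assumes "X \<in> G.C" "u \<in> lists S.E" "v \<in> lists S.E"
  shows "word_act B X (u @ v) = word_act B (word_act B X u) v"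
  using assms by (auto simp: word_act_def G.assoc cls_in_IG IG_mult word_def simp flip: IG_mult)

lemma word_act_mult:
  assumes "Y \<in> G.C" "X \<in> G.C" "w \<in> lists S.E"
  shows "Y \<bullet> word_act B X w = word_act B (Y \<bullet> X) w"
  using assms by (auto simp: word_act_def G.assoc cls_in_IG word_def)

lemma word_act_cls:
  assumes "word u" "w \<in> lists S.E" shows "word_act B (c u) w = c (u @ w)"
  using assms by (cases "w = []") (auto simp: word_act_def IG_mult word_def)

lemma word_act_Cons:
  assumes "X \<in> G.C" "g \<in> S.E" "w \<in> lists S.E"
  shows "word_act B X (g # w) = word_act B (X \<bullet> c [g]) w"
  using word_act_append[of X "[g]" w] assms by (simp add: word_act_def)

lemma word_act_L:
  assumes "(X, Y) \<in> G.L" "w \<in> lists S.E" shows "(word_act B X w, word_act B Y w) \<in> G.L"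
  using assms G.L_cong[OF assms(1)] by (auto simp: word_act_def word_def cls_in_IG)

lemma word_act_R:
  assumes "X \<in> G.C" "u \<in> lists S.E" "v \<in> lists S.E" "word_act B (word_act B X u) v = X"
  shows "(X, word_act B X u) \<in> G.R"
proof (cases "u = [] \<or> v = []")
  case True
  then show ?thesis using assms by (auto intro: G.R_refl)
next
  case False
  then have uv: "c u \<in> G.C" "c v \<in> G.C" using assms(2,3) by (auto simp: word_def intro!: cls_in_IG)
  with False assms show ?thesis by (auto simp: G.R_iff word_act_def)
qed

end

section \<open>Coordinates\<close>

locale indexed_classes = D_class S B e for S :: "'a sgrp" and B e +
  fixes X :: "('a, 'i) coord"
  assumes indexes_classes: "indexes_classes B e X"
begin

abbreviation "Ix \<equiv> idxI X"
abbreviation "Jx \<equiv> idxJ X"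
abbreviation "o1 \<equiv> base X"
abbreviation "Hx \<equiv> Hcl X"
abbreviation "K \<equiv> KK B X"
abbreviation "el \<equiv> eij B X"
abbreviation "r \<equiv> rw X"
abbreviation "r' \<equiv> rw' X"

lemma indexes: "bij_betw (Rcl X) Ix {G.R `` {x} |x. x \<in> D}" "bij_betw (Lcl X) Jx {G.L `` {x} |x. x \<in> D}"
  "o1 \<in> Ix" "o1 \<in> Jx" "c [e] \<in> Hx o1 o1"
  using indexes_classes by (simp_all add: indexes_classes_def)

lemma Rcl_eq:
  assumes "i \<in> Ix" "x \<in> Rcl X i" shows "Rcl X i = G.R `` {x}" "x \<in> D"
proof -
  have "Rcl X i \<in> {G.R `` {x} |x. x \<in> D}" by (rule bij_betw_apply[OF indexes(1) assms(1)])
  then obtain y where y: "y \<in> D" "Rcl X i = G.R `` {y}" by blast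
  then have yx: "(y, x) \<in> G.R" using assms(2) by auto
  then show "Rcl X i = G.R `` {x}" using y G.R_class_eq by simp
  show "x \<in> D" using D_R y yx by blast
qed

lemma Lcl_eq:
  assumes "j \<in> Jx" "x \<in> Lcl X j" shows "Lcl X j = G.L `` {x}" "x \<in> D"
proof -
  have "Lcl X j \<in> {G.L `` {x} |x. x \<in> D}" by (rule bij_betw_apply[OF indexes(2) assms(1)])
  then obtain y where y: "y \<in> D" "Lcl X j = G.L `` {y}" by blast
  then have yx: "(y, x) \<in> G.L" using assms(2) by auto
  then show "Lcl X j = G.L `` {x}" using y G.L_class_eq by simp
  show "x \<in> D" using D_L y yx by blast
qed

lemma Rcl_R: "i \<in> Ix \<Longrightarrow> x \<in> Rcl X i \<Longrightarrow> y \<in> Rcl X i \<longleftrightarrow> (x, y) \<in> G.R"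
  using Rcl_eq by auto

lemma Lcl_L: "j \<in> Jx \<Longrightarrow> x \<in> Lcl X j \<Longrightarrow> y \<in> Lcl X j \<longleftrightarrow> (x, y) \<in> G.L"
  using Lcl_eq by auto

definition "row x = (THE i. i \<in> Ix \<and> x \<in> Rcl X i)"
definition "col x = (THE j. j \<in> Jx \<and> x \<in> Lcl X j)"

lemma row_unique:
  assumes "i \<in> Ix" "x \<in> Rcl X i" "k \<in> Ix" "x \<in> Rcl X k" shows "i = k"
  using bij_betw_imp_inj_on[OF indexes(1)] Rcl_eq(1)[OF assms(1,2)] Rcl_eq(1)[OF assms(3,4)] assms(1,3)
  by (simp add: inj_on_def)

lemma col_unique:
  assumes "i \<in> Jx" "x \<in> Lcl X i" "k \<in> Jx" "x \<in> Lcl X k" shows "i = k"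
  using bij_betw_imp_inj_on[OF indexes(2)] Lcl_eq(1)[OF assms(1,2)] Lcl_eq(1)[OF assms(3,4)] assms(1,3)
  by (simp add: inj_on_def)

lemma row_eqI: "i \<in> Ix \<Longrightarrow> x \<in> Rcl X i \<Longrightarrow> row x = i"
  unfolding row_def using row_unique by blast

lemma col_eqI: "j \<in> Jx \<Longrightarrow> x \<in> Lcl X j \<Longrightarrow> col x = j"
  unfolding col_def using col_unique by blast

lemma row:
  assumes "x \<in> D" shows "row x \<in> Ix" "x \<in> Rcl X (row x)"
proof -
  have "G.R `` {x} \<in> Rcl X ` Ix" using bij_betw_imp_surj_on[OF indexes(1)] assms by blast
  then obtain i where "i \<in> Ix" "Rcl X i = G.R `` {x}" by auto
  moreover have "x \<in> G.R `` {x}" using G.R_refl[OF D_C[OF assms]] by simp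
  ultimately show "row x \<in> Ix" "x \<in> Rcl X (row x)" using row_eqI by auto
qed

lemma col:
  assumes "x \<in> D" shows "col x \<in> Jx" "x \<in> Lcl X (col x)"
proof -
  have "G.L `` {x} \<in> Lcl X ` Jx" using bij_betw_imp_surj_on[OF indexes(2)] assms by blast
  then obtain i where "i \<in> Jx" "Lcl X i = G.L `` {x}" by auto
  moreover have "x \<in> G.L `` {x}" using G.L_refl[OF D_C[OF assms]] by simp
  ultimately show "col x \<in> Jx" "x \<in> Lcl X (col x)" using col_eqI by auto
qed

lemma row_eq_iff: "x \<in> D \<Longrightarrow> (x, y) \<in> G.R \<Longrightarrow> row y = row x"
  using row_eqI[of "row x" y] row[of x] Rcl_R[of "row x" x y] by simp

lemma col_eq_iff: "x \<in> D \<Longrightarrow> (x, y) \<in> G.L \<Longrightarrow> col y = col x"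
  using col_eqI[of "col x" y] col[of x] Lcl_L[of "col x" x y] by simp

lemma H_iff: "i \<in> Ix \<Longrightarrow> j \<in> Jx \<Longrightarrow> x \<in> Hx i j \<longleftrightarrow> x \<in> D \<and> row x = i \<and> col x = j"
  using row col row_eqI col_eqI Rcl_eq(2) unfolding Hcl_def by blast

lemma H_D: "i \<in> Ix \<Longrightarrow> x \<in> Hx i j \<Longrightarrow> x \<in> D"
  using Rcl_eq(2) by (auto simp: Hcl_def)

lemma H_nonempty:
  assumes "i \<in> Ix" "j \<in> Jx" shows "\<exists>x. x \<in> Hx i j"
proof -
  from assms indexes obtain x y where x: "x \<in> D" "Rcl X i = G.R `` {x}" and y: "y \<in> D" "Lcl X j = G.L `` {y}"
    using bij_betw_apply[OF indexes(1) assms(1)] bij_betw_apply[OF indexes(2) assms(2)] by blast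
  from D_R_L[OF x(1) y(1)] obtain z where "(x, z) \<in> G.R" "(z, y) \<in> G.L" by blast
  then show ?thesis using x y G.L_sym by (auto simp: Hcl_def)
qed

lemma H_class:
  assumes "i \<in> Ix" "j \<in> Jx" "x \<in> Hx i j" shows "Hx i j = G.Hclass x"
  using Rcl_eq(1)[of i x] Lcl_eq(1)[of j x] assms by (simp add: Hcl_def)

text \<open>The identity of a group H-class is an idempotent of D, hence a letter; this turns
  \<open>KK\<close> into a statement about letters.\<close>

lemma K_iff: "(i, j) \<in> K \<longleftrightarrow> i \<in> Ix \<and> j \<in> Jx \<and> (\<exists>a\<in>F. c [a] \<in> Hx i j)"
proof
  assume "(i, j) \<in> K"
  then have ij: "i \<in> Ix" "j \<in> Jx" and "is_subgroup_of I (Hx i j)" by (auto simp: KK_def)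
  then obtain u where "group (sub_monoid I (Hx i j) u)" by (auto simp: is_subgroup_of_def)
  then interpret H: group "sub_monoid I (Hx i j) u" .
  have u: "u \<in> Hx i j" "u \<bullet> u = u" using H.one_closed H.l_one[OF H.one_closed] by (simp_all add: sub_monoid_def)
  then have "u \<in> D" using H_D ij by blast
  then have "u \<in> G.E" using u D_C by (simp add: idempotents_def)
  with idem_letter \<open>u \<in> D\<close> u ij show "i \<in> Ix \<and> j \<in> Jx \<and> (\<exists>a\<in>F. c [a] \<in> Hx i j)" by blast
next
  assume *: "i \<in> Ix \<and> j \<in> Jx \<and> (\<exists>a\<in>F. c [a] \<in> Hx i j)"
  then obtain a where a: "a \<in> F" "c [a] \<in> Hx i j" by blast
  have "group (sub_monoid I (Hx i j) (c [a]))"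
    using G.H_group[OF F_idem[OF a(1)]] H_class[of i j "c [a]"] a(2) * by simp
  moreover have "Hx i j \<subseteq> carrier I" using H_D D_C * by blast
  ultimately show "(i, j) \<in> K" using * by (auto simp: KK_def is_subgroup_of_def)
qed

lemma el_eqI:
  assumes "i \<in> Ix" "j \<in> Jx" "a \<in> S.E" "c [a] \<in> Hx i j" shows "el i j = a"
  unfolding eij_def
proof (rule the_equality)
  show "a \<in> carrier B \<and> c [a] \<in> Hx i j" using assms by simp
next
  fix b assume b: "b \<in> carrier B \<and> c [b] \<in> Hx i j"
  then have "c [b] \<in> G.Hclass (c [a])" using H_class[OF assms(1,2,4)] by simp
  then have "c [a] = c [b]"
    using G.H_idem_unique[OF cls_letter_idem cls_letter_idem, of a b] assms(3) b by auto
  then show "b = a" using cls_letter_eq_iff assms(3) b by auto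
qed

lemma el:
  assumes "(i, j) \<in> K"
  shows "el i j \<in> F" "c [el i j] \<in> Hx i j" "row (c [el i j]) = i" "col (c [el i j]) = j"
proof -
  from assms obtain a where a: "i \<in> Ix" "j \<in> Jx" "a \<in> F" "c [a] \<in> Hx i j" using K_iff by blast
  then have "el i j = a" using el_eqI F_E by blast
  with a show "el i j \<in> F" "c [el i j] \<in> Hx i j" "row (c [el i j]) = i" "col (c [el i j]) = j"
    using H_iff by auto
qed

lemma F_el:
  assumes "a \<in> F"
  shows "(row (c [a]), col (c [a])) \<in> K" "el (row (c [a])) (col (c [a])) = a"
proof -
  have D: "c [a] \<in> D" using assms F_D by blast
  then have *: "row (c [a]) \<in> Ix" "col (c [a]) \<in> Jx" "c [a] \<in> Hx (row (c [a])) (col (c [a]))"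
    using row col by (auto simp: Hcl_def)
  then show "(row (c [a]), col (c [a])) \<in> K" using assms K_iff by blast
  show "el (row (c [a])) (col (c [a])) = a" using el_eqI * assms F_E by blast
qed

lemma idx_el:
  assumes "(i, j) \<in> K" shows "idx B X (el i j) = (i, j)"
  unfolding idx_def
proof (rule the_equality)
  show "case (i, j) of (k, l) \<Rightarrow> (k, l) \<in> K \<and> el k l = el i j" using assms by simp
  fix p assume p: "case p of (k, l) \<Rightarrow> (k, l) \<in> K \<and> el k l = el i j"
  obtain k l where "p = (k, l)" by (cases p)
  with p el(3,4)[of k l] el(3,4)[OF assms] show "p = (i, j)" by auto
qed

lemma idx_F: "a \<in> F \<Longrightarrow> idx B X a = (row (c [a]), col (c [a]))"
  using idx_el F_el by metis

lemma el_base: "(o1, o1) \<in> K" "el o1 o1 = e"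
  using K_iff e_F indexes el_eqI e by auto

text \<open>Stability together with both halves of the Miller-Clifford theorem.\<close>

lemma mult_D_iff:
  assumes "x \<in> D" "y \<in> D" shows "x \<bullet> y \<in> D \<longleftrightarrow> (row y, col x) \<in> K"
proof
  assume "x \<bullet> y \<in> D"
  from D_mult_letter[OF assms this] obtain a where a: "a \<in> F" "(x, c [a]) \<in> G.L" "(c [a], y) \<in> G.R" by blast
  have "row y = row (c [a])" "col x = col (c [a])"
    using row_eq_iff[OF F_D[OF a(1)] a(3)] col_eq_iff[OF assms(1) a(2)] by auto
  then show "(row y, col x) \<in> K" using F_el(1)[OF a(1)] by simp
next
  assume K: "(row y, col x) \<in> K"
  let ?a = "el (row y) (col x)"
  have "(x, c [?a]) \<in> G.L" "(c [?a], y) \<in> G.R"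
    using Lcl_L[OF col[OF assms(1)]] Rcl_R[OF row(1)[OF assms(2)]] row(2)[OF assms(2)] el(2)[OF K]
    by (auto simp: Hcl_def)
  then show "x \<bullet> y \<in> D" using D_mult[OF assms(1) el(1)[OF K]] by blast
qed

lemma row_col_mult:
  assumes "x \<in> D" "y \<in> D" "x \<bullet> y \<in> D" shows "row (x \<bullet> y) = row x" "col (x \<bullet> y) = col y"
  using D_stable[OF assms] row_eq_iff col_eq_iff assms by auto

lemma act_None: "act B X None w = None"
  by (induction w) simp_all

text \<open>\<open>The\<close> in \<open>act1\<close> is well defined: columns meet the first row in
  nonempty sets, disjoint for different columns.\<close>

lemma act1_Some:
  assumes "act1 B X j g = Some l"
  shows "l \<in> Jx" "(\<lambda>x. x \<bullet> c [g]) ` Hx o1 j = Hx o1 l"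
proof -
  let ?Q = "\<lambda>l. l \<in> Jx \<and> (\<lambda>x. x \<bullet> c [g]) ` Hx o1 j = Hx o1 l"
  from assms have ex: "Ex ?Q" and l: "l = The ?Q" unfolding act1_def Let_def by (auto split: if_splits)
  have uq: "k = k'" if "?Q k" "?Q k'" for k k'
  proof -
    have "k \<in> Jx" "k' \<in> Jx" "Hx o1 k = Hx o1 k'" using that by auto
    moreover obtain x where "x \<in> Hx o1 k" using H_nonempty[OF indexes(3) \<open>k \<in> Jx\<close>] by blast
    ultimately show ?thesis using col_unique[of k x k'] unfolding Hcl_def by blast
  qed
  from theI'[OF ex_ex1I[OF ex uq]] show "l \<in> Jx" "(\<lambda>x. x \<bullet> c [g]) ` Hx o1 j = Hx o1 l" unfolding l by simp_all
qed

lemma act_Some: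
  assumes "act B X (Some j) w = Some l" "w \<in> lists S.E" "j \<in> Jx"
  shows "l \<in> Jx \<and> (\<lambda>x. word_act B x w) ` Hx o1 j = Hx o1 l"
  using assms
proof (induction w arbitrary: j)
  case (Cons g w)
  then obtain k where k: "act1 B X j g = Some k" by (cases "act1 B X j g") (auto simp: act_None)
  with Cons have IH: "l \<in> Jx" "(\<lambda>x. word_act B x w) ` Hx o1 k = Hx o1 l"
    using act1_Some(1)[OF k] by auto
  have "word_act B x (g # w) = word_act B (x \<bullet> c [g]) w" if "x \<in> Hx o1 j" for x
    using word_act_Cons[of x g w] Cons(3) H_D[OF indexes(3) that] D_C by auto
  then have "(\<lambda>x. word_act B x (g # w)) ` Hx o1 j = (\<lambda>x. word_act B x w) ` (\<lambda>x. x \<bullet> c [g]) ` Hx o1 j"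
    by (auto simp: image_image)
  with IH act1_Some(2)[OF k] show ?case by simp
qed simp

end

locale coordinates = indexed_classes S B e X
  for S :: "'a sgrp" and B e and X :: "('a, 'i) coord" +
  assumes coordinatization: "coordinatization B e X"
begin

lemma schreier:
  assumes "j \<in> Jx"
  shows "r j \<in> lists F" "r' j \<in> lists F"
    "act B X (Some o1) (r j) = Some j" "act B X (Some j) (r' j) = Some o1"
    "x \<in> Hx o1 o1 \<Longrightarrow> word_act B x (r j @ r' j) = x"
    "y \<in> Hx o1 j \<Longrightarrow> word_act B y (r' j @ r j) = y"
  using coordinatization assms by (auto simp: coordinatization_def schreier_system_def)

lemma schreier_lists: "j \<in> Jx \<Longrightarrow> r j \<in> lists S.E" "j \<in> Jx \<Longrightarrow> r' j \<in> lists S.E"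
  using schreier(1,2) F_lists by blast+

text \<open>The Schreier conditions concern the first row only; \<open>x \<bullet> c [e] = x\<close>
  carries them to all rows of the first column.\<close>

lemma act_r:
  assumes j: "j \<in> Jx" and x: "x \<in> D" "col x = o1"
  shows "word_act B x (r j) \<in> D" "row (word_act B x (r j)) = row x" "col (word_act B x (r j)) = j"
    "word_act B (word_act B x (r j)) (r' j) = x"
proof -
  note l = schreier_lists[OF j]
  have xe: "(x, c [e]) \<in> G.L" using Lcl_L[OF col[OF x(1)]] x(2) indexes(5) by (simp add: Hcl_def)
  then have "x \<bullet> c [e] = x" using G.L_idem(1) G.L_sym cls_letter_idem[OF e] by blast
  then have "word_act B x (r j @ r' j) = x \<bullet> word_act B (c [e]) (r j @ r' j)"
    using word_act_mult[of x "c [e]" "r j @ r' j"] l x(1) D_C e_D by auto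
  also have "\<dots> = x" using schreier(5)[OF j indexes(5)] \<open>x \<bullet> c [e] = x\<close> by simp
  finally show *: "word_act B (word_act B x (r j)) (r' j) = x"
    using word_act_append[of x "r j" "r' j"] l x(1) D_C by simp
  from word_act_R[OF D_C[OF x(1)] l *] have R: "(x, word_act B x (r j)) \<in> G.R" .
  then show "word_act B x (r j) \<in> D" "row (word_act B x (r j)) = row x"
    using D_R row_eq_iff x(1) by auto
  have "word_act B (c [e]) (r j) \<in> Hx o1 j"
    using act_Some[OF schreier(3)[OF j] l(1)] indexes by auto
  then show "col (word_act B x (r j)) = j"
    using word_act_L[OF xe l(1)] Lcl_L[OF j] col_eqI[OF j] G.L_sym by (auto simp: Hcl_def)
qed

text \<open>Some \<open>h\<close> in the first row of column \<open>j\<close> is carried to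
  \<open>x\<close> by a left multiplication, which commutes with the action of words.\<close>

lemma act_r':
  assumes x: "x \<in> D" and j: "j = col x"
  shows "word_act B x (r' j) \<in> D" "row (word_act B x (r' j)) = row x" "col (word_act B x (r' j)) = o1"
    "word_act B (word_act B x (r' j)) (r j) = x"
proof -
  have jJ: "j \<in> Jx" using col x j by simp
  note l = schreier_lists[OF jJ]
  obtain h where h: "h \<in> Hx o1 j" using H_nonempty indexes jJ by blast
  have hC: "h \<in> G.C" using H_D h indexes D_C by blast
  have hx: "(h, x) \<in> G.L" using Lcl_L[OF jJ] h col(2)[OF x] j by (auto simp: Hcl_def)
  have *: "word_act B h (r' j @ r j) = h" using schreier(6)[OF jJ h] .
  have "word_act B x (r' j @ r j) = x"
  proof (cases "h = x")
    case False
    then obtain s where s: "s \<in> G.C" "s \<bullet> h = x" using hx by (auto simp: G.L_iff)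
    then have "word_act B x (r' j @ r j) = s \<bullet> word_act B h (r' j @ r j)"
      using word_act_mult[of s h "r' j @ r j"] l hC by auto
    with * s show ?thesis by simp
  qed (use * in simp)
  then show **: "word_act B (word_act B x (r' j)) (r j) = x"
    using word_act_append[of x "r' j" "r j"] l x D_C by simp
  from word_act_R[OF D_C[OF x] l(2,1) **] have R: "(x, word_act B x (r' j)) \<in> G.R" .
  then show "word_act B x (r' j) \<in> D" "row (word_act B x (r' j)) = row x"
    using D_R row_eq_iff x by auto
  have "word_act B h (r' j) \<in> Hx o1 o1"
    using act_Some[OF schreier(4)[OF jJ] l(2) jJ] h by auto
  then show "col (word_act B x (r' j)) = o1"
    using word_act_L[OF hx l(2)] Lcl_L[OF indexes(4)] col_eqI[OF indexes(4)] by (auto simp: Hcl_def)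
qed

lemma jsel: "i \<in> Ix \<Longrightarrow> (i, jsel X i) \<in> K" "i \<in> Ix \<Longrightarrow> jsel X i \<in> Jx"
  using coordinatization K_iff by (auto simp: coordinatization_def)

end

section \<open>Rees coordinates on the D-class\<close>

context coordinates begin

abbreviation "q i \<equiv> el i (jsel X i)"
abbreviation "H \<equiv> Hx o1 o1"
abbreviation "G1 \<equiv> HG B e X"

text \<open>For rows, \<open>lam i\<close> and \<open>mu i\<close> play the part of \<open>r\<close>
  and \<open>r'\<close>. They lie in \<open>H_{1,j(i)}\<close> and \<open>H_{i,1}\<close> and are
  inverse to each other: the product \<open>lam i \<bullet> mu i\<close> is \<open>e\<close>, and
  \<open>mu i \<bullet> lam i\<close> is \<open>e_{i,j(i)}\<close>.\<close>

definition "lam i = word_act B (c [e]) (r (jsel X i))"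
definition "mu i = word_act B (c [q i]) (r' (jsel X i))"

text \<open>The \<open>H\<close>-coordinate of an element of \<open>D\<close>; \<open>f\<^sub>i\<^sub>j\<close> is that of \<open>e\<^sub>i\<^sub>j\<close>.\<close>

definition "hcoord x = word_act B (lam (row x) \<bullet> x) (r' (col x))"
definition "elt i g j = word_act B (mu i \<bullet> g) (r j)"

lemma H_iff1: "x \<in> H \<longleftrightarrow> x \<in> D \<and> row x = o1 \<and> col x = o1"
  using H_iff indexes by blast

lemma e_H: "c [e] \<in> H" and e_row_col: "row (c [e]) = o1" "col (c [e]) = o1"
  using indexes(5) H_iff1 by auto

lemma R_if_row: "x \<in> D \<Longrightarrow> y \<in> D \<Longrightarrow> row x = row y \<Longrightarrow> (x, y) \<in> G.R"
  using row[of x] row[of y] Rcl_R by metis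

lemma L_if_col: "x \<in> D \<Longrightarrow> y \<in> D \<Longrightarrow> col x = col y \<Longrightarrow> (x, y) \<in> G.L"
  using col[of x] col[of y] Lcl_L by metis

lemma letter_mult_left: "a \<in> F \<Longrightarrow> x \<in> D \<Longrightarrow> row x = row (c [a]) \<Longrightarrow> c [a] \<bullet> x = x"
  using G.R_idem(1)[OF F_idem R_if_row[OF F_D]] by simp

lemma letter_mult_right: "a \<in> F \<Longrightarrow> x \<in> D \<Longrightarrow> col x = col (c [a]) \<Longrightarrow> x \<bullet> c [a] = x"
  using G.L_idem(1)[OF F_idem L_if_col[OF F_D]] by simp

lemma e_mult: "x \<in> D \<Longrightarrow> row x = o1 \<Longrightarrow> c [e] \<bullet> x = x" "x \<in> D \<Longrightarrow> col x = o1 \<Longrightarrow> x \<bullet> c [e] = x"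
  using letter_mult_left[OF e_F] letter_mult_right[OF e_F] e_row_col by auto

lemma mult_base:
  assumes "x \<in> D" "y \<in> D" "col x = o1" "row y = o1"
  shows "x \<bullet> y \<in> D" "row (x \<bullet> y) = row x" "col (x \<bullet> y) = col y"
  using mult_D_iff[OF assms(1,2)] row_col_mult[OF assms(1,2)] el_base(1) assms(3,4) by simp_all

lemma q: "i \<in> Ix \<Longrightarrow> q i \<in> F" "i \<in> Ix \<Longrightarrow> row (c [q i]) = i" "i \<in> Ix \<Longrightarrow> col (c [q i]) = jsel X i"
  using el[OF jsel(1)] by auto

lemma lam:
  assumes "i \<in> Ix" shows "lam i \<in> D" "row (lam i) = o1" "col (lam i) = jsel X i"
  using act_r(1-3)[OF jsel(2)[OF assms] e_D] e_row_col by (simp_all add: lam_def)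

lemma mu:
  assumes "i \<in> Ix" shows "mu i \<in> D" "row (mu i) = i" "col (mu i) = o1"
  using act_r'(1-3)[OF F_D[OF q(1)[OF assms]], of "jsel X i"] q[OF assms] by (simp_all add: mu_def)

lemma lam_mu: assumes i: "i \<in> Ix" shows "lam i \<bullet> mu i = c [e]"
proof -
  have "lam i \<bullet> mu i = word_act B (lam i \<bullet> c [q i]) (r' (jsel X i))"
    using lam(1)[OF i] F_D[OF q(1)[OF i]] schreier_lists jsel i by (simp add: mu_def word_act_mult D_C)
  also have "lam i \<bullet> c [q i] = lam i"
    using letter_mult_right[OF q(1)[OF i] lam(1)[OF i]] lam q i by simp
  also have "word_act B (lam i) (r' (jsel X i)) = c [e]"
    using act_r(4)[OF jsel(2)[OF i] e_D e_row_col(2)] by (simp add: lam_def)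
  finally show ?thesis .
qed

lemma mu_lam: assumes i: "i \<in> Ix" shows "mu i \<bullet> lam i = c [q i]"
proof -
  have "mu i \<bullet> lam i = word_act B (mu i \<bullet> c [e]) (r (jsel X i))"
    using mu(1)[OF i] e_D schreier_lists jsel i by (simp add: lam_def word_act_mult D_C)
  also have "mu i \<bullet> c [e] = mu i"
    using e_mult mu i by simp
  also have "word_act B (mu i) (r (jsel X i)) = c [q i]"
    using act_r'(4)[OF F_D[OF q(1)[OF i]]] q i by (simp add: mu_def)
  finally show ?thesis .
qed

lemma lam_mult:
  assumes "x \<in> D" shows "lam (row x) \<bullet> x \<in> D" "row (lam (row x) \<bullet> x) = o1" "col (lam (row x) \<bullet> x) = col x"
proof -
  have i: "row x \<in> Ix" using row assms by blast
  show *: "lam (row x) \<bullet> x \<in> D"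
    using mult_D_iff[OF lam(1)[OF i] assms] lam(3)[OF i] jsel(1)[OF i] by simp
  show "row (lam (row x) \<bullet> x) = o1" "col (lam (row x) \<bullet> x) = col x"
    using row_col_mult[OF lam(1)[OF i] assms *] lam[OF i] by auto
qed

lemma hcoord_H: "x \<in> D \<Longrightarrow> hcoord x \<in> H"
  using act_r'[OF lam_mult(1)] lam_mult by (simp add: hcoord_def H_iff1)

lemma hcoord_r: "x \<in> D \<Longrightarrow> word_act B (hcoord x) (r (col x)) = lam (row x) \<bullet> x"
  using act_r'(4)[OF lam_mult(1)] lam_mult by (simp add: hcoord_def)

lemma mu_hcoord:
  assumes x: "x \<in> D" shows "mu (row x) \<bullet> hcoord x = word_act B x (r' (col x))"
proof -
  have i: "row x \<in> Ix" using row x by blast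
  have "mu (row x) \<bullet> hcoord x = word_act B (mu (row x) \<bullet> (lam (row x) \<bullet> x)) (r' (col x))"
    using mu(1)[OF i] lam_mult(1)[OF x] schreier_lists col(1)[OF x]
    by (simp add: hcoord_def word_act_mult D_C)
  also have "mu (row x) \<bullet> (lam (row x) \<bullet> x) = c [q (row x)] \<bullet> x"
    using mu_lam[OF i] mu(1)[OF i] lam(1)[OF i] x by (simp add: D_C flip: G.assoc)
  also have "\<dots> = x" using letter_mult_left q i x by simp
  finally show ?thesis .
qed

lemma elt_hcoord:
  assumes "x \<in> D" shows "elt (row x) (hcoord x) (col x) = x"
  using mu_hcoord[OF assms] act_r'(4)[OF assms HOL.refl] by (simp add: elt_def)

lemma elt:
  assumes i: "i \<in> Ix" and j: "j \<in> Jx" and g: "g \<in> H"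
  shows "elt i g j \<in> D" "row (elt i g j) = i" "col (elt i g j) = j" "hcoord (elt i g j) = g"
proof -
  have gD: "g \<in> D" "row g = o1" "col g = o1" using g H_iff1 by auto
  note mg = mult_base[OF mu(1)[OF i] gD(1) mu(3)[OF i] gD(2)]
  note rc = act_r[OF j mg(1), folded elt_def]
  show *: "elt i g j \<in> D" "row (elt i g j) = i" "col (elt i g j) = j"
    using rc mg mu i gD by auto
  have "lam i \<bullet> elt i g j = word_act B (lam i \<bullet> (mu i \<bullet> g)) (r j)"
    using lam(1)[OF i] mg(1) schreier_lists j by (simp add: elt_def word_act_mult D_C)
  also have "lam i \<bullet> (mu i \<bullet> g) = c [e] \<bullet> g"
    using lam_mu[OF i] mu(1)[OF i] lam(1)[OF i] gD by (simp add: D_C flip: G.assoc)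
  also have "\<dots> = g" using e_mult gD by simp
  finally have "lam i \<bullet> elt i g j = word_act B g (r j)" .
  then show "hcoord (elt i g j) = g" using act_r(4)[OF j gD(1,3)] * by (simp add: hcoord_def)
qed

text \<open>The claimed inverse \<open>e r\<^sub>j e\<^sub>i\<^sub>,\<^sub>j\<^sub>(\<^sub>i\<^sub>) r'\<^sub>j\<^sub>(\<^sub>i\<^sub>)\<close> of \<open>f\<^sub>i\<^sub>j\<close>.\<close>

definition "finv i j = word_act B (c [e]) (r j) \<bullet> mu i"

text \<open>In the middle, \<open>hcoord_r\<close> cancels \<open>r'\<close> against
  \<open>r\<close> and \<open>mu_hcoord\<close> cancels \<open>mu\<close> against
  \<open>lam\<close>; only \<open>x \<bullet> y\<close> and the outer factors survive.\<close>

lemma hcoord_finv: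
  assumes x: "x \<in> D" and y: "y \<in> D"
  shows "hcoord x \<bullet> finv (row y) (col x) \<bullet> hcoord y = word_act B (lam (row x) \<bullet> (x \<bullet> y)) (r' (col y))"
proof -
  have i: "row y \<in> Ix" and j: "col x \<in> Jx" "col y \<in> Jx" using row col x y by auto
  have ix: "row x \<in> Ix" using row x by blast
  note hx = hcoord_H[OF x, unfolded H_iff1] and hy = hcoord_H[OF y, unfolded H_iff1]
  note E = act_r(1)[OF j(1) e_D e_row_col(2)]
  have 1: "hcoord x \<bullet> word_act B (c [e]) (r (col x)) = lam (row x) \<bullet> x"
    using word_act_mult[of "hcoord x" "c [e]" "r (col x)"] hx e_D schreier_lists(1)[OF j(1)]
      e_mult(2)[of "hcoord x"] hcoord_r[OF x] D_C by simp
  have "hcoord x \<bullet> finv (row y) (col x) \<bullet> hcoord y =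
      hcoord x \<bullet> word_act B (c [e]) (r (col x)) \<bullet> (mu (row y) \<bullet> hcoord y)"
    using hx hy E mu(1)[OF i] D_C by (simp add: finv_def G.assoc)
  also have "\<dots> = lam (row x) \<bullet> x \<bullet> word_act B y (r' (col y))"
    by (simp only: 1 mu_hcoord[OF y])
  also have "\<dots> = word_act B (lam (row x) \<bullet> (x \<bullet> y)) (r' (col y))"
    using lam(1)[OF ix] x y schreier_lists(2)[OF j(2)] D_C by (simp add: word_act_mult G.assoc)
  finally show ?thesis .
qed

lemma hcoord_mult:
  assumes x: "x \<in> D" and y: "y \<in> D" and xy: "x \<bullet> y \<in> D"
  shows "hcoord (x \<bullet> y) = hcoord x \<bullet> finv (row y) (col x) \<bullet> hcoord y"
  unfolding hcoord_finv[OF x y] using row_col_mult[OF x y xy] by (simp add: hcoord_def)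

lemma HG: "group G1" "carrier G1 = H" "\<one>\<^bsub>G1\<^esub> = c [e]" "x \<otimes>\<^bsub>G1\<^esub> y = x \<bullet> y"
  using G.H_group[OF F_idem[OF e_F]] H_class[OF indexes(3,4,5)] by (simp_all add: HG_def sub_monoid_def)

text \<open>As \<open>e_ij\<close> is idempotent, \<open>hcoord_mult\<close> gives
  \<open>h f h = h\<close> for its H-coordinate \<open>h\<close> and \<open>f = finv i j\<close>;
  cancellation in the group leaves \<open>h f = 1\<close>.\<close>

lemma finv:
  assumes "(i, j) \<in> K"
  shows "finv i j \<in> H" "inv\<^bsub>G1\<^esub> (hcoord (c [el i j])) = finv i j"
proof -
  interpret Gr: group G1 by (rule HG(1))
  let ?a = "el i j"
  have ij: "i \<in> Ix" "j \<in> Jx" using assms K_iff by auto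
  note a = el[OF assms] and aD = F_D[OF el(1)[OF assms]]
  note E = act_r(1-3)[OF ij(2) e_D e_row_col(2)]
  \<comment> \<open>The left factor has column \<open>j\<close> and the right one row
    \<open>i\<close>, so \<open>(i, j) \<in> K\<close> is the criterion of
    \<open>mult_D_iff\<close>.\<close>
  have D: "finv i j \<in> D"
    unfolding finv_def using mult_D_iff[OF E(1) mu(1)[OF ij(1)]] E(3) mu(2)[OF ij(1)] assms by simp
  then show fH: "finv i j \<in> H"
    using row_col_mult[OF E(1) mu(1)[OF ij(1)]] E e_row_col mu[OF ij(1)] by (simp add: H_iff1 finv_def)
  have aa: "c [?a] \<bullet> c [?a] = c [?a]" using F_idem[OF a(1)] by blast
  then have *: "hcoord (c [?a]) \<bullet> finv i j \<bullet> hcoord (c [?a]) = hcoord (c [?a])"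
    using hcoord_mult[OF aD aD] aD a by simp
  note hH = hcoord_H[OF aD]
  have "hcoord (c [?a]) \<otimes>\<^bsub>G1\<^esub> finv i j \<otimes>\<^bsub>G1\<^esub> hcoord (c [?a]) = \<one>\<^bsub>G1\<^esub> \<otimes>\<^bsub>G1\<^esub> hcoord (c [?a])"
    using * hH e_mult(1)[of "hcoord (c [?a])"] H_iff1 by (simp add: HG)
  then have "hcoord (c [?a]) \<otimes>\<^bsub>G1\<^esub> finv i j = \<one>\<^bsub>G1\<^esub>"
    using Gr.right_cancel[of "hcoord (c [?a])" "hcoord (c [?a]) \<otimes>\<^bsub>G1\<^esub> finv i j" "\<one>\<^bsub>G1\<^esub>"]
      hH[folded HG(2)] fH[folded HG(2)] by blast
  then show "inv\<^bsub>G1\<^esub> (hcoord (c [el i j])) = finv i j"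
    using Gr.inv_equality[OF _ hH[folded HG(2)] fH[folded HG(2)]] Gr.inv_comm hH fH HG(2) by simp
qed

lemma fval:
  assumes "(i, j) \<in> K" shows "fval B e X i j = hcoord (c [el i j])"
proof -
  have ij: "i \<in> Ix" "j \<in> Jx" using assms K_iff by auto
  note a = el[OF assms] and l = schreier_lists(1)[OF jsel(2)[OF ij(1)]] schreier_lists(2)[OF ij(2)]
  have aE: "el i j \<in> S.E" using a F_E by blast
  have "hcoord (c [el i j]) = word_act B (lam i \<bullet> c [el i j]) (r' j)" using a by (simp add: hcoord_def)
  also have "lam i = c (e # r (jsel X i))" using word_act_cls[of "[e]"] e l by (simp add: lam_def)
  also have "c (e # r (jsel X i)) \<bullet> c [el i j] = c (e # r (jsel X i) @ [el i j])" using e l aE by (simp add: IG_mult)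
  finally show ?thesis using word_act_cls[of "e # r (jsel X i) @ [el i j]" "r' j"] e l aE by (simp add: fval_def)
qed

lemma gen_val:
  assumes "g \<in> gens B X"
  shows "rho_letter B e X g \<in> lists F" "rho_letter B e X g \<noteq> []"
    "c (rho_letter B e X g) = gen_val B e X g" "gen_val B e X g \<in> H"
proof -
  from assms obtain i j where ij: "(i, j) \<in> K" and g: "g = Gen i j \<or> g = GenInv i j" by (auto simp: gens_def)
  then have I: "i \<in> Ix" "j \<in> Jx" "jsel X i \<in> Jx" using K_iff jsel by auto
  note a = el(1)[OF ij] q(1)[OF I(1)]
  show "rho_letter B e X g \<in> lists F" "rho_letter B e X g \<noteq> []"
    using g e_F a schreier(1,2)[OF I(2)] schreier(1,2)[OF I(3)] by auto
  note l = schreier_lists[OF I(2)] schreier_lists[OF I(3)]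
  have "finv i j = c (e # r j @ [q i] @ r' (jsel X i))"
    using e l F_E[OF a(2)] word_act_cls[of "[e]"] word_act_cls[of "[q i]"] by (simp add: finv_def mu_def IG_mult)
  then show "c (rho_letter B e X g) = gen_val B e X g"
    using g finv(2)[OF ij] fval[OF ij] by (auto simp: fval_def)
  show "gen_val B e X g \<in> H"
    using g finv[OF ij] fval[OF ij] hcoord_H[OF F_D[OF a(1)]] by auto
qed

lemma word_val_Nil: "word_val B e X [] = c [e]"
  by (simp add: word_val_def HG)

lemma word_val_Cons: "word_val B e X (g # u) = gen_val B e X g \<bullet> word_val B e X u"
  by (simp add: word_val_def HG)

lemma word_val_H: "u \<in> lists (gens B X) \<Longrightarrow> word_val B e X u \<in> H"
proof (induction u)
  case (Cons g u)
  interpret Gr: group G1 by (rule HG(1))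
  show ?case using Cons gen_val(4)[of g] Gr.m_closed by (simp add: word_val_Cons HG)
qed (simp add: word_val_Nil e_H)

text \<open>Phrased as an action on \<open>x\<close> so that \<open>u = []\<close> is included: the
  empty word represents no element of IG, but it acts as its value \<open>e\<close> does on the
  first column.\<close>

lemma rho_letters_act:
  assumes "u \<in> lists (gens B X)" "x \<in> D" "col x = o1"
  shows "word_act B x (concat (map (rho_letter B e X) u)) = x \<bullet> word_val B e X u"
  using assms
proof (induction u arbitrary: x rule: list.induct)
  case Nil
  then show ?case by (simp add: word_val_Nil e_mult)
next
  case (Cons g u)
  have g: "g \<in> gens B X" and u: "u \<in> lists (gens B X)" using Cons by auto
  note gv = gen_val[OF g]
  have gD: "gen_val B e X g \<in> D" "row (gen_val B e X g) = o1" "col (gen_val B e X g) = o1"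
    using gv(4) H_iff1 by auto
  note m = mult_base[OF Cons(3) gD(1) Cons(4) gD(2)]
  have cl: "concat (map (rho_letter B e X) u) \<in> lists S.E" using u gen_val(1) F_E by fastforce
  have "word_act B x (concat (map (rho_letter B e X) (g # u))) =
      word_act B (x \<bullet> gen_val B e X g) (concat (map (rho_letter B e X) u))"
    using word_act_append[OF D_C[OF Cons(3)] F_lists[OF gv(1)] cl] gv(2,3) by (simp add: word_act_def)
  also have "\<dots> = x \<bullet> gen_val B e X g \<bullet> word_val B e X u"
    using Cons.IH[OF u m(1)] m(3) gD by simp
  also have "\<dots> = x \<bullet> word_val B e X (g # u)"
    using Cons(3) gD word_val_H[OF u] H_iff1 D_C by (simp add: word_val_Cons G.assoc)
  finally show ?case .
qed

lemma rho_map_val: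
  assumes "i \<in> Ix" "u \<in> lists (gens B X)" "j \<in> Jx"
  shows "rho_map B e X (i, u, j) \<in> lists F" "c (rho_map B e X (i, u, j)) = elt i (word_val B e X u) j"
proof -
  note qF = q(1)[OF assms(1)] and jJ = jsel(2)[OF assms(1)]
  have clF: "concat (map (rho_letter B e X) u) \<in> lists F" using assms(2) gen_val(1) by fastforce
  then show rF: "rho_map B e X (i, u, j) \<in> lists F"
    using qF e_F el_base(2) schreier(2)[OF jJ] schreier(1)[OF assms(3)] by auto
  let ?v = "word_val B e X u"
  have v: "?v \<in> D" "row ?v = o1" "col ?v = o1" using word_val_H[OF assms(2)] H_iff1 by auto
  note m = mult_base[OF mu(1)[OF assms(1)] v(1) mu(3)[OF assms(1)] v(2)]
  note l = schreier_lists(2)[OF jJ] F_lists[OF clF] schreier_lists(1)[OF assms(3)]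
  have eE: "[e] \<in> lists S.E" using e by simp
  have "c (rho_map B e X (i, u, j)) =
      word_act B (c [q i]) (r' (jsel X i) @ concat (map (rho_letter B e X) u) @ [e] @ r j)"
    using word_act_cls[of "[q i]"] F_E[OF qF] l eE by (simp add: el_base(2))
  also have "\<dots> = word_act B (word_act B (word_act B (mu i) (concat (map (rho_letter B e X) u))) [e]) (r j)"
    using l eE F_E[OF qF] cls_in_IG[of "[q i]"]
      word_act_append[of "word_act B (mu i) (concat (map (rho_letter B e X) u))" "[e]" "r j"]
    by (simp add: word_act_append word_act_C mu_def)
  also have "word_act B (mu i) (concat (map (rho_letter B e X) u)) = mu i \<bullet> ?v"
    using rho_letters_act[OF assms(2) mu(1,3)[OF assms(1)]] .
  also have "word_act B (mu i \<bullet> ?v) [e] = mu i \<bullet> ?v"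
    using e_mult(2)[OF m(1)] m(3) v(3) by (simp add: word_act_def)
  finally show "c (rho_map B e X (i, u, j)) = elt i ?v j" by (simp add: elt_def)
qed

section \<open>Words over the letters of D and the mapping \<pi>\<close>

lemma pi_mid_Cons: "ks \<noteq> [] \<Longrightarrow> pi_mid ((i, j) # ks) = Gen i j # GenInv (fst (hd ks)) j # pi_mid ks"
  by (cases ks) auto

lemma cls_Cons: "a \<in> F \<Longrightarrow> w \<in> lists F \<Longrightarrow> w \<noteq> [] \<Longrightarrow> c (a # w) = c [a] \<bullet> c w"
  using F_E F_lists[of w] by (simp add: IG_mult word_def)

lemma cls_F_C: "w \<in> lists F \<Longrightarrow> w \<noteq> [] \<Longrightarrow> c w \<in> G.C"
  using F_lists[of w] by (simp add: cls_in_IG word_def)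

lemma D_word_suffix:
  assumes "a \<in> F" "w \<in> lists F" "w \<noteq> []" "c (a # w) \<in> D" shows "c w \<in> D"
proof -
  from assms(3) obtain b v where w: "w = b # v" by (cases w) auto
  show ?thesis
  proof (cases "v = []")
    case False
    then have "c w = c [b] \<bullet> c v" "c v \<in> G.C" using assms(2) w cls_Cons cls_F_C by auto
    then show ?thesis
      using D_suffix[of "c [a]" "c [b]" "c v"] assms w cls_Cons[OF assms(1-3)] F_D by auto
  qed (use assms w F_D in auto)
qed

lemma pi_dom_single: "[a] \<in> pi_dom B e \<longleftrightarrow> a \<in> F"
  using F_D by (auto simp: pi_dom_def)

text \<open>With \<open>row_word\<close>, membership in \<open>pi_dom\<close> becomes a condition on
  adjacent letters; this is the form in which it is decided.\<close>

lemma pi_dom_Cons: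
  assumes "w \<noteq> []"
  shows "a # w \<in> pi_dom B e \<longleftrightarrow> a \<in> F \<and> w \<in> pi_dom B e \<and> (row (c w), col (c [a])) \<in> K"
proof (cases "a \<in> F \<and> w \<in> lists F")
  case True
  then show ?thesis
    using mult_D_iff[of "c [a]" "c w"] D_word_suffix[of a w] F_D[of a] cls_Cons[of a w] assms
    by (auto simp: pi_dom_def simp del: in_lists_conv_set)
qed (auto simp: pi_dom_def)

lemma row_col_word:
  assumes "a # w \<in> pi_dom B e" "w \<noteq> []"
  shows "row (c (a # w)) = row (c [a])" "col (c (a # w)) = col (c w)"
proof -
  have "a \<in> F" "w \<in> pi_dom B e" using assms pi_dom_Cons by auto
  then show "row (c (a # w)) = row (c [a])" "col (c (a # w)) = col (c w)"
    using row_col_mult[of "c [a]" "c w"] assms cls_Cons[of a w] F_D by (auto simp: pi_dom_def)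
qed

lemma row_word: "w \<in> pi_dom B e \<Longrightarrow> row (c w) = row (c [hd w])"
  using row_col_word(1) by (cases w; cases "tl w = []") (auto simp: pi_dom_def)

text \<open>\<open>pi_mid\<close> is \<open>hcoord_mult\<close> unrolled along \<open>w\<close>:
  each \<open>GenInv\<close> is the sandwich entry between two adjacent letters.\<close>

lemma pi_map_val:
  assumes "w \<in> pi_dom B e"
  shows "pi_map B X w = (row (c w), pi_mid (map (idx B X) w), col (c w)) \<and>
    pi_mid (map (idx B X) w) \<in> lists (gens B X) \<and>
    word_val B e X (pi_mid (map (idx B X) w)) = hcoord (c w)"
  using assms
proof (induction w rule: list.induct)
  case Nil
  then show ?case by (simp add: pi_dom_def)
next
  case (Cons a w)
  show ?case
  proof (cases "w = []")
    case True
    with Cons have a: "a \<in> F" by (simp add: pi_dom_single)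
    have h: "hcoord (c [a]) \<in> H" using hcoord_H F_D a by blast
    then show ?thesis
      using True a idx_F F_el[OF a] fval[OF F_el(1)[OF a]] e_mult(2)[of "hcoord (c [a])"] H_iff1
      by (auto simp: pi_map_def gens_def word_val_Cons word_val_Nil)
  next
    case False
    with Cons(2) have a: "a \<in> F" and w: "w \<in> pi_dom B e" and K: "(row (c w), col (c [a])) \<in> K"
      using pi_dom_Cons by auto
    note IH = Cons(1)[OF w]
    have hd: "idx B X (hd w) = (row (c w), col (c [hd w]))"
      using row_word[OF w] idx_F[of "hd w"] w False by (auto simp: pi_dom_def)
    let ?m = "pi_mid (map (idx B X) w)"
    have m: "pi_mid (map (idx B X) (a # w)) =
        Gen (row (c [a])) (col (c [a])) # GenInv (row (c w)) (col (c [a])) # ?m"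
      using pi_mid_Cons[of "map (idx B X) w"] False idx_F[OF a] hd by (simp add: hd_map)
    have D: "c [a] \<in> D" "c w \<in> D" "c [a] \<bullet> c w \<in> D"
      using a w Cons(2) False cls_Cons[of a w] F_D by (auto simp: pi_dom_def)
    have "word_val B e X (pi_mid (map (idx B X) (a # w))) =
        hcoord (c [a]) \<bullet> (finv (row (c w)) (col (c [a])) \<bullet> hcoord (c w))"
      using m IH fval[OF F_el(1)[OF a]] F_el(2)[OF a] fval[OF K] finv(2)[OF K] by (simp add: word_val_Cons)
    also have "\<dots> = hcoord (c [a] \<bullet> c w)"
      using hcoord_mult[OF D] hcoord_H[OF D(1)] hcoord_H[OF D(2)] finv(1)[OF K] H_iff1 D_C
      by (simp add: G.assoc)
    also have "\<dots> = hcoord (c (a # w))" using cls_Cons[of a w] a w False by (simp add: pi_dom_def)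
    finally have val: "word_val B e X (pi_mid (map (idx B X) (a # w))) = hcoord (c (a # w))" .
    have "pi_map B X (a # w) = (fst (idx B X a), pi_mid (map (idx B X) (a # w)), snd (snd (pi_map B X w)))"
      using False by (simp add: pi_map_def Let_def)
    then have "pi_map B X (a # w) =
        (row (c (a # w)), pi_mid (map (idx B X) (a # w)), col (c (a # w)))"
      using row_col_word[OF Cons(2) False] IH idx_F[OF a] by simp
    moreover have "pi_mid (map (idx B X) (a # w)) \<in> lists (gens B X)"
      unfolding m using IH K F_el(1)[OF a] by (auto simp: gens_def)
    ultimately show ?thesis using val by blast
  qed
qed

text \<open>That the \<open>f_ij\<close> generate H follows from \<pi>: write the element with
  coordinates \<open>(1, g, 1)\<close> as a word over letters of D and take its image.\<close>

lemma word_val_surj: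
  assumes "g \<in> H" shows "\<exists>u\<in>lists (gens B X). word_val B e X u = g"
proof -
  let ?x = "elt o1 g o1"
  have x: "?x \<in> D" "hcoord ?x = g" using elt indexes assms by blast+
  obtain v where v: "v \<noteq> []" "v \<in> lists F" "?x = c v" using D_word[OF x(1)] by blast
  then have "v \<in> pi_dom B e" using x by (simp add: pi_dom_def)
  from pi_map_val[OF this] x v show ?thesis by auto
qed

section \<open>The two isomorphisms\<close>

abbreviation "D0 \<equiv> principal_factor I D"
abbreviation "M0 \<equiv> rees_matrix G1 Ix Jx (sandwich B e X)"

definition "Phi = map_option (\<lambda>x. (row x, hcoord x, col x))"
definition "Psi = map_option (\<lambda>(i, g, j). elt i g j)"

lemma carriers: "carrier D0 = insert None (Some ` D)" "carrier M0 = insert None (Some ` (Ix \<times> H \<times> Jx))"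
  by (simp_all add: principal_factor_def rees_matrix_def HG)

lemma Phi_closed: "x \<in> carrier D0 \<Longrightarrow> Phi x \<in> carrier M0"
  by (auto simp: carriers Phi_def row col hcoord_H)

lemma Psi_closed: "y \<in> carrier M0 \<Longrightarrow> Psi y \<in> carrier D0"
  by (auto simp: carriers Psi_def elt)

lemma Psi_Phi: "x \<in> carrier D0 \<Longrightarrow> Psi (Phi x) = x"
  by (auto simp: carriers Phi_def Psi_def elt_hcoord)

lemma Phi_Psi: "y \<in> carrier M0 \<Longrightarrow> Phi (Psi y) = y"
  by (auto simp: carriers Phi_def Psi_def elt)

lemma Phi_iso: "sgrp_iso D0 M0 Phi"
  unfolding sgrp_iso_def
proof (intro conjI ballI)
  show "bij_betw Phi (carrier D0) (carrier M0)"
    by (rule bij_betw_byWitness[where f' = Psi]) (use Psi_Phi Phi_Psi Phi_closed Psi_closed in auto)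
  fix a b assume ab: "a \<in> carrier D0" "b \<in> carrier D0"
  show "Phi (sprod D0 a b) = sprod M0 (Phi a) (Phi b)"
  proof (cases "a = None \<or> b = None")
    case True
    then show ?thesis by (auto simp: principal_factor_def rees_matrix_def Phi_def split: option.split)
  next
    case False
    then obtain x y where xy: "a = Some x" "b = Some y" "x \<in> D" "y \<in> D" using ab by (auto simp: carriers)
    show ?thesis
    proof (cases "x \<bullet> y \<in> D")
      case True
      then have K: "(row y, col x) \<in> K" using mult_D_iff xy by blast
      show ?thesis
        using True xy K hcoord_mult[OF xy(3,4) True] row_col_mult[OF xy(3,4) True] fval[OF K] finv(2)[OF K]
        by (simp add: principal_factor_def rees_matrix_def Phi_def sandwich_def HG)
    next
      case False
      then have "(row y, col x) \<notin> K" using mult_D_iff xy by blast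
      then show ?thesis
        using False xy by (simp add: principal_factor_def rees_matrix_def Phi_def sandwich_def)
    qed
  qed
qed

lemma Psi_iso: "sgrp_iso M0 D0 Psi"
  unfolding sgrp_iso_def
proof (intro conjI ballI)
  show "bij_betw Psi (carrier M0) (carrier D0)"
    by (rule bij_betw_byWitness[where f' = Phi]) (use Psi_Phi Phi_Psi Phi_closed Psi_closed in auto)
  have closed: "sprod D0 a b \<in> carrier D0" for a b
    by (auto simp: principal_factor_def split: option.split)
  fix a b assume ab: "a \<in> carrier M0" "b \<in> carrier M0"
  have "Phi (sprod D0 (Psi a) (Psi b)) = sprod M0 a b"
    using Phi_iso Psi_closed[OF ab(1)] Psi_closed[OF ab(2)] Phi_Psi ab by (simp add: sgrp_iso_def)
  then show "Psi (sprod M0 a b) = sprod D0 (Psi a) (Psi b)" using Psi_Phi[OF closed] by metis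
qed

lemma pi_induces: "induces (pi_dom B e) (rho_dom B X) (pi_map B X) c (triple_val B e X) D0 Phi"
  unfolding induces_def
proof (intro conjI ballI)
  show "pi_map B X \<in> pi_dom B e \<rightarrow> rho_dom B X"
    using pi_map_val row(1) col(1) by (auto simp: rho_dom_def pi_dom_def)
  have "c ` pi_dom B e = D" using D_word by (force simp: pi_dom_def)
  then show "carrier D0 = insert None (Some ` c ` pi_dom B e)" by (simp add: carriers)
  fix w assume "w \<in> pi_dom B e"
  then show "Phi (Some (c w)) = Some (triple_val B e X (pi_map B X w))"
    using pi_map_val by (simp add: Phi_def)
qed (simp add: Phi_def)

lemma rho_induces: "induces (rho_dom B X) (pi_dom B e) (rho_map B e X) (triple_val B e X) c M0 Psi"
  unfolding induces_def
proof (intro conjI ballI)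
  show "rho_map B e X \<in> rho_dom B X \<rightarrow> pi_dom B e"
  proof
    fix p assume "p \<in> rho_dom B X"
    then obtain i u j where p: "p = (i, u, j)" "i \<in> Ix" "u \<in> lists (gens B X)" "j \<in> Jx"
      by (auto simp: rho_dom_def)
    then show "rho_map B e X p \<in> pi_dom B e"
      using rho_map_val[OF p(2-4)] elt(1)[OF p(2,4) word_val_H[OF p(3)]]
      by (simp add: pi_dom_def)
  qed
  have "triple_val B e X ` rho_dom B X = Ix \<times> H \<times> Jx"
  proof (intro equalityI subsetI)
    fix t assume "t \<in> Ix \<times> H \<times> Jx"
    then obtain i g j where t: "t = (i, g, j)" "i \<in> Ix" "g \<in> H" "j \<in> Jx" by auto
    then obtain u where "u \<in> lists (gens B X)" "word_val B e X u = g" using word_val_surj by blast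
    then have "t = triple_val B e X (i, u, j)" "(i, u, j) \<in> rho_dom B X" using t by (auto simp: rho_dom_def)
    then show "t \<in> triple_val B e X ` rho_dom B X" by blast
  qed (auto simp: rho_dom_def intro: word_val_H)
  then show "carrier M0 = insert None (Some ` triple_val B e X ` rho_dom B X)" by (simp add: carriers)
  fix p assume "p \<in> rho_dom B X"
  then obtain i u j where p: "p = (i, u, j)" "i \<in> Ix" "u \<in> lists (gens B X)" "j \<in> Jx"
    by (auto simp: rho_dom_def)
  then show "Psi (Some (triple_val B e X p)) = Some (c (rho_map B e X p))"
    using rho_map_val(2)[OF p(2-4)] by (simp add: Psi_def del: rho_map.simps)
qed (simp add: Psi_def)

end

section \<open>Computing the mappings from finite tables\<close>

lemma code_id: "(code :: nat \<Rightarrow> nat) = id"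
  by (simp add: fun_eq_iff)

lemma enc_list_code: "enc_list code = code"
  by (simp add: enc_list_def code_list_def fun_eq_iff)

lemma enc_pair_code: "enc_pair code code = code"
  by (simp add: enc_pair_def code_prod_def fun_eq_iff)

lemma enc_gen_code: "enc_gen = code"
proof
  fix g show "enc_gen g = code g" by (cases g) (simp_all add: code_prod_def)
qed

lemma enc_code: "enc_word = code" "enc_triple = code" "enc_algebra = code" "enc_coord = code"
  unfolding enc_word_def enc_triple_def enc_algebra_def enc_coord_def
  by (simp_all only: code_id[symmetric] enc_list_code enc_pair_code enc_gen_code)

lemma computable_Gen [computable_intros]:
  assumes "computable f" "computable g" shows "computable (\<lambda>x. Gen (f x) (g x))"
proof (rule computable_recode)
  show "computable (\<lambda>x. (0 :: nat, f x, g x))" by (intro computable_intros assms)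
qed simp

lemma computable_GenInv [computable_intros]:
  assumes "computable f" "computable g" shows "computable (\<lambda>x. GenInv (f x) (g x))"
proof (rule computable_recode)
  show "computable (\<lambda>x. (1 :: nat, f x, g x))" by (intro computable_intros assms)
qed simp

text \<open>Has the same code as its argument, so case distinctions on generators become projections
  of triples.\<close>

primrec gen_parts :: "'i gen \<Rightarrow> nat \<times> 'i \<times> 'i" where
  "gen_parts (Gen i j) = (0, i, j)"
| "gen_parts (GenInv i j) = (1, i, j)"

lemma computable_gen_parts [computable_intros]:
  assumes "computable f" shows "computable (\<lambda>x. gen_parts (f x))"
proof (rule computable_recode[OF assms])
  fix x show "code (gen_parts (f x)) = code (f x)" by (cases "f x") simp_all
qed

text \<open>A missing key yields a component of the fixed value \<open>hd []\<close>, which keeps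
  lookups total; correctness is claimed for listed keys.\<close>

definition lookup :: "'k \<Rightarrow> ('k \<times> 'v) list \<Rightarrow> 'v" where
  "lookup k l = snd (hd (filter (\<lambda>p. fst p = k) l))"

lemma lookup_eq: "set l = {(k, f k) |k. k \<in> A} \<Longrightarrow> k \<in> A \<Longrightarrow> lookup k l = f k"
proof -
  assume l: "set l = {(k, f k) |k. k \<in> A}" and k: "k \<in> A"
  then have "(k, f k) \<in> set (filter (\<lambda>p. fst p = k) l)" by auto
  then have "filter (\<lambda>p. fst p = k) l \<noteq> []" by (metis empty_iff empty_set)
  from hd_in_set[OF this] l show ?thesis by (auto simp: lookup_def)
qed

lemma computable_lookup [computable_intros]:
  assumes "computable k" "computable l" shows "computable (\<lambda>x. lookup (k x) (l x))"
  unfolding lookup_def by (intro computable_intros assms computable_comp[OF assms(1)])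

definition letter_at :: "(nat \<times> nat \<times> nat) list \<Rightarrow> nat \<Rightarrow> nat \<Rightarrow> nat" where
  "letter_at ks i j = snd (snd (hd (filter (\<lambda>p. fst p = i \<and> fst (snd p) = j) ks)))"

lemma computable_letter_at [computable_intros]:
  assumes "computable k" "computable i" "computable j"
  shows "computable (\<lambda>x. letter_at (k x) (i x) (j x))"
  unfolding letter_at_def
  by (intro computable_intros assms computable_comp[OF assms(2)] computable_comp[OF assms(3)])

definition index_of :: "(nat \<times> nat \<times> nat) list \<Rightarrow> nat \<Rightarrow> nat \<times> nat" where
  "index_of ks a = (let p = hd (filter (\<lambda>p. snd (snd p) = a) ks) in (fst p, fst (snd p)))"

lemma computable_index_of [computable_intros]:
  assumes "computable k" "computable a"
  shows "computable (\<lambda>x. index_of (k x) (a x))"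
  unfolding index_of_def Let_def
  by (intro computable_intros assms computable_comp[OF assms(2)])

definition in_table :: "(nat \<times> nat \<times> nat) list \<Rightarrow> nat \<Rightarrow> nat \<Rightarrow> bool" where
  "in_table ks i j \<longleftrightarrow> (\<exists>p\<in>set ks. fst p = i \<and> fst (snd p) = j)"

lemma computable_in_table [computable_intros]:
  assumes "computable k" "computable i" "computable j"
  shows "computable (\<lambda>x. in_table (k x) (i x) (j x))"
  unfolding in_table_def
  by (intro computable_intros assms computable_comp[OF assms(2)] computable_comp[OF assms(3)])

definition is_letter :: "(nat \<times> nat \<times> nat) list \<Rightarrow> nat \<Rightarrow> bool" where
  "is_letter ks a \<longleftrightarrow> (\<exists>p\<in>set ks. snd (snd p) = a)"

lemma computable_is_letter [computable_intros]:
  assumes "computable k" "computable a"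
  shows "computable (\<lambda>x. is_letter (k x) (a x))"
  unfolding is_letter_def
  by (intro computable_intros assms computable_comp[OF assms(2)])

text \<open>The criterion of \<open>pi_dom_Cons\<close> read in the table: for adjacent letters
  \<open>e_ij\<close> and \<open>e_kl\<close> the pair \<open>(k, j)\<close> must be listed.\<close>

definition pi_defined :: "(nat \<times> nat \<times> nat) list \<Rightarrow> nat list \<Rightarrow> bool" where
  "pi_defined ks w \<longleftrightarrow> w \<noteq> [] \<and> rec_list True (\<lambda>a v r. r \<and> is_letter ks a \<and>
     (v = [] \<or> in_table ks (fst (index_of ks (hd v))) (snd (index_of ks a)))) w"

definition pi_mid_table :: "(nat \<times> nat \<times> nat) list \<Rightarrow> nat list \<Rightarrow> nat gen list" where
  "pi_mid_table ks w = rec_list [] (\<lambda>a v r. Gen (fst (index_of ks a)) (snd (index_of ks a)) #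
     (if v = [] then [] else GenInv (fst (index_of ks (hd v))) (snd (index_of ks a)) # r)) w"

definition pi_table :: "(nat \<times> nat \<times> nat) list \<Rightarrow> nat list \<Rightarrow> nat \<times> nat gen list \<times> nat" where
  "pi_table ks w = (fst (index_of ks (hd w)), pi_mid_table ks w, snd (index_of ks (last w)))"

abbreviation "ks_of (d :: coord_table) \<equiv> fst (snd (snd (snd d)))"
abbreviation "rs_of (d :: coord_table) \<equiv> fst (snd (snd (snd (snd d))))"
abbreviation "rs'_of (d :: coord_table) \<equiv> fst (snd (snd (snd (snd (snd d)))))"
abbreviation "ss_of (d :: coord_table) \<equiv> snd (snd (snd (snd (snd (snd d)))))"
abbreviation "base_of (d :: coord_table) \<equiv> fst (snd (snd d))"
abbreviation "is_of (d :: coord_table) \<equiv> fst d"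
abbreviation "js_of (d :: coord_table) \<equiv> fst (snd d)"

definition rho_letter_table :: "nat \<Rightarrow> coord_table \<Rightarrow> nat gen \<Rightarrow> nat list" where
  "rho_letter_table e d g = (let i = fst (snd (gen_parts g)); j = snd (snd (gen_parts g));
      s = lookup i (ss_of d)
    in if fst (gen_parts g) = 0
       then [e] @ lookup s (rs_of d) @ [letter_at (ks_of d) i j] @ lookup j (rs'_of d)
       else [e] @ lookup j (rs_of d) @ [letter_at (ks_of d) i s] @ lookup s (rs'_of d))"

definition rho_table :: "nat \<Rightarrow> coord_table \<Rightarrow> nat \<times> nat gen list \<times> nat \<Rightarrow> nat list" where
  "rho_table e d p = (let i = fst p; u = fst (snd p); j = snd (snd p); s = lookup i (ss_of d)
    in [letter_at (ks_of d) i s] @ lookup s (rs'_of d) @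
      concat (map (\<lambda>g. rho_letter_table e d g) u) @
      [letter_at (ks_of d) (base_of d) (base_of d)] @ lookup j (rs_of d))"

definition rho_defined :: "coord_table \<Rightarrow> nat \<times> nat gen list \<times> nat \<Rightarrow> bool" where
  "rho_defined d p \<longleftrightarrow> fst p \<in> set (is_of d) \<and> snd (snd p) \<in> set (js_of d) \<and>
    (\<forall>g\<in>set (fst (snd p)). in_table (ks_of d) (fst (snd (gen_parts g))) (snd (snd (gen_parts g))))"

lemma computable_pi_defined: "computable (\<lambda>x. pi_defined (fst x) (snd x))"
  unfolding pi_defined_def by (intro computable_intros computable_rec_list)

lemma computable_pi_table: "computable (\<lambda>x. pi_table (fst x) (snd x))"
  unfolding pi_table_def pi_mid_table_def by (intro computable_intros computable_rec_list)

lemma computable_rho_defined: "computable (\<lambda>x. rho_defined (fst x) (snd x))"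
  unfolding rho_defined_def by (intro computable_intros)

lemma computable_rho_letter_table:
  assumes "computable e" "computable d" "computable g"
  shows "computable (\<lambda>x. rho_letter_table (e x) (d x) (g x))"
  unfolding rho_letter_table_def Let_def by (intro computable_intros assms)

lemma computable_rho_table: "computable (\<lambda>x. rho_table (fst x) (fst (snd x)) (snd (snd x)))"
  unfolding rho_table_def Let_def by (intro computable_intros computable_rho_letter_table)

text \<open>Machines receive separate arguments, while a tuple is coded by nested pairing;
  precomposition with the pairing joins the two forms.\<close>

lemma rec_eval_guarded4:
  fixes P :: "'b :: coded \<Rightarrow> 'c :: coded \<Rightarrow> 'd :: coded \<Rightarrow> bool" and f :: "'b \<Rightarrow> 'c \<Rightarrow> 'd \<Rightarrow> 'r :: coded"
  assumes "computable (\<lambda>x. P (fst x) (fst (snd x)) (snd (snd x)))"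
    "computable (\<lambda>x. f (fst x) (fst (snd x)) (snd (snd x)))"
  shows "\<exists>F. \<forall>t e d v y. rec_eval F [t, code e, code d, code v] y \<longleftrightarrow> P e d v \<and> y = code (f e d v)"
proof -
  from rec_eval_guarded[OF assms] obtain F where
    F: "\<And>e d v y. rec_eval F [code (e, d, v)] y \<longleftrightarrow> P e d v \<and> y = code (f e d v)" by fastforce
  have "total_rec 4 (\<lambda>xs. prod_encode (xs ! 1, prod_encode (xs ! 2, xs ! 3)))"
    by (intro total_rec_prod_encode total_rec_proj) simp_all
  from rec_eval_precomp[OF this, of F] obtain G where G: "\<And>xs y. length xs = 4 \<Longrightarrow>
    rec_eval G xs y \<longleftrightarrow> rec_eval F [prod_encode (xs ! 1, prod_encode (xs ! 2, xs ! 3))] y" by blast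
  have "rec_eval G [t, code e, code d, code v] y \<longleftrightarrow> P e d v \<and> y = code (f e d v)" for t e d v y
    using G[of "[t, code e, code d, code v]" y] F[of e d v y] by (simp add: code_Pair)
  then show ?thesis by blast
qed

lemma presents_coord_iff:
  "presents_coord d B X \<longleftrightarrow> set (is_of d) = idxI X \<and> set (js_of d) = idxJ X \<and> base_of d = base X \<and>
    set (ks_of d) = {(i, j, eij B X i j) |i j. (i, j) \<in> KK B X} \<and>
    set (rs_of d) = {(j, rw X j) |j. j \<in> idxJ X} \<and> set (rs'_of d) = {(j, rw' X j) |j. j \<in> idxJ X} \<and>
    set (ss_of d) = {(i, jsel X i) |i. i \<in> idxI X}"
  by (cases d) simp

locale presented_coordinates = coordinates S B e X
  for S :: "nat sgrp" and B e and X :: "(nat, nat) coord" +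
  fixes d :: coord_table
  assumes presents_coord: "presents_coord d B X"
begin

lemma tables: "set (is_of d) = Ix" "set (js_of d) = Jx" "base_of d = o1"
  "set (ks_of d) = {(i, j, el i j) |i j. (i, j) \<in> K}"
  "set (rs_of d) = {(j, r j) |j. j \<in> Jx}" "set (rs'_of d) = {(j, r' j) |j. j \<in> Jx}"
  "set (ss_of d) = {(i, jsel X i) |i. i \<in> Ix}"
  using presents_coord unfolding presents_coord_iff by simp_all

lemma lookups: "j \<in> Jx \<Longrightarrow> lookup j (rs_of d) = r j" "j \<in> Jx \<Longrightarrow> lookup j (rs'_of d) = r' j"
  "i \<in> Ix \<Longrightarrow> lookup i (ss_of d) = jsel X i"
  using lookup_eq[OF tables(5)] lookup_eq[OF tables(6)] lookup_eq[OF tables(7)] by simp_all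

lemma in_table: "in_table (ks_of d) i j \<longleftrightarrow> (i, j) \<in> K"
  unfolding in_table_def tables(4) by auto

lemma letter_at:
  assumes "(i, j) \<in> K" shows "letter_at (ks_of d) i j = el i j"
proof -
  let ?l = "filter (\<lambda>p. fst p = i \<and> fst (snd p) = j) (ks_of d)"
  have "(i, j, el i j) \<in> set ?l" using assms tables(4) by simp
  then have "?l \<noteq> []" by (metis empty_iff empty_set)
  from hd_in_set[OF this] have "hd ?l = (i, j, el i j)" using tables(4) by auto
  then show ?thesis by (simp add: letter_at_def)
qed

lemma is_letter: "is_letter (ks_of d) a \<longleftrightarrow> a \<in> F"
  unfolding is_letter_def tables(4) using el(1) F_el by force

lemma index_of:
  assumes "a \<in> F" shows "index_of (ks_of d) a = (row (c [a]), col (c [a]))"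
proof -
  let ?l = "filter (\<lambda>p. snd (snd p) = a) (ks_of d)"
  have "(row (c [a]), col (c [a]), a) \<in> set ?l" using tables(4) F_el[OF assms] by force
  then have "?l \<noteq> []" by (metis empty_iff empty_set)
  from hd_in_set[OF this] obtain i j where "hd ?l = (i, j, el i j)" "(i, j) \<in> K" "el i j = a"
    using tables(4) by auto
  then show ?thesis using el(3,4)[of i j] by (simp add: index_of_def)
qed

lemma pi_defined: "pi_defined (ks_of d) w \<longleftrightarrow> w \<in> pi_dom B e"
proof (induction w rule: list.induct)
  case Nil
  then show ?case by (simp add: pi_defined_def pi_dom_def)
next
  case (Cons a w)
  show ?case
  proof (cases "w = []")
    case True
    then show ?thesis by (simp add: pi_defined_def is_letter pi_dom_single)
  next
    case False
    have "pi_defined (ks_of d) (a # w) \<longleftrightarrow> pi_defined (ks_of d) w \<and> a \<in> F \<and>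
        (fst (index_of (ks_of d) (hd w)), snd (index_of (ks_of d) a)) \<in> K"
      using False by (simp add: pi_defined_def is_letter in_table)
    also have "\<dots> \<longleftrightarrow> w \<in> pi_dom B e \<and> a \<in> F \<and> (row (c w), col (c [a])) \<in> K"
    proof -
      have "hd w \<in> F" if "w \<in> pi_dom B e" using that by (cases w) (auto simp: pi_dom_def)
      then show ?thesis using Cons index_of row_word by auto
    qed
    finally show ?thesis using pi_dom_Cons[OF False, of a] by blast
  qed
qed

lemma pi_mid_table:
  "w \<in> lists F \<Longrightarrow> pi_mid_table (ks_of d) w = pi_mid (map (idx B X) w)"
proof (induction w)
  case (Cons a w)
  then show ?case
    using idx_F[of a] index_of[of a] idx_F[of "hd w"] index_of[of "hd w"]
    by (cases w) (auto simp: pi_mid_table_def)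
qed (simp add: pi_mid_table_def)

lemma pi_table:
  assumes "w \<in> pi_dom B e" shows "pi_table (ks_of d) w = pi_map B X w"
proof -
  have w: "w \<noteq> []" "w \<in> lists F" using assms by (auto simp: pi_dom_def)
  then have "hd w \<in> F" "last w \<in> F" by auto
  then show ?thesis
    using w idx_F index_of pi_mid_table[OF w(2)]
    by (simp add: pi_table_def pi_map_def Let_def hd_map last_map)
qed

lemma rho_defined: "rho_defined d p \<longleftrightarrow> p \<in> rho_dom B X"
proof -
  obtain i u j where p: "p = (i, u, j)" by (cases p)
  have "g \<in> gens B X \<longleftrightarrow> (fst (snd (gen_parts g)), snd (snd (gen_parts g))) \<in> K" for g
    by (cases g) (auto simp: gens_def)
  then show ?thesis by (auto simp: p rho_defined_def rho_dom_def tables in_table)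
qed

lemma rho_letter_table:
  assumes "g \<in> gens B X" shows "rho_letter_table e d g = rho_letter B e X g"
proof -
  from assms obtain i j where g: "g = Gen i j \<or> g = GenInv i j" and K: "(i, j) \<in> K"
    by (auto simp: gens_def)
  then have "i \<in> Ix" "j \<in> Jx" using K_iff by auto
  with g K show ?thesis
    using jsel lookups letter_at by (auto simp: rho_letter_table_def Let_def)
qed

lemma rho_table:
  assumes "p \<in> rho_dom B X" shows "rho_table e d p = rho_map B e X p"
proof -
  from assms obtain i u j where p: "p = (i, u, j)" "i \<in> Ix" "u \<in> lists (gens B X)" "j \<in> Jx"
    by (auto simp: rho_dom_def)
  have "rho_letter_table e d g = rho_letter B e X g" if "g \<in> set u" for g
    using p(3) rho_letter_table that by auto
  then show ?thesis
    using p jsel lookups letter_at el_base tables(3)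
    by (simp add: rho_table_def Let_def cong: map_cong)
qed

end

section \<open>Deciding whether a table presents a coordinatization\<close>

text \<open>The two entries state the equations of \<open>letter_R_iff\<close>.\<close>

definition R_table :: "(nat \<times> nat \<times> nat) list \<Rightarrow> nat \<Rightarrow> nat \<Rightarrow> bool" where
  "R_table ts a b \<longleftrightarrow> (a, b, b) \<in> set ts \<and> (b, a, a) \<in> set ts"

definition L_table :: "(nat \<times> nat \<times> nat) list \<Rightarrow> nat \<Rightarrow> nat \<Rightarrow> bool" where
  "L_table ts a b \<longleftrightarrow> (a, b, a) \<in> set ts \<and> (b, a, b) \<in> set ts"

definition table_on :: "('k \<times> 'v) list \<Rightarrow> 'k list \<Rightarrow> bool" where
  "table_on l A \<longleftrightarrow> (\<forall>k\<in>set A. \<exists>p\<in>set l. fst p = k) \<and> (\<forall>p\<in>set l. fst p \<in> set A) \<and>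
    (\<forall>p\<in>set l. \<forall>p'\<in>set l. fst p = fst p' \<longrightarrow> p = p')"

text \<open>The last clause closes the list under R and L, so once it contains \<open>e\<close> it
  contains all letters of D by \<open>F_connected\<close>. That nothing else is listed comes from
  the Schreier words, in \<open>letters_subset\<close>.\<close>

definition letters_valid :: "algebra_table \<Rightarrow> nat \<Rightarrow> coord_table \<Rightarrow> bool" where
  "letters_valid t e d \<longleftrightarrow>
    (\<forall>p\<in>set (ks_of d). fst p \<in> set (is_of d) \<and> fst (snd p) \<in> set (js_of d) \<and> snd (snd p) \<in> set (fst t)) \<and>
    (\<forall>p\<in>set (ks_of d). \<forall>p'\<in>set (ks_of d).
       (fst p = fst p' \<longleftrightarrow> R_table (snd t) (snd (snd p)) (snd (snd p'))) \<and>
       (fst (snd p) = fst (snd p') \<longleftrightarrow> L_table (snd t) (snd (snd p)) (snd (snd p')))) \<and>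
    (base_of d, base_of d, e) \<in> set (ks_of d) \<and>
    (\<forall>p\<in>set (ks_of d). \<forall>a\<in>set (fst t).
       R_table (snd t) (snd (snd p)) a \<or> L_table (snd t) (snd (snd p)) a \<longrightarrow> is_letter (ks_of d) a)"

text \<open>The word \<open>r\<^sub>l\<close> extends some \<open>r\<^sub>j\<close> by one letter, and \<open>r'\<^sub>l\<close> is \<open>r'\<^sub>j\<close> with a letter in front
  that undoes the action of the former.\<close>

definition schreier_valid :: "coord_table \<Rightarrow> bool" where
  "schreier_valid d \<longleftrightarrow> (\<forall>p\<in>set (rs_of d).
     p = (base_of d, []) \<and> (base_of d, []) \<in> set (rs'_of d) \<or>
     (\<exists>p0\<in>set (rs_of d). \<exists>p1\<in>set (rs'_of d). \<exists>g\<in>set (ks_of d). \<exists>y\<in>set (ks_of d).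
        fst g = fst y \<and> fst (snd g) = fst p \<and> fst (snd y) = fst p0 \<and> fst p1 = fst p0 \<and>
        snd p = snd p0 @ [snd (snd g)] \<and> (fst p, snd (snd y) # snd p1) \<in> set (rs'_of d)))"

definition valid :: "algebra_table \<Rightarrow> nat \<Rightarrow> coord_table \<Rightarrow> bool" where
  "valid t e d \<longleftrightarrow> letters_valid t e d \<and> schreier_valid d \<and>
    table_on (rs_of d) (js_of d) \<and> table_on (rs'_of d) (js_of d) \<and> table_on (ss_of d) (is_of d) \<and>
    (\<forall>p\<in>set (ss_of d). in_table (ks_of d) (fst p) (snd p))"

lemma computable_R_table [computable_intros]:
  assumes "computable t" "computable a" "computable b"
  shows "computable (\<lambda>x. R_table (t x) (a x) (b x))"
  unfolding R_table_def by (intro computable_intros assms)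

lemma computable_L_table [computable_intros]:
  assumes "computable t" "computable a" "computable b"
  shows "computable (\<lambda>x. L_table (t x) (a x) (b x))"
  unfolding L_table_def by (intro computable_intros assms)

lemma computable_table_on [computable_intros]:
  assumes "computable l" "computable A" shows "computable (\<lambda>x. table_on (l x) (A x))"
  unfolding table_on_def
  by (intro computable_intros assms computable_comp[OF assms(1)] computable_comp[OF assms(2)])

lemma computable_letters_valid:
  assumes "computable t" "computable e" "computable d"
  shows "computable (\<lambda>x. letters_valid (t x) (e x) (d x))"
  unfolding letters_valid_def
  by (intro computable_intros assms computable_comp[OF assms(1)] computable_comp[OF assms(2)]
      computable_comp[OF assms(3)])

lemma computable_schreier_valid:
  assumes "computable d" shows "computable (\<lambda>x. schreier_valid (d x))"
  unfolding schreier_valid_def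
  by (intro computable_intros assms computable_comp[OF assms(1)])

lemma computable_valid: "computable (\<lambda>x. valid (fst (fst x)) (snd (fst x)) (snd x))"
  unfolding valid_def
  by (intro computable_intros computable_letters_valid computable_schreier_valid)

lemma surj_code_prod: "surj (code :: 'a :: coded \<Rightarrow> nat) \<Longrightarrow> surj (code :: 'b :: coded \<Rightarrow> nat) \<Longrightarrow>
    surj (code :: 'a \<times> 'b \<Rightarrow> nat)"
proof (rule surjI)
  fix n
  assume s: "surj (code :: 'a \<Rightarrow> nat)" "surj (code :: 'b \<Rightarrow> nat)"
  show "code (inv_into UNIV (code :: 'a \<Rightarrow> nat) (fst (prod_decode n)), inv_into UNIV (code :: 'b \<Rightarrow> nat) (snd (prod_decode n))) = n"
    using s by (simp add: code_Pair surj_f_inv_f)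
qed

lemma surj_code_list: "surj (code :: 'a :: coded \<Rightarrow> nat) \<Longrightarrow> surj (code :: 'a list \<Rightarrow> nat)"
proof (rule surjI)
  fix n
  assume s: "surj (code :: 'a \<Rightarrow> nat)"
  have "map code (map (inv_into UNIV (code :: 'a \<Rightarrow> nat)) xs) = xs" for xs
    using s by (induction xs) (simp_all add: surj_f_inv_f)
  then show "code (map (inv_into UNIV (code :: 'a \<Rightarrow> nat)) (list_decode n)) = n"
    by (simp only: code_list_def list_decode_inverse)
qed

lemma surj_code_nat: "surj (code :: nat \<Rightarrow> nat)"
  by (simp add: code_id)

lemma rec_eval_coord:
  "\<exists>F. \<forall>t e. (\<exists>d. valid t e d) \<longrightarrow>
     (\<exists>d. valid t e d \<and> (\<forall>y. rec_eval F [code t, e] y \<longleftrightarrow> y = code d))"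
proof -
  have "surj (code :: coord_table \<Rightarrow> nat)"
    by (intro surj_code_prod surj_code_list surj_code_nat)
  from rec_eval_search[of "\<lambda>x d. valid (fst x) (snd x) d", OF computable_valid this]
  obtain F where "\<forall>x. (\<exists>d. valid (fst x) (snd x) d) \<longrightarrow> (\<exists>d. valid (fst x) (snd x) d \<and>
    (\<forall>y. rec_eval F [code x] y \<longleftrightarrow> y = code d))" ..
  from this[rule_format, of "(_, _)"]
  have F: "\<exists>d. valid t e d \<Longrightarrow> \<exists>d. valid t e d \<and> (\<forall>y. rec_eval F [code (t, e)] y \<longleftrightarrow> y = code d)" for t e
    by simp
  have "total_rec 2 (\<lambda>xs. prod_encode (xs ! 0, xs ! 1))"
    by (intro total_rec_prod_encode total_rec_proj) simp_all
  from rec_eval_precomp[OF this, of F] obtain G where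
    G: "\<And>xs y. length xs = 2 \<Longrightarrow> rec_eval G xs y \<longleftrightarrow> rec_eval F [prod_encode (xs ! 0, xs ! 1)] y" by blast
  have "rec_eval G [code t, e] y \<longleftrightarrow> rec_eval F [code (t, e)] y" for t :: algebra_table and e y
    using G[of "[code t, e]" y] by (simp add: code_Pair)
  then show ?thesis using F by (intro exI[of _ G]) simp
qed

lemma act_append: "act B X s (u @ v) = act B X (act B X s u) v"
  by (induction u arbitrary: s) simp_all

section \<open>Action of single letters on columns\<close>

context indexed_classes begin

lemma act1_eqI:
  assumes l: "l \<in> Jx" and im: "(\<lambda>x. x \<bullet> c [g]) ` Hx o1 j = Hx o1 l"
  shows "act1 B X j g = Some l"
proof -
  from assms have "\<exists>l. l \<in> Jx \<and> (\<lambda>x. x \<bullet> c [g]) ` Hx o1 j = Hx o1 l" by blast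
  then obtain k where k: "act1 B X j g = Some k" unfolding act1_def Let_def by simp
  obtain x where "x \<in> Hx o1 l" using H_nonempty[OF indexes(3) l] by blast
  then have "k = l" using act1_Some[OF k] im l col_unique[of k x l] unfolding Hcl_def by auto
  with k show ?thesis by simp
qed

text \<open>The idempotent \<open>y\<close> is L-related to \<open>x\<close> and R-related to
  \<open>g\<close>, so \<open>x \<bullet> c [g]\<close> stays in its row and moves to the column of
  \<open>g\<close>; going back uses \<open>g y = y\<close> and \<open>x y = x\<close>.\<close>

lemma letter_action:
  assumes g: "g \<in> F" and y: "y \<in> F" and gy: "(c [g], c [y]) \<in> G.R"
    and x: "x \<in> Hx o1 (col (c [y]))"
  shows "x \<bullet> c [g] \<in> Hx o1 (col (c [g]))" "x \<bullet> c [g] \<bullet> c [y] = x"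
proof -
  note gD = F_D[OF g] and yD = F_D[OF y]
  have xD: "x \<in> D" and rx: "row x = o1" and cx: "col x = col (c [y])"
    using x H_iff[OF indexes(3) col(1)[OF yD]] by auto
  have "(c [y], x) \<in> G.L" using Lcl_L[OF col[OF yD]] col(2)[OF xD] cx by simp
  then have xy: "(x, c [y]) \<in> G.L" "x \<bullet> c [y] = x" using G.L_sym G.L_idem(1) F_idem[OF y] by blast+
  have yg: "(c [y], c [g]) \<in> G.R" using gy G.R_sym by blast
  note m = G.mult_through_idem[OF F_idem[OF y] xy(1) yg]
  have "x \<bullet> c [g] \<in> D" "row (x \<bullet> c [g]) = o1" "col (x \<bullet> c [g]) = col (c [g])"
    using m D_R[OF xD] row_eq_iff[OF xD] col_eq_iff[OF gD] rx by auto
  then show "x \<bullet> c [g] \<in> Hx o1 (col (c [g]))" using H_iff[OF indexes(3) col(1)[OF gD]] by blast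
  have "c [g] \<bullet> c [y] = c [y]" using G.R_idem(1)[OF F_idem[OF g] gy] .
  then show "x \<bullet> c [g] \<bullet> c [y] = x" using xy(2) xD gD yD D_C by (simp add: G.assoc)
qed

lemma act1_letter:
  assumes g: "g \<in> F" and y: "y \<in> F" and gy: "(c [g], c [y]) \<in> G.R"
  shows "act1 B X (col (c [y])) g = Some (col (c [g]))"
proof (rule act1_eqI)
  show "col (c [g]) \<in> Jx" using col F_D g by blast
  show "(\<lambda>x. x \<bullet> c [g]) ` Hx o1 (col (c [y])) = Hx o1 (col (c [g]))"
  proof (intro equalityI subsetI)
    fix x assume x: "x \<in> Hx o1 (col (c [g]))"
    note s = letter_action[OF y g G.R_sym[OF gy] x]
    then show "x \<in> (\<lambda>x. x \<bullet> c [g]) ` Hx o1 (col (c [y]))" by force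
  qed (use letter_action(1)[OF assms] in blast)
qed

end

section \<open>Reading Green's relations from the table\<close>

locale presented_class = D_class S B e for S :: "nat sgrp" and B e +
  fixes t :: algebra_table
  assumes presents: "presents t B"
begin

lemma fst_t: "set (fst t) = S.E"
  using presents by (cases t) simp

lemma snd_t: "(a, b, d) \<in> set (snd t) \<longleftrightarrow> a \<in> S.E \<and> b \<in> S.E \<and> star B a b = Some d"
  using presents by (cases t) simp

lemma R_table_iff:
  assumes "a \<in> S.E" "b \<in> S.E" shows "R_table (snd t) a b \<longleftrightarrow> (c [a], c [b]) \<in> G.R"
  using assms by (auto simp: R_table_def snd_t star_B letter_R_iff basic_pair_def)

lemma L_table_iff:
  assumes "a \<in> S.E" "b \<in> S.E" shows "L_table (snd t) a b \<longleftrightarrow> (c [a], c [b]) \<in> G.L"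
  using assms by (auto simp: L_table_def snd_t star_B letter_L_iff basic_pair_def)

end

section \<open>From a valid table to a coordinatization\<close>

locale valid_table = presented_class S B e t for S :: "nat sgrp" and B e t +
  fixes d :: coord_table
  assumes valid: "valid t e d"
begin

abbreviation "ks \<equiv> set (ks_of d)"
abbreviation "bs \<equiv> base_of d"

lemma letters_valid: "letters_valid t e d"
  using valid by (simp add: valid_def)

lemma ks_E:
  assumes "(i, j, a) \<in> ks" shows "i \<in> set (is_of d) \<and> j \<in> set (js_of d) \<and> a \<in> S.E"
proof -
  have "\<forall>p\<in>ks. fst p \<in> set (is_of d) \<and> fst (snd p) \<in> set (js_of d) \<and> snd (snd p) \<in> S.E"
    using letters_valid unfolding letters_valid_def fst_t by (elim conjE)
  from bspec[OF this assms] show ?thesis by simp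
qed

lemma ks_RL:
  assumes "(i, j, a) \<in> ks" "(k, l, b) \<in> ks"
  shows "i = k \<longleftrightarrow> (c [a], c [b]) \<in> G.R" "j = l \<longleftrightarrow> (c [a], c [b]) \<in> G.L"
proof -
  have "\<forall>p\<in>ks. \<forall>p'\<in>ks. (fst p = fst p' \<longleftrightarrow> R_table (snd t) (snd (snd p)) (snd (snd p'))) \<and>
       (fst (snd p) = fst (snd p') \<longleftrightarrow> L_table (snd t) (snd (snd p)) (snd (snd p')))"
    using letters_valid unfolding letters_valid_def by (elim conjE)
  from bspec[OF bspec[OF this assms(1)] assms(2)]
  show "i = k \<longleftrightarrow> (c [a], c [b]) \<in> G.R" "j = l \<longleftrightarrow> (c [a], c [b]) \<in> G.L"
    using ks_E assms R_table_iff L_table_iff by simp_all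
qed

lemmas ks_R = ks_RL(1) and ks_L = ks_RL(2)

lemma ks_base: "(bs, bs, e) \<in> ks"
  using letters_valid unfolding letters_valid_def by (elim conjE)

lemma ks_closed:
  assumes "(i, j, a) \<in> ks" "b \<in> S.E" "(c [a], c [b]) \<in> G.R \<or> (c [a], c [b]) \<in> G.L"
  shows "\<exists>i j. (i, j, b) \<in> ks"
proof -
  have "R_table (snd t) a b \<or> L_table (snd t) a b"
    using assms R_table_iff L_table_iff ks_E by blast
  moreover have "\<forall>p\<in>ks. \<forall>a\<in>set (fst t). R_table (snd t) (snd (snd p)) a \<or> L_table (snd t) (snd (snd p)) a
      \<longrightarrow> is_letter (ks_of d) a"
    using letters_valid unfolding letters_valid_def by (elim conjE)
  note bspec[OF bspec[OF this assms(1)], of b]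
  ultimately have "is_letter (ks_of d) b" using assms(2) fst_t by simp
  then show ?thesis unfolding is_letter_def by force
qed

lemma tables_on: "table_on (rs_of d) (js_of d)" "table_on (rs'_of d) (js_of d)" "table_on (ss_of d) (is_of d)"
  using valid unfolding valid_def by blast+

lemma table_on_lookup:
  assumes "table_on l A" shows "set l = {(k, lookup k l) |k. k \<in> set A}"
proof -
  have "(k, lookup k l) \<in> set l" if "k \<in> set A" for k
  proof -
    obtain p where "p \<in> set l" "fst p = k" using assms \<open>k \<in> set A\<close> unfolding table_on_def by blast
    then have "p \<in> set (filter (\<lambda>p. fst p = k) l)" by simp
    then have "filter (\<lambda>p. fst p = k) l \<noteq> []" by (metis empty_iff empty_set)
    from hd_in_set[OF this] show ?thesis by (auto simp: lookup_def) (metis prod.collapse)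
  qed
  moreover have "p = (fst p, lookup (fst p) l) \<and> fst p \<in> set A" if "p \<in> set l" for p
  proof -
    have A: "fst p \<in> set A" using assms that unfolding table_on_def by blast
    then have "(fst p, lookup (fst p) l) \<in> set l" by (rule calculation)
    with A show ?thesis using assms that unfolding table_on_def by fastforce
  qed
  ultimately show ?thesis by blast
qed

lemmas set_rs = table_on_lookup[OF tables_on(1)]
lemmas set_rs' = table_on_lookup[OF tables_on(2)]
lemmas set_ss = table_on_lookup[OF tables_on(3)]

lemma schreier_cases:
  assumes "(l, w) \<in> set (rs_of d)"
  obtains "l = bs" "w = []" "(bs, []) \<in> set (rs'_of d)"
  | j w0 w0' i g y where "(j, w0) \<in> set (rs_of d)" "(j, w0') \<in> set (rs'_of d)" "(i, l, g) \<in> ks" "(i, j, y) \<in> ks"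
      "w = w0 @ [g]" "(l, y # w0') \<in> set (rs'_of d)"
proof -
  have "schreier_valid d" using valid by (simp add: valid_def)
  from bspec[OF this[unfolded schreier_valid_def] assms]
  consider "(l, w) = (bs, [])" "(bs, []) \<in> set (rs'_of d)"
    | p0 p1 g y where "p0 \<in> set (rs_of d)" "p1 \<in> set (rs'_of d)" "g \<in> ks" "y \<in> ks"
        "fst g = fst y" "fst (snd g) = l" "fst (snd y) = fst p0" "fst p1 = fst p0"
        "w = snd p0 @ [snd (snd g)]" "(l, snd (snd y) # snd p1) \<in> set (rs'_of d)"
    by auto
  then show thesis
  proof cases
    case 1
    then show ?thesis using that(1) by simp
  next
    case (2 p0 p1 g y)
    then show ?thesis
      using that(2)[of "fst p0" "snd p0" "snd p1" "fst g" "snd (snd g)" "snd (snd y)"]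
      by (metis prod.collapse)
  qed
qed

text \<open>Descent along the Schreier words: the last letter \<open>g\<close> of \<open>r_l\<close>
  is R-related to a listed letter \<open>y\<close> in the column of a shorter word. So
  \<open>y\<close> in D puts \<open>g\<close> in D, and with it all listed letters of column
  \<open>l\<close>. The root is the column of \<open>e\<close>.\<close>

lemma letters_subset:
  assumes "(l, w) \<in> set (rs_of d)" "(i, l, a) \<in> ks" shows "a \<in> F"
  using assms
proof (induction "length w" arbitrary: l w i a rule: less_induct)
  case less
  have LF: "a \<in> F" if "(k, l, b) \<in> ks" "b \<in> F" for k b
  proof -
    have "(c [b], c [a]) \<in> G.L" using ks_L[OF that(1) less(3)] by simp
    then show ?thesis using D_L[OF F_D[OF that(2)]] ks_E[OF less(3)] F_iff by blast
  qed
  from less(2) show ?case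
  proof (cases rule: schreier_cases)
    case 1
    then show ?thesis using LF ks_base e_F by blast
  next
    case (2 j w0 w0' i' g y)
    have "y \<in> F" using less(1)[OF _ 2(1,4)] 2(5) by simp
    moreover have "(c [y], c [g]) \<in> G.R" using ks_R[OF 2(4,3)] by simp
    ultimately have "g \<in> F" using D_R F_D ks_E[OF 2(3)] F_iff by blast
    then show ?thesis using LF[OF 2(3)] by blast
  qed
qed

lemma letters: "a \<in> F \<longleftrightarrow> (\<exists>i j. (i, j, a) \<in> ks)"
proof
  assume "\<exists>i j. (i, j, a) \<in> ks"
  then obtain i j where ij: "(i, j, a) \<in> ks" by blast
  then have "(j, lookup j (rs_of d)) \<in> set (rs_of d)" using ks_E set_rs by blast
  with ij show "a \<in> F" using letters_subset by blast
next
  have "\<exists>i j. (i, j, b) \<in> ks" if "connected_letters a b" "a = e" for a b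
    using that
  proof induction
    case (base a)
    then show ?case using ks_base by blast
  next
    case (R_step a b f)
    then show ?case using ks_closed by blast
  next
    case (L_step a b f)
    then show ?case using ks_closed by blast
  qed
  then show "a \<in> F \<Longrightarrow> \<exists>i j. (i, j, a) \<in> ks" using F_connected by blast
qed

text \<open>\<open>presents_coord\<close> mentions \<open>Rcl\<close> and \<open>Lcl\<close> only
  through the idempotents; here they are generated by the listed letters, and by \<open>ks_R\<close>
  and \<open>ks_L\<close> each union is a single class.\<close>

definition X :: "(nat, nat) coord" where
  "X = \<lparr>idxI = set (is_of d), idxJ = set (js_of d), base = bs,
    Rcl = (\<lambda>i. G.R `` {c [a] |a j. (i, j, a) \<in> ks}), Lcl = (\<lambda>j. G.L `` {c [a] |a i. (i, j, a) \<in> ks}),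
    rw = (\<lambda>j. lookup j (rs_of d)), rw' = (\<lambda>j. lookup j (rs'_of d)), jsel = (\<lambda>i. lookup i (ss_of d))\<rparr>"

lemma X_simps [simp]: "idxI X = set (is_of d)" "idxJ X = set (js_of d)" "base X = bs"
  "rw X j = lookup j (rs_of d)" "rw' X j = lookup j (rs'_of d)" "jsel X i = lookup i (ss_of d)"
  by (simp_all add: X_def)

lemma X_R: "(i, j, a) \<in> ks \<Longrightarrow> Rcl X i = G.R `` {c [a]}"
  using ks_R G.R_trans unfolding X_def by auto blast

lemma X_L: "(i, j, a) \<in> ks \<Longrightarrow> Lcl X j = G.L `` {c [a]}"
  using ks_L G.L_trans unfolding X_def by auto blast

lemma ks_row: assumes "i \<in> set (is_of d)" shows "\<exists>j a. (i, j, a) \<in> ks"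
proof -
  have "(i, lookup i (ss_of d)) \<in> set (ss_of d)" using set_ss assms by blast
  then have "in_table (ks_of d) i (lookup i (ss_of d))" using valid unfolding valid_def by fastforce
  then show ?thesis unfolding in_table_def by force
qed

lemma ks_col: assumes "l \<in> set (js_of d)" shows "\<exists>i a. (i, l, a) \<in> ks"
proof -
  have "(l, lookup l (rs_of d)) \<in> set (rs_of d)" using set_rs assms by blast
  then show ?thesis by (cases rule: schreier_cases) (use ks_base in auto)
qed

text \<open>One argument for rows and columns; \<open>T i a\<close> stands for a listed letter
  \<open>a\<close> in the class with index \<open>i\<close>.\<close>

lemma bij_betw_classes:
  assumes "\<And>i. i \<in> A \<Longrightarrow> \<exists>a. T i a"
    and T: "\<And>i a. T i a \<Longrightarrow> i \<in> A \<and> a \<in> F \<and> f i = Q `` {c [a]}"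
    and inj: "\<And>i a k b. T i a \<Longrightarrow> T k b \<Longrightarrow> i = k \<longleftrightarrow> (c [a], c [b]) \<in> Q"
    and rep: "\<And>x. x \<in> D \<Longrightarrow> \<exists>a i. T i a \<and> Q `` {c [a]} = Q `` {x}"
  shows "bij_betw f A {Q `` {x} |x. x \<in> D}"
  unfolding bij_betw_def
proof (intro conjI equalityI subsetI inj_onI)
  fix i k assume "i \<in> A" "k \<in> A" and eq: "f i = f k"
  then obtain a b where ab: "T i a" "T k b" using assms(1) by meson
  then have "(c [a], c [b]) \<in> Q" using T[OF ab(1)] T[OF ab(2)] eq inj[OF ab(2,2)] by auto
  then show "i = k" using inj[OF ab] by simp
next
  fix Y assume "Y \<in> f ` A"
  then obtain i a where "T i a" "Y = f i" using assms(1) by blast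
  then show "Y \<in> {Q `` {x} |x. x \<in> D}" using T F_D by blast
next
  fix Y assume "Y \<in> {Q `` {x} |x. x \<in> D}"
  then obtain i a where "T i a" "Y = Q `` {c [a]}" using rep by blast
  then show "Y \<in> f ` A" using T by blast
qed

lemma X_indexes: "indexes_classes B e X"
  unfolding indexes_classes_def
proof (intro conjI)
  show "bij_betw (Rcl X) (idxI X) {G.R `` {x} |x. x \<in> D}"
  proof (rule bij_betw_classes[where T = "\<lambda>i a. \<exists>j. (i, j, a) \<in> ks"])
    fix x assume "x \<in> D"
    then obtain a where a: "a \<in> F" "(c [a], x) \<in> G.R" using D_R_letter by blast
    then show "\<exists>a i. (\<exists>j. (i, j, a) \<in> ks) \<and> G.R `` {c [a]} = G.R `` {x}"
      using letters G.R_class_eq by blast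
  next
    fix i assume "i \<in> idxI X"
    then show "\<exists>a j. (i, j, a) \<in> ks" using ks_row[of i] by auto
  next
    fix i a assume "\<exists>j. (i, j, a) \<in> ks"
    then obtain j where ij: "(i, j, a) \<in> ks" ..
    then show "i \<in> idxI X \<and> a \<in> F \<and> Rcl X i = G.R `` {c [a]}"
      using X_R[OF ij] ks_E[OF ij] letters by auto
    fix k b assume "\<exists>j. (k, j, b) \<in> ks"
    then show "i = k \<longleftrightarrow> (c [a], c [b]) \<in> G.R" using ks_R[OF ij] by blast
  qed
  show "bij_betw (Lcl X) (idxJ X) {G.L `` {x} |x. x \<in> D}"
  proof (rule bij_betw_classes[where T = "\<lambda>j a. \<exists>i. (i, j, a) \<in> ks"])
    fix x assume "x \<in> D"
    then obtain a where a: "a \<in> F" "(c [a], x) \<in> G.L" using D_L_letter by blast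
    then show "\<exists>a j. (\<exists>i. (i, j, a) \<in> ks) \<and> G.L `` {c [a]} = G.L `` {x}"
      using letters G.L_class_eq by blast
  next
    fix j assume "j \<in> idxJ X"
    then show "\<exists>a i. (i, j, a) \<in> ks" using ks_col[of j] by auto
  next
    fix j a assume "\<exists>i. (i, j, a) \<in> ks"
    then obtain i where ij: "(i, j, a) \<in> ks" ..
    then show "j \<in> idxJ X \<and> a \<in> F \<and> Lcl X j = G.L `` {c [a]}"
      using X_L[OF ij] ks_E[OF ij] letters by auto
    fix k b assume "\<exists>i. (i, k, b) \<in> ks"
    then show "j = k \<longleftrightarrow> (c [a], c [b]) \<in> G.L" using ks_L[OF ij] by blast
  qed
  show "base X \<in> idxI X \<inter> idxJ X" using ks_E[OF ks_base] by simp
  show "c [e] \<in> Hcl X (base X) (base X)"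
    using X_R[OF ks_base] X_L[OF ks_base] G.R_refl G.L_refl D_C[OF e_D] by (simp add: Hcl_def)
qed

sublocale indexed_classes S B e X
  by unfold_locales (rule X_indexes)

lemma ks_H: "(i, j, a) \<in> ks \<Longrightarrow> c [a] \<in> Hx i j"
  using X_R X_L G.R_refl G.L_refl D_C F_D letters unfolding Hcl_def by blast

lemma ks_row_col:
  assumes "(i, j, a) \<in> ks" shows "row (c [a]) = i" "col (c [a]) = j"
  using H_iff[of i j "c [a]"] ks_E[OF assms] ks_H[OF assms] by simp_all

lemma ks_K: "ks = {(i, j, el i j) |i j. (i, j) \<in> K}"
proof (intro equalityI subsetI)
  fix p assume pks: "p \<in> ks"
  obtain i j a where "p = (i, j, a)" by (rule prod_cases3)
  note p = this pks[unfolded this]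
  then have "(i, j) \<in> K" "el i j = a" using F_el[of a] ks_row_col[OF p(2)] letters by auto
  with p(1) show "p \<in> {(i, j, el i j) |i j. (i, j) \<in> K}" by blast
next
  fix p assume "p \<in> {(i, j, el i j) |i j. (i, j) \<in> K}"
  then obtain i j where p: "p = (i, j, el i j)" "(i, j) \<in> K" by blast
  from el(1)[OF p(2)] obtain k l where kl: "(k, l, el i j) \<in> ks" using letters by blast
  then have "k = i" "l = j" using ks_row_col[OF kl] el(3,4)[OF p(2)] by auto
  with kl show "p \<in> ks" using p(1) by simp
qed

lemma presents_X: "presents_coord d B X"
  unfolding presents_coord_iff using ks_K set_rs set_rs' set_ss by simp

text \<open>Passing to a child appends \<open>g\<close> to \<open>r\<close> and puts
  \<open>y\<close> in front of \<open>r'\<close>. In \<open>r r'\<close> the adjacent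
  \<open>g y\<close> cancels first; in \<open>r' r\<close> the words of the parent cancel inside,
  and \<open>y g\<close> is left.\<close>

lemma schreier_rs:
  assumes "(l, w) \<in> set (rs_of d)" "(l, w') \<in> set (rs'_of d)"
  shows "w \<in> lists F \<and> w' \<in> lists F \<and> act B X (Some bs) w = Some l \<and> act B X (Some l) w' = Some bs \<and>
    (\<forall>p. prefix p w \<longrightarrow> (\<exists>k. (k, p) \<in> set (rs_of d))) \<and>
    (\<forall>x\<in>Hx bs bs. word_act B x (w @ w') = x) \<and> (\<forall>x\<in>Hx bs l. word_act B x (w' @ w) = x)"
  using assms
proof (induction "length w" arbitrary: l w w' rule: less_induct)
  case less
  have uniq: "w' = v" if "(l, v) \<in> set (rs'_of d)" for v
    using less(3) that set_rs' by auto
  from less(2) show ?case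
  proof (cases rule: schreier_cases)
    case 1
    have "w' = []" using uniq 1 by simp
    then show ?thesis using 1 less(2) by auto
  next
    case (2 j w0 w0' i g y)
    have w': "w' = y # w0'" using uniq[OF 2(6)] .
    have IH: "w0 \<in> lists F" "w0' \<in> lists F" "act B X (Some bs) w0 = Some j" "act B X (Some j) w0' = Some bs"
      "\<forall>p. prefix p w0 \<longrightarrow> (\<exists>k. (k, p) \<in> set (rs_of d))"
      "\<forall>x\<in>Hx bs bs. word_act B x (w0 @ w0') = x" "\<forall>x\<in>Hx bs j. word_act B x (w0' @ w0) = x"
      using less(1)[OF _ 2(1,2)] 2(5) by auto
    have g: "g \<in> F" "col (c [g]) = l" and y: "y \<in> F" "col (c [y]) = j"
      using 2(3,4) letters ks_row_col by blast+
    have gy: "(c [g], c [y]) \<in> G.R" using ks_R[OF 2(3,4)] by simp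
    note yg = G.R_sym[OF gy]
    have act: "act1 B X j g = Some l" "act1 B X l y = Some j"
      using act1_letter[OF g(1) y(1) gy] act1_letter[OF y(1) g(1) yg] g y by auto
    have E: "w0 \<in> lists S.E" "w0' \<in> lists S.E" "g \<in> S.E" "y \<in> S.E"
      using F_lists[OF IH(1)] F_lists[OF IH(2)] F_E g y by auto
    have HC: "x \<in> G.C" if "x \<in> Hx bs k" for x k
      using H_D[of bs x k] that indexes(3) D_C by simp
    have "w \<in> lists F" "w' \<in> lists F" using 2(5) w' IH(1,2) g y by auto
    moreover have "act B X (Some bs) w = Some l" "act B X (Some l) w' = Some bs"
      using 2(5) w' IH(3,4) act by (simp_all add: act_append)
    moreover have "\<forall>p. prefix p w \<longrightarrow> (\<exists>k. (k, p) \<in> set (rs_of d))"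
      using IH(5) less(2) 2(5) by (auto simp: prefix_snoc)
    moreover have "word_act B x (w @ w') = x" if x: "x \<in> Hx bs bs" for x
    proof -
      let ?x = "word_act B x w0"
      have x1: "?x \<in> Hx bs j"
        using act_Some[of bs w0 j] IH(3) E(1) indexes(4) x by auto
      have "word_act B x (w @ w') = word_act B ?x (g # y # w0')"
        using word_act_append[OF HC[OF x] E(1), of "g # y # w0'"] E 2(5) w' by simp
      also have "\<dots> = word_act B (?x \<bullet> c [g] \<bullet> c [y]) w0'"
        using word_act_Cons[of ?x g "y # w0'"] word_act_Cons[of "?x \<bullet> c [g]" y w0'] E HC[OF x1] cls_in_IG
        by simp
      also have "?x \<bullet> c [g] \<bullet> c [y] = ?x" using letter_action(2)[OF g(1) y(1) gy] x1 y(2) by simp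
      also have "word_act B ?x w0' = word_act B x (w0 @ w0')"
        using word_act_append[OF HC[OF x] E(1,2)] by simp
      also have "\<dots> = x" using IH(6) x by blast
      finally show ?thesis .
    qed
    moreover have "word_act B x (w' @ w) = x" if x: "x \<in> Hx bs l" for x
    proof -
      have s: "x \<bullet> c [y] \<in> Hx bs j" "x \<bullet> c [y] \<bullet> c [g] = x"
        using letter_action[OF y(1) g(1) yg, of x] x g(2) y(2) by simp_all
      have "word_act B x (w' @ w) = word_act B (x \<bullet> c [y]) ((w0' @ w0) @ [g])"
        using word_act_Cons[OF HC[OF x] E(4), of "w0' @ w0 @ [g]"] E 2(5) w' by simp
      also have "\<dots> = word_act B (word_act B (x \<bullet> c [y]) (w0' @ w0)) [g]"
        using word_act_append[OF HC[OF s(1)], of "w0' @ w0" "[g]"] E by simp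
      also have "word_act B (x \<bullet> c [y]) (w0' @ w0) = x \<bullet> c [y]" using IH(7) s(1) by blast
      finally show ?thesis using s(2) by (simp add: word_act_def)
    qed
    ultimately show ?thesis by blast
  qed
qed

lemma coordinatization_X: "coordinatization B e X"
  unfolding coordinatization_def schreier_system_def
proof (intro conjI ballI)
  show "indexes_classes B e X" by (rule X_indexes)
next
  fix i assume "i \<in> idxI X"
  then have "(i, lookup i (ss_of d)) \<in> set (ss_of d)" using set_ss by simp
  then have "in_table (ks_of d) i (lookup i (ss_of d))" using valid unfolding valid_def by fastforce
  then show "(i, jsel X i) \<in> KK B X" using ks_K unfolding in_table_def by auto
next
  fix j assume "j \<in> idxJ X"
  then have "(j, rw X j) \<in> set (rs_of d)" "(j, rw' X j) \<in> set (rs'_of d)"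
    using set_rs set_rs' by auto
  note s = schreier_rs[OF this]
  show "rw X j \<in> lists F" "rw' X j \<in> lists F" "act B X (Some (base X)) (rw X j) = Some j"
    "act B X (Some j) (rw' X j) = Some (base X)"
    unfolding X_simps(3)
    by (rule s[THEN conjunct1] s[THEN conjunct2, THEN conjunct1]
        s[THEN conjunct2, THEN conjunct2, THEN conjunct1]
        s[THEN conjunct2, THEN conjunct2, THEN conjunct2, THEN conjunct1])+
  note s = s[THEN conjunct2, THEN conjunct2, THEN conjunct2, THEN conjunct2]
  show "\<forall>p. prefix p (rw X j) \<longrightarrow> (\<exists>l\<in>idxJ X. p = rw X l)"
  proof (intro allI impI)
    fix p assume "prefix p (rw X j)"
    then obtain k where "(k, p) \<in> set (rs_of d)" using s[THEN conjunct1] by blast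
    then show "\<exists>l\<in>idxJ X. p = rw X l" using set_rs by auto
  qed
  fix x
  show "x \<in> Hcl X (base X) (base X) \<Longrightarrow> word_act B x (rw X j @ rw' X j) = x"
    using s[THEN conjunct2, THEN conjunct1] unfolding X_simps(3) by (rule bspec)
  show "x \<in> Hcl X (base X) j \<Longrightarrow> word_act B x (rw' X j @ rw X j) = x"
    using s[THEN conjunct2, THEN conjunct2] unfolding X_simps(3) by (rule bspec)
qed

end

section \<open>Existence of a valid table\<close>

context presented_class begin

text \<open>Classes are named by letters of their own. As \<open>base\<close> is a common index of
  rows and columns, both classes of \<open>e\<close> must bear the name \<open>e\<close>; any other
  class is named by its least letter.\<close>

definition "rep Q a = (if (c [e], c [a]) \<in> Q then e else LEAST b. b \<in> F \<and> (c [b], c [a]) \<in> Q)"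

abbreviation "rrep \<equiv> rep G.R"
abbreviation "lrep \<equiv> rep G.L"

lemma letter_refl: "a \<in> F \<Longrightarrow> (c [a], c [a]) \<in> G.R" "a \<in> F \<Longrightarrow> (c [a], c [a]) \<in> G.L"
  using G.R_refl G.L_refl D_C F_D by blast+

lemma rep_eq_iff:
  assumes Q: "\<And>a. a \<in> F \<Longrightarrow> (c [a], c [a]) \<in> Q" "\<And>x y. (x, y) \<in> Q \<Longrightarrow> (y, x) \<in> Q"
      "\<And>x y z. (x, y) \<in> Q \<Longrightarrow> (y, z) \<in> Q \<Longrightarrow> (x, z) \<in> Q"
    and F: "a \<in> F" "b \<in> F"
  shows "rep Q a = rep Q b \<longleftrightarrow> (c [a], c [b]) \<in> Q"
proof
  have rep: "(c [rep Q a], c [a]) \<in> Q" if "a \<in> F" for a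
    using LeastI[of "\<lambda>b. b \<in> F \<and> (c [b], c [a]) \<in> Q" a] that Q(1) by (simp add: rep_def)
  assume "rep Q a = rep Q b"
  then show "(c [a], c [b]) \<in> Q" using Q(3)[OF Q(2)[OF rep[OF F(1)]]] rep[OF F(2)] by simp
next
  assume ab: "(c [a], c [b]) \<in> Q"
  have "(x, c [a]) \<in> Q \<longleftrightarrow> (x, c [b]) \<in> Q" for x
    using Q(3)[OF _ ab] Q(3)[OF _ Q(2)[OF ab]] by blast
  then show "rep Q a = rep Q b" by (simp add: rep_def)
qed

lemma rrep_eq_iff: "a \<in> F \<Longrightarrow> b \<in> F \<Longrightarrow> rrep a = rrep b \<longleftrightarrow> (c [a], c [b]) \<in> G.R"
  by (rule rep_eq_iff[OF letter_refl(1) G.R_sym G.R_trans])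

lemma lrep_eq_iff: "a \<in> F \<Longrightarrow> b \<in> F \<Longrightarrow> lrep a = lrep b \<longleftrightarrow> (c [a], c [b]) \<in> G.L"
  by (rule rep_eq_iff[OF letter_refl(2) G.L_sym G.L_trans])

lemma rep_e: "rrep e = e" "lrep e = e"
  using letter_refl[OF e_F] by (simp_all add: rep_def)

lemma finite_F: "finite F"
  using fst_t by (auto simp: ED_def intro: finite_subset[of _ "set (fst t)"])

text \<open>Partial Schreier systems as triples of a column and its words \<open>r\<close> and
  \<open>r'\<close>. A new column is entered by an R-step from \<open>y\<close> to \<open>g\<close>,
  recorded as \<open>g\<close> in \<open>r\<close> and as the undoing \<open>y\<close> in
  \<open>r'\<close>.\<close>

inductive schreier_tree :: "(nat \<times> nat list \<times> nat list) set \<Rightarrow> bool" where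
  root: "schreier_tree {(e, [], [])}"
| grow: "schreier_tree T \<Longrightarrow> (lrep y, w, w') \<in> T \<Longrightarrow> g \<in> F \<Longrightarrow> y \<in> F \<Longrightarrow> (c [g], c [y]) \<in> G.R \<Longrightarrow>
    lrep g \<notin> fst ` T \<Longrightarrow> schreier_tree (insert (lrep g, w @ [g], y # w') T)"

lemma schreier_tree_props:
  "schreier_tree T \<Longrightarrow> finite T \<and> inj_on fst T \<and> fst ` T \<subseteq> lrep ` F \<and> (e, [], []) \<in> T \<and>
    (\<forall>p\<in>T. p = (e, [], []) \<or> (\<exists>y w w' g. (lrep y, w, w') \<in> T \<and> g \<in> F \<and> y \<in> F \<and>
       (c [g], c [y]) \<in> G.R \<and> p = (lrep g, w @ [g], y # w')))"
proof (induction rule: schreier_tree.induct)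
  case root
  have "e \<in> lrep ` F" using rep_e e_F by force
  then show ?case by simp
next
  case (grow T y w w' g)
  then show ?case by (auto 0 4)
qed

text \<open>While a column is missing, some chain of letters from \<open>e\<close> leaves the
  columns reached so far. L-steps stay in their column, so it leaves by an R-step, and that step
  extends the tree.\<close>

lemma schreier_tree_complete:
  "schreier_tree T \<Longrightarrow> \<exists>T'. schreier_tree T' \<and> lrep ` F \<subseteq> fst ` T'"
proof (induction "card (lrep ` F - fst ` T)" arbitrary: T rule: less_induct)
  case less
  note props = schreier_tree_props[OF less(2)]
  show ?case
  proof (cases "lrep ` F \<subseteq> fst ` T")
    case False
    have "\<exists>y\<in>F. \<exists>g\<in>F. (c [g], c [y]) \<in> G.R \<and> lrep y \<in> fst ` T \<and> lrep g \<notin> fst ` T"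
    proof (rule ccontr)
      assume *: "\<not> ?thesis"
      have "lrep b \<in> fst ` T" if "connected_letters a b" "a = e" for a b
        using that
      proof (induction rule: connected_letters.induct)
        case (base a)
        then show ?case using props rep_e by force
      next
        case (R_step a b f)
        have "b \<in> F" "f \<in> F" "(c [f], c [b]) \<in> G.R"
          using connected_in_F[OF R_step(1)] connected_in_F[OF connected_letters.R_step[OF R_step(1-3)]]
            R_step e_F G.R_sym by auto
        then show ?case using * R_step by blast
      next
        case (L_step a b f)
        have bf: "b \<in> F" "f \<in> F"
          using connected_in_F[OF L_step(1)] connected_in_F[OF connected_letters.L_step[OF L_step(1-3)]]
            L_step e_F by auto
        then show ?case using lrep_eq_iff[OF bf] L_step by simp
      qed
      then show False using False F_connected by blast
    qed
    then obtain y g where yg: "y \<in> F" "g \<in> F" "(c [g], c [y]) \<in> G.R" "lrep y \<in> fst ` T" "lrep g \<notin> fst ` T"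
      by blast
    then obtain w w' where w: "(lrep y, w, w') \<in> T" by force
    let ?T = "insert (lrep g, w @ [g], y # w') T"
    have tree: "schreier_tree ?T" using grow[OF less(2) w yg(2,1,3,5)] .
    have "lrep ` F - fst ` ?T \<subset> lrep ` F - fst ` T" using yg(2,5) by auto
    then have "card (lrep ` F - fst ` ?T) < card (lrep ` F - fst ` T)"
      using finite_F by (intro psubset_card_mono) auto
    from less(1)[OF this tree] show ?thesis .
  qed (use less(2) in blast)
qed

lemma ex_valid: "\<exists>d. valid t e d"
proof -
  obtain T where tree: "schreier_tree T" and full: "lrep ` F \<subseteq> fst ` T"
    using schreier_tree_complete[OF root] by blast
  note props = schreier_tree_props[OF tree]
  \<comment> \<open>Any letter of row \<open>i\<close> will do: its column meets the row in a group
    H-class.\<close>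
  define ss where "ss = (\<lambda>i. (i, lrep (SOME a. a \<in> F \<and> rrep a = i))) ` rrep ` F"
  have fin: "finite T" "finite ss" using props finite_F by (auto simp: ss_def)
  obtain is' where is': "set is' = rrep ` F" using finite_list[OF finite_imageI[OF finite_F]] by metis
  obtain js where js: "set js = lrep ` F" using finite_list[OF finite_imageI[OF finite_F]] by metis
  obtain ks where ks: "set ks = (\<lambda>a. (rrep a, lrep a, a)) ` F" using finite_list[OF finite_imageI[OF finite_F]] by metis
  obtain rs where rs: "set rs = (\<lambda>p. (fst p, fst (snd p))) ` T" using finite_list[OF finite_imageI[OF fin(1)]] by metis
  obtain rs' where rs': "set rs' = (\<lambda>p. (fst p, snd (snd p))) ` T" using finite_list[OF finite_imageI[OF fin(1)]] by metis
  obtain sl where sl: "set sl = ss" using finite_list[OF fin(2)] by metis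
  define d :: coord_table where "d = (is', js, e, ks, rs, rs', sl)"
  have "letters_valid t e d"
  proof -
    have closed: "b \<in> F" if "a \<in> F" "b \<in> S.E" "(c [a], c [b]) \<in> G.R \<or> (c [a], c [b]) \<in> G.L" for a b
      using that(2,3) D_R[OF F_D[OF that(1)], of "c [b]"] D_L[OF F_D[OF that(1)], of "c [b]"]
      by (auto simp: F_iff)
    have letter: "is_letter ks a \<longleftrightarrow> a \<in> F" for a unfolding is_letter_def ks by auto
    have RL: "R_table (snd t) a b \<longleftrightarrow> (c [a], c [b]) \<in> G.R" "L_table (snd t) a b \<longleftrightarrow> (c [a], c [b]) \<in> G.L"
      if "a \<in> F" "b \<in> S.E" for a b
      using R_table_iff L_table_iff F_E that by simp_all
    have d_simps: "ks_of d = ks" "is_of d = is'" "js_of d = js" "base_of d = e" by (simp_all add: d_def)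
    show ?thesis unfolding letters_valid_def d_simps fst_t
    proof (intro conjI ballI impI)
      fix p assume "p \<in> set ks"
      then obtain a where a: "a \<in> F" "p = (rrep a, lrep a, a)" using ks by blast
      then show "fst p \<in> set is'" "fst (snd p) \<in> set js" "snd (snd p) \<in> S.E"
        using is' js F_E by simp_all
      show "is_letter ks b" if b: "b \<in> S.E"
          "R_table (snd t) (snd (snd p)) b \<or> L_table (snd t) (snd (snd p)) b" for b
        unfolding letter using closed[OF a(1) b(1)] RL[OF a(1) b(1)] b(2) a(2) by simp
      fix p' assume "p' \<in> set ks"
      then obtain b where b: "b \<in> F" "p' = (rrep b, lrep b, b)" using ks by blast
      show "fst p = fst p' \<longleftrightarrow> R_table (snd t) (snd (snd p)) (snd (snd p'))"
        "fst (snd p) = fst (snd p') \<longleftrightarrow> L_table (snd t) (snd (snd p)) (snd (snd p'))"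
        using a b RL[OF a(1) F_E[OF b(1)]] rrep_eq_iff lrep_eq_iff by simp_all
    next
      have "(rrep e, lrep e, e) \<in> set ks" using ks e_F by blast
      then show "(e, e, e) \<in> set ks" using rep_e by simp
    qed
  qed
  moreover have "schreier_valid d" unfolding schreier_valid_def
  proof
    fix p assume "p \<in> set (rs_of d)"
    then obtain q where q: "q \<in> T" "p = (fst q, fst (snd q))" by (auto simp: d_def rs)
    then consider "q = (e, [], [])"
      | y w w' g where "(lrep y, w, w') \<in> T" "g \<in> F" "y \<in> F" "(c [g], c [y]) \<in> G.R"
        "q = (lrep g, w @ [g], y # w')" using props by blast
    then show "p = (base_of d, []) \<and> (base_of d, []) \<in> set (rs'_of d) \<or>
     (\<exists>p0\<in>set (rs_of d). \<exists>p1\<in>set (rs'_of d). \<exists>g\<in>set (ks_of d). \<exists>y\<in>set (ks_of d).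
        fst g = fst y \<and> fst (snd g) = fst p \<and> fst (snd y) = fst p0 \<and> fst p1 = fst p0 \<and>
        snd p = snd p0 @ [snd (snd g)] \<and> (fst p, snd (snd y) # snd p1) \<in> set (rs'_of d))"
    proof cases
      case 1
      then show ?thesis using q by (force simp: d_def rs')
    next
      case (2 y w w' g)
      have "(lrep y, w) \<in> set (rs_of d)" "(lrep y, w') \<in> set (rs'_of d)"
        "(rrep g, lrep g, g) \<in> set (ks_of d)" "(rrep y, lrep y, y) \<in> set (ks_of d)"
        "(lrep g, y # w') \<in> set (rs'_of d)" "rrep g = rrep y"
        using 2 q by (force simp: d_def rs rs' ks rrep_eq_iff)+
      then show ?thesis using 2(5) q(2)
        by (intro disjI2 bexI[of _ "(lrep y, w)"] bexI[of _ "(lrep y, w')"]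
            bexI[of _ "(rrep g, lrep g, g)"] bexI[of _ "(rrep y, lrep y, y)"]) simp_all
    qed
  qed
  moreover have "table_on (rs_of d) (js_of d)" "table_on (rs'_of d) (js_of d)"
    using props full unfolding table_on_def d_def by (force simp: js rs rs' inj_on_def)+
  moreover have "table_on (ss_of d) (is_of d)"
    unfolding table_on_def d_def by (auto simp: is' sl ss_def)
  moreover have "in_table (ks_of d) (fst p) (snd p)" if "p \<in> set (ss_of d)" for p
  proof -
    from that obtain b where b: "b \<in> F" "p = (rrep b, lrep (SOME a. a \<in> F \<and> rrep a = rrep b))"
      by (auto simp: d_def sl ss_def)
    define a where "a = (SOME a. a \<in> F \<and> rrep a = rrep b)"
    have "a \<in> F \<and> rrep a = rrep b" unfolding a_def by (rule someI[of _ b]) (use b in simp)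
    then show ?thesis using b(2) unfolding a_def[symmetric] in_table_def by (force simp: d_def ks)
  qed
  ultimately show ?thesis unfolding valid_def by blast
qed

end

lemma D_class_exists:
  assumes "biordered_set B" "e \<in> carrier B" "Dcl B e = Jcl B e"
    "completely_0_simple (principal_factor (IG B) (Dcl B e)) None"
  obtains S where "D_class S B e"
proof -
  from assms(1) obtain S where S: "is_semigroup S" "B = biordered_set_of S"
    by (auto simp: biordered_set_def)
  then have "D_class S B e"
    using assms(2-4) by unfold_locales (simp_all add: biordered_set_of_def)
  then show thesis by (rule that)
qed

theorem lemma4p3:
  shows "(\<forall>(B :: 'a partial_algebra) e (X :: ('a, 'i) coord).
            biordered_set B \<and> e \<in> carrier B \<and> Dcl B e = Jcl B e \<and>
            completely_0_simple (principal_factor (IG B) (Dcl B e)) None \<and>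
            coordinatization B e X \<longrightarrow>
            (let D0 = principal_factor (IG B) (Dcl B e);
                 M0 = rees_matrix (HG B e X) (idxI X) (idxJ X) (sandwich B e X)
             in \<exists>\<Phi> \<Psi>.
                  induces (pi_dom B e) (rho_dom B X) (pi_map B X) (cls B) (triple_val B e X) D0 \<Phi> \<and>
                  induces (rho_dom B X) (pi_dom B e) (rho_map B e X) (triple_val B e X) (cls B) M0 \<Psi> \<and>
                  sgrp_iso D0 M0 \<Phi> \<and> sgrp_iso M0 D0 \<Psi> \<and>
                  (\<forall>x\<in>carrier D0. \<Psi> (\<Phi> x) = x) \<and> (\<forall>y\<in>carrier M0. \<Phi> (\<Psi> y) = y)))
       \<and>
         (\<exists>F_coord F_pi F_rho. \<forall>(B :: nat partial_algebra) t e.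
            biordered_set B \<and> finite (carrier B) \<and> presents t B \<and>
            e \<in> carrier B \<and> Dcl B e = Jcl B e \<and>
            completely_0_simple (principal_factor (IG B) (Dcl B e)) None \<longrightarrow>
            (\<exists>X d. coordinatization B e X \<and> presents_coord d B X \<and>
                   (\<forall>y. rec_eval F_coord [enc_algebra t, e] y \<longleftrightarrow> y = enc_coord d)) \<and>
            (\<forall>X d. coordinatization B e X \<and> presents_coord d B X \<longrightarrow>
                   computes_on F_pi [enc_algebra t, e, enc_coord d] enc_word enc_triple
                     (pi_dom B e) (pi_map B X) \<and>
                   computes_on F_rho [enc_algebra t, e, enc_coord d] enc_triple enc_word
                     (rho_dom B X) (rho_map B e X)))"
proof (rule conjI, goal_cases)
  case 1
  show ?case
    unfolding Let_def
  proof (intro allI impI, elim conjE)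
    fix B :: "'a partial_algebra" and e and X :: "('a, 'i) coord"
    assume *: "biordered_set B" "e \<in> carrier B" "Dcl B e = Jcl B e"
      "completely_0_simple (principal_factor (IG B) (Dcl B e)) None" and X: "coordinatization B e X"
    obtain S where "D_class S B e" using D_class_exists[OF *] .
    then interpret D_class S B e .
    interpret coordinates S B e X
      using X by unfold_locales (simp_all add: coordinatization_def)
    show "\<exists>\<Phi> \<Psi>.
        induces (pi_dom B e) (rho_dom B X) (pi_map B X) (cls B) (triple_val B e X) D0 \<Phi> \<and>
        induces (rho_dom B X) (pi_dom B e) (rho_map B e X) (triple_val B e X) (cls B) M0 \<Psi> \<and>
        sgrp_iso D0 M0 \<Phi> \<and> sgrp_iso M0 D0 \<Psi> \<and>
        (\<forall>x\<in>carrier D0. \<Psi> (\<Phi> x) = x) \<and> (\<forall>y\<in>carrier M0. \<Phi> (\<Psi> y) = y)"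
      using pi_induces rho_induces Phi_iso Psi_iso Psi_Phi Phi_Psi by blast
  qed
next
  case 2
  \<comment> \<open>The three machines are fixed before \<open>B\<close>, \<open>t\<close> and
    \<open>e\<close>, so the same programs serve all finite biordered sets.\<close>
  have "\<exists>F. \<forall>t (e :: nat) d v y. rec_eval F [t, code e, code d, code v] y \<longleftrightarrow>
      pi_defined (ks_of d) v \<and> y = code (pi_table (ks_of d) v)"
    by (rule rec_eval_guarded4) (intro computable_comp2[OF computable_pi_defined]
        computable_comp2[OF computable_pi_table] computable_intros)+
  then obtain F_pi where F_pi: "\<And>t e d v y. rec_eval F_pi [t, code (e :: nat), code d, code v] y \<longleftrightarrow>
      pi_defined (ks_of d) v \<and> y = code (pi_table (ks_of d) v)" by blast
  have "\<exists>F. \<forall>t e d v y. rec_eval F [t, code e, code d, code v] y \<longleftrightarrow>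
      rho_defined d v \<and> y = code (rho_table e d v)"
    by (rule rec_eval_guarded4) (intro computable_comp2[OF computable_rho_defined]
        computable_rho_table computable_intros)+
  then obtain F_rho where F_rho: "\<And>t e d v y. rec_eval F_rho [t, code e, code d, code v] y \<longleftrightarrow>
      rho_defined d v \<and> y = code (rho_table e d v)" by blast
  obtain F_coord where F_coord: "\<forall>t e. (\<exists>d. valid t e d) \<longrightarrow>
      (\<exists>d. valid t e d \<and> (\<forall>y. rec_eval F_coord [code t, e] y \<longleftrightarrow> y = code d))"
    using rec_eval_coord ..
  show ?case
  proof (rule exI[of _ F_coord], rule exI[of _ F_pi], rule exI[of _ F_rho], intro allI impI, elim conjE,
      intro conjI allI impI, goal_cases)
    case (1 B t e)
    obtain S where "D_class S B e" using D_class_exists[OF 1(1,4,5,6)] .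
    then interpret D_class S B e .
    interpret presented_class S B e t by unfold_locales (rule 1(3))
    obtain d where d: "valid t e d" "\<forall>y. rec_eval F_coord [code t, e] y \<longleftrightarrow> y = code d"
      using F_coord ex_valid by blast
    interpret valid_table S B e t d by unfold_locales (rule d(1))
    show ?case using coordinatization_X presents_X d(2) unfolding enc_code by blast
  next
    case (2 B t e X d)
    obtain S where "D_class S B e" using D_class_exists[OF 2(1,4,5,6)] .
    then interpret D_class S B e .
    interpret presented_coordinates S B e X d
      using 2(7) by unfold_locales (simp_all add: coordinatization_def)
    show ?case
      using F_pi[of "code t" e d] pi_defined pi_table by (auto simp: computes_on_def enc_code)
  next
    case (3 B t e X d)
    obtain S where "D_class S B e" using D_class_exists[OF 3(1,4,5,6)] .
    then interpret D_class S B e .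
    interpret presented_coordinates S B e X d
      using 3(7) by unfold_locales (simp_all add: coordinatization_def)
    show ?case
      using F_rho[of "code t" e d] rho_defined rho_table by (auto simp: computes_on_def enc_code)
  qed
qed

end
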